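(* Let $(B_t)_{t\ge0}$ be the $1$-dimensional $G$-Brownian motion with $G(\alpha)=\frac12(\bar\sigma^2\alpha^+-\underline\sigma^2\alpha^-)$, $0\le\underline\sigma\le\bar\sigma<\infty$, and let $\langle B\rangle$ be its quadratic variation process. For each fixed $s,t\ge0$, the increment $\langle B\rangle_{s+t}-\langle B\rangle_s$ is identically distributed with $\langle B\rangle_t$ and is independent from $\Omega_s$.
   Context: $C_{l.Lip}(\mathbb{R}^n)$: functions $\varphi:\mathbb{R}^n\to\mathbb{R}$ with $|\varphi(x)-\varphi(y)|\le C(1+|x|^m+|y|^m)|x-y|$ for some $C>0$, $m\in\mathbb{N}$. $C_{b.Lip}(\mathbb{R}^n)$: bounded Lipschitz functions. Sublinear expectation space $(\tilde\Omega,\tilde{\mathcal{H}},\tilde{\mathbb{E}})$: $\tilde{\mathcal{H}}$ is a linear space of real functions on the set $\tilde\Omega$ containing constants and stable under $|\cdot|$ and under composition with $C_{l.Lip}$ functions; $\tilde{\mathbb{E}}:\tilde{\mathcal{H}}\to\mathbb{R}$ is monotone, constant preserving, subadditive and positively homogeneous. $X\overset{d}{=}Y$ means equality of the expectations of $\varphi(X)$ and $\varphi(Y)$ for all $\varphi\in C_{l.Lip}$; $Y$ is independent from $X$ if $\tilde{\mathbb{E}}[\varphi(X,Y)]=\tilde{\mathbb{E}}[\tilde{\mathbb{E}}[\varphi(x,Y)]_{x=X}]$ for all $\varphi\in C_{l.Lip}$. A real random variable $\xi$ is $G$-normal if $a\xi+b\bar\xi\overset{d}{=}\sqrt{a^2+b^2}\,\xi$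 for all $a,b\ge0$, $\bar\xi$ being an independent copy of $\xi$, and $\frac12\tilde{\mathbb{E}}[\alpha\xi^2]=G(\alpha)$ for all $\alpha\in\mathbb{R}$. $G$-expectation (dimension $1$): $\Omega$ is the space of continuous paths $\omega:[0,\infty)\to\mathbb{R}$ with $\omega_0=0$, $B_t(\omega)=\omega_t$; $L_{ip}(\Omega)$ is the space of all $\varphi(B_{t_1},\dots,B_{t_n})$, $n\in\mathbb{N}$, $t_i\ge0$, $\varphi\in C_{l.Lip}(\mathbb{R}^n)$, and $L_{ip}(\Omega_t)$ the subspace with all $t_i\le t$. Let $\xi_1,\xi_2,\dots$ be $G$-normal random variables on a sublinear expectation space $(\tilde\Omega,\tilde{\mathcal{H}},\tilde{\mathbb{E}})$ with $\xi_{i+1}$ independent from $(\xi_1,\dots,\xi_i)$. For $0=t_0<t_1<\dots<t_n$, $$\hat{\mathbb{E}}[\varphi(B_{t_1}-B_{t_0},\dots,B_{t_n}-B_{t_{n-1}})]:=\tilde{\mathbb{E}}[\varphi(\sqrt{t_1-t_0}\,\xi_1,\dots,\sqrt{t_n-t_{n-1}}\,\xi_n)],$$ and $\hat{\mathbb{E}}[\varphi(B_{t_1}-B_{t_0},\dots,B_{t_n}-B_{t_{n-1}})|\Omega_{t_j}]:=\psi(B_{t_1}-B_{t_0},\dots,B_{t_j}-B_{t_{j-1}})$ with $\psi(x_1,\dots,x_j)=\tilde{\mathbb{E}}[\varphi(x_1,\dots,x_j,\sqrt{t_{j+1}-t_j}\,\xi_{j+1},\dots,\sqrt{t_n-t_{n-1}}\,\xi_n)]$.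 The canonical process $B$ under $\hat{\mathbb{E}}$ is the $G$-Brownian motion. $L_G^p(\Omega)$, $L_G^p(\Omega_t)$ are the completions of $L_{ip}(\Omega)$, $L_{ip}(\Omega_t)$ under $\|X\|_p=(\hat{\mathbb{E}}[|X|^p])^{1/p}$, $p\ge1$; $\hat{\mathbb{E}}$ and $\hat{\mathbb{E}}[\cdot|\Omega_t]:L_G^1(\Omega)\to L_G^1(\Omega_t)$ are the continuous extensions. Integral: $M_G^{2,0}(0,T)$ is the set of $\eta_t=\sum_{k=0}^{N-1}\xi_k\mathbf{1}_{[t_k,t_{k+1})}(t)$ with $0=t_0<\dots<t_N=T$, $\xi_k\in L_G^2(\Omega_{t_k})$, and $M_G^2(0,T)$ its completion under $(\hat{\mathbb{E}}[\int_0^T|\eta_t|^2dt])^{1/2}$; $\int_0^T\eta_tdB_t:=\sum_k\xi_k(B_{t_{k+1}}-B_{t_k})$ on $M_G^{2,0}(0,T)$ extends continuously to $M_G^2(0,T)\to L_G^2(\Omega_T)$. The quadratic variation process is $\langle B\rangle_t:=B_t^2-2\int_0^tB_sdB_s$, which is also the $L_G^2(\Omega)$-limit of $\sum_j(B_{t_{j+1}^N}-B_{t_j^N})^2$ over partitions of $[0,t]$ with mesh tending to $0$. For elements of $L_G^1(\Omega)$, "identically distributed" means $\hat{\mathbb{E}}[\varphi(X)]=\hat{\mathbb{E}}[\varphi(Y)]$ for all $\varphi\in C_{b.Lip}(\mathbb{R})$, and $Y$ is independent from $\Omega_s$ if $\hat{\mathbb{E}}[\varphi(Y)|\Omega_s]=\hat{\mathbb{E}}[\varphi(Y)]$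 for all $\varphi\in C_{b.Lip}(\mathbb{R})$. *)

theory Defs
  imports "HOL-Analysis.Analysis"
begin

subsection \<open>Test functions and sublinear expectation spaces\<close>

text \<open>A point of \<open>\<real>\<^sup>n\<close>, with \<open>n\<close> varying, is a real list of length \<open>n\<close>; \<^const>\<open>L2_set\<close> over
  \<open>{..<n}\<close> is its Euclidean norm.  Only the values of \<open>\<phi>\<close> on lists of length \<open>n\<close> are constrained.\<close>

definition ClLip :: "nat \<Rightarrow> (real list \<Rightarrow> real) set" where
  "ClLip n = {\<phi>. \<exists>C>0. \<exists>m::nat. \<forall>x y. length x = n \<longrightarrow> length y = n \<longrightarrow>
     \<bar>\<phi> x - \<phi> y\<bar> \<le> C * (1 + L2_set (\<lambda>i. x ! i) {..<n} ^ m + L2_set (\<lambda>i. y ! i) {..<n} ^ m)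
                    * L2_set (\<lambda>i. x ! i - y ! i) {..<n}}"

definition CbLip :: "(real \<Rightarrow> real) set" where
  "CbLip = {\<phi>. bounded (range \<phi>) \<and> (\<exists>L. L-lipschitz_on UNIV \<phi>)}"

definition vec_at :: "('a \<Rightarrow> real) list \<Rightarrow> 'a \<Rightarrow> real list" where
  "vec_at Xs \<omega> = map (\<lambda>X. X \<omega>) Xs"

text \<open>The underlying set is the whole type \<open>'a\<close>.  \<open>E\<close> is a total HOL function, but only its values
  on \<open>H\<close> matter.\<close>

locale sublinear_expectation_space =
  fixes H :: "('a \<Rightarrow> real) set" and E :: "('a \<Rightarrow> real) \<Rightarrow> real"
  assumes add_closed: "X \<in> H \<Longrightarrow> Y \<in> H \<Longrightarrow> (\<lambda>\<omega>. X \<omega> + Y \<omega>) \<in> H"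
    and scale_closed: "X \<in> H \<Longrightarrow> (\<lambda>\<omega>. c * X \<omega>) \<in> H"
    and const_closed: "(\<lambda>_. c) \<in> H"
    and abs_closed: "X \<in> H \<Longrightarrow> (\<lambda>\<omega>. \<bar>X \<omega>\<bar>) \<in> H"
    and comp_closed: "set Xs \<subseteq> H \<Longrightarrow> \<phi> \<in> ClLip (length Xs) \<Longrightarrow> (\<lambda>\<omega>. \<phi> (vec_at Xs \<omega>)) \<in> H"
    and mono: "X \<in> H \<Longrightarrow> Y \<in> H \<Longrightarrow> (\<And>\<omega>. X \<omega> \<le> Y \<omega>) \<Longrightarrow> E X \<le> E Y"
    and const_preserving: "E (\<lambda>_. c) = c"
    and subadditive: "X \<in> H \<Longrightarrow> Y \<in> H \<Longrightarrow> E (\<lambda>\<omega>. X \<omega> + Y \<omega>) \<le> E X + E Y"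
    and pos_homogeneous: "X \<in> H \<Longrightarrow> 0 \<le> c \<Longrightarrow> E (\<lambda>\<omega>. c * X \<omega>) = c * E X"

definition eq_in_distr ::
    "(('a \<Rightarrow> real) \<Rightarrow> real) \<Rightarrow> ('a \<Rightarrow> real) \<Rightarrow> ('a \<Rightarrow> real) \<Rightarrow> bool" where
  "eq_in_distr E X Y \<longleftrightarrow> (\<forall>\<phi> \<in> ClLip 1. E (\<lambda>\<omega>. \<phi> [X \<omega>]) = E (\<lambda>\<omega>. \<phi> [Y \<omega>]))"

text \<open>\<open>independent_from E Xs Y\<close>: the random variable \<open>Y\<close> is independent from the random vector
  \<open>Xs\<close>; this relation is not symmetric.\<close>

definition independent_from ::
    "(('a \<Rightarrow> real) \<Rightarrow> real) \<Rightarrow> ('a \<Rightarrow> real) list \<Rightarrow> ('a \<Rightarrow> real) \<Rightarrow> bool" where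
  "independent_from E Xs Y \<longleftrightarrow> (\<forall>\<phi> \<in> ClLip (length Xs + 1).
     E (\<lambda>\<omega>. \<phi> (vec_at Xs \<omega> @ [Y \<omega>])) = E (\<lambda>\<omega>. E (\<lambda>\<omega>'. \<phi> (vec_at Xs \<omega> @ [Y \<omega>']))))"

text \<open>The independent copy is required to exist in \<open>H\<close>: a universal quantifier over the copies
  would make the stability condition void on spaces without any.  The joint law of \<open>(X, X')\<close> is
  determined by the law of \<open>X\<close>, so the choice of the copy is immaterial.\<close>

definition G_normal ::
    "('a \<Rightarrow> real) set \<Rightarrow> (('a \<Rightarrow> real) \<Rightarrow> real) \<Rightarrow> (real \<Rightarrow> real) \<Rightarrow> ('a \<Rightarrow> real) \<Rightarrow> bool" where
  "G_normal H E G X \<longleftrightarrow> X \<in> H \<and>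
     (\<exists>X'\<in>H. eq_in_distr E X' X \<and> independent_from E [X] X' \<and>
        (\<forall>a\<ge>0. \<forall>b\<ge>0. eq_in_distr E (\<lambda>\<omega>. a * X \<omega> + b * X' \<omega>) (\<lambda>\<omega>. sqrt (a\<^sup>2 + b\<^sup>2) * X \<omega>))) \<and>
     (\<forall>\<alpha>. 1/2 * E (\<lambda>\<omega>. \<alpha> * (X \<omega>)\<^sup>2) = G \<alpha>)"

definition G_fun :: "real \<Rightarrow> real \<Rightarrow> real \<Rightarrow> real" where
  "G_fun \<sigma>_lo \<sigma>_hi \<alpha> = 1/2 * (\<sigma>_hi\<^sup>2 * max \<alpha> 0 - \<sigma>_lo\<^sup>2 * max (- \<alpha>) 0)"


subsection \<open>Path space and cylinder functions\<close>

text \<open>Paths are continuous functions on \<open>[0,\<infinity>)\<close>; the value \<open>0\<close> at negative times only makes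
  the representation by functions on the whole line unique.\<close>

typedef cpath = "{w :: real \<Rightarrow> real. continuous_on {0..} w \<and> w 0 = 0 \<and> (\<forall>t<0. w t = 0)}"
  morphisms path_at Abs_cpath
  by (rule exI[of _ "\<lambda>_. 0"]) simp

definition B :: "real \<Rightarrow> cpath \<Rightarrow> real" where
  "B t \<omega> = path_at \<omega> t"

definition Lip_upto :: "real \<Rightarrow> (cpath \<Rightarrow> real) set" where
  "Lip_upto T = {\<lambda>\<omega>. \<phi> (map (\<lambda>t. B t \<omega>) ts) | \<phi> ts.
     (\<forall>t\<in>set ts. 0 \<le> t \<and> t \<le> T) \<and> \<phi> \<in> ClLip (length ts)}"

definition Lip :: "(cpath \<Rightarrow> real) set" where
  "Lip = {\<lambda>\<omega>. \<phi> (map (\<lambda>t. B t \<omega>) ts) | \<phi> ts. (\<forall>t\<in>set ts. 0 \<le> t) \<and> \<phi> \<in> ClLip (length ts)}"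

text \<open>A grid \<open>[t\<^sub>0, \<dots>, t\<^sub>n]\<close> with \<open>0 = t\<^sub>0 < \<dots> < t\<^sub>n\<close> has length \<open>n + 1\<close>, hence the \<open>length ts - 1\<close>
  below; \<open>[0]\<close> is the only grid with last point \<open>0\<close>.\<close>

definition grid :: "real list \<Rightarrow> bool" where
  "grid ts \<longleftrightarrow> ts \<noteq> [] \<and> hd ts = 0 \<and> sorted_wrt (<) ts"

definition increments :: "real list \<Rightarrow> cpath \<Rightarrow> real list" where
  "increments ts \<omega> = map (\<lambda>k. B (ts ! Suc k) \<omega> - B (ts ! k) \<omega>) [0..<length ts - 1]"

definition incr_rep :: "(cpath \<Rightarrow> real) \<Rightarrow> real list \<Rightarrow> (real list \<Rightarrow> real) \<Rightarrow> bool" where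
  "incr_rep X ts \<phi> \<longleftrightarrow> grid ts \<and> \<phi> \<in> ClLip (length ts - 1) \<and> X = (\<lambda>\<omega>. \<phi> (increments ts \<omega>))"


subsection \<open>Completion of a pseudometric space\<close>

text \<open>Elements of the completion of \<open>(S, d)\<close> are classes of Cauchy sequences in \<open>S\<close>.\<close>

definition cauchy_seqs :: "'x set \<Rightarrow> ('x \<Rightarrow> 'x \<Rightarrow> real) \<Rightarrow> (nat \<Rightarrow> 'x) set" where
  "cauchy_seqs S d = {X. (\<forall>n. X n \<in> S) \<and> (\<forall>e>0. \<exists>N. \<forall>m\<ge>N. \<forall>n\<ge>N. d (X m) (X n) < e)}"

definition cauchy_rel :: "'x set \<Rightarrow> ('x \<Rightarrow> 'x \<Rightarrow> real) \<Rightarrow> ((nat \<Rightarrow> 'x) \<times> (nat \<Rightarrow> 'x)) set" where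
  "cauchy_rel S d = {(X, Y). X \<in> cauchy_seqs S d \<and> Y \<in> cauchy_seqs S d \<and>
     (\<lambda>n. d (X n) (Y n)) \<longlonglongrightarrow> 0}"

definition completion :: "'x set \<Rightarrow> ('x \<Rightarrow> 'x \<Rightarrow> real) \<Rightarrow> (nat \<Rightarrow> 'x) set set" where
  "completion S d = cauchy_seqs S d // cauchy_rel S d"

definition completion_dist ::
    "('x \<Rightarrow> 'x \<Rightarrow> real) \<Rightarrow> (nat \<Rightarrow> 'x) set \<Rightarrow> (nat \<Rightarrow> 'x) set \<Rightarrow> real" where
  "completion_dist d a b = (THE r. \<forall>X\<in>a. \<forall>Y\<in>b. (\<lambda>n. d (X n) (Y n)) \<longlonglongrightarrow> r)"

type_synonym LG_elem = "(nat \<Rightarrow> cpath \<Rightarrow> real) set"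


subsection \<open>G-expectation, stochastic integral, quadratic variation\<close>

text \<open>In the locale, \<open>\<xi> k\<close> (counted from \<open>0\<close>) drives the increment over \<open>[t\<^sub>k, t\<^sub>k\<^sub>+\<^sub>1]\<close>.  The locale
  has no assumptions; the properties of \<open>E\<close> and \<open>\<xi>\<close> are hypotheses of the theorem.\<close>

locale G_expectation =
  fixes E :: "('a \<Rightarrow> real) \<Rightarrow> real" and \<xi> :: "nat \<Rightarrow> 'a \<Rightarrow> real"
begin

definition scaled_xi :: "real list \<Rightarrow> nat \<Rightarrow> 'a \<Rightarrow> real list" where
  "scaled_xi ts j w = map (\<lambda>k. sqrt (ts ! Suc k - ts ! k) * \<xi> k w) [j..<length ts - 1]"

text \<open>For both expectations below the value does not depend on the chosen representation.\<close>

definition Ehat :: "(cpath \<Rightarrow> real) \<Rightarrow> real" where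
  "Ehat X = (case SOME (ts, \<phi>). incr_rep X ts \<phi> of (ts, \<phi>) \<Rightarrow> E (\<lambda>w. \<phi> (scaled_xi ts 0 w)))"

definition Ehat_cond :: "real \<Rightarrow> (cpath \<Rightarrow> real) \<Rightarrow> cpath \<Rightarrow> real" where
  "Ehat_cond s X =
     (case SOME (ts, \<phi>, j). incr_rep X ts \<phi> \<and> j < length ts \<and> ts ! j = s of (ts, \<phi>, j) \<Rightarrow>
        (\<lambda>\<omega>. E (\<lambda>w. \<phi> (take j (increments ts \<omega>) @ scaled_xi ts j w))))"

definition Lp_dist :: "real \<Rightarrow> (cpath \<Rightarrow> real) \<Rightarrow> (cpath \<Rightarrow> real) \<Rightarrow> real" where
  "Lp_dist p X Y = Ehat (\<lambda>\<omega>. \<bar>X \<omega> - Y \<omega>\<bar> powr p) powr (1 / p)"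

definition LG :: "real \<Rightarrow> LG_elem set" where
  "LG p = completion Lip (Lp_dist p)"

text \<open>The completion of \<open>Lip_upto T\<close>, identified with a subset of \<open>LG p\<close>.\<close>

definition LG_upto :: "real \<Rightarrow> real \<Rightarrow> LG_elem set" where
  "LG_upto p T = {a \<in> LG p. \<exists>X\<in>a. \<forall>n. X n \<in> Lip_upto T}"

definition lg_class :: "real \<Rightarrow> (nat \<Rightarrow> cpath \<Rightarrow> real) \<Rightarrow> LG_elem" where
  "lg_class p X = cauchy_rel Lip (Lp_dist p) `` {X}"

definition lg_embed :: "real \<Rightarrow> (cpath \<Rightarrow> real) \<Rightarrow> LG_elem" where
  "lg_embed p X = lg_class p (\<lambda>_. X)"

text \<open>Operations are lifted from representatives to classes by taking the union over all
  representatives, as in \<^theory>\<open>HOL.Equiv_Relations\<close>.\<close>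

definition lg_add :: "real \<Rightarrow> LG_elem \<Rightarrow> LG_elem \<Rightarrow> LG_elem" where
  "lg_add p a b = (\<Union>X\<in>a. \<Union>Y\<in>b. lg_class p (\<lambda>n \<omega>. X n \<omega> + Y n \<omega>))"

definition lg_scale :: "real \<Rightarrow> real \<Rightarrow> LG_elem \<Rightarrow> LG_elem" where
  "lg_scale p c a = (\<Union>X\<in>a. lg_class p (\<lambda>n \<omega>. c * X n \<omega>))"

definition lg_diff :: "real \<Rightarrow> LG_elem \<Rightarrow> LG_elem \<Rightarrow> LG_elem" where
  "lg_diff p a b = (\<Union>X\<in>a. \<Union>Y\<in>b. lg_class p (\<lambda>n \<omega>. X n \<omega> - Y n \<omega>))"

definition lg_sum :: "real \<Rightarrow> nat \<Rightarrow> (nat \<Rightarrow> LG_elem) \<Rightarrow> LG_elem" where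
  "lg_sum p N a = foldr (lg_add p) (map a [0..<N]) (lg_embed p (\<lambda>_. 0))"

text \<open>The inclusion of \<open>LG 2\<close> into \<open>LG 1\<close>, and the square as a map from \<open>LG 2\<close> to \<open>LG 1\<close>.\<close>

definition lg_incl :: "LG_elem \<Rightarrow> LG_elem" where
  "lg_incl a = (\<Union>X\<in>a. lg_class 1 X)"

definition lg_square :: "LG_elem \<Rightarrow> LG_elem" where
  "lg_square a = (\<Union>X\<in>a. lg_class 1 (\<lambda>n \<omega>. (X n \<omega>)\<^sup>2))"

definition lg_comp :: "(real \<Rightarrow> real) \<Rightarrow> LG_elem \<Rightarrow> LG_elem" where
  "lg_comp \<phi> a = (\<Union>X\<in>a. lg_class 1 (\<lambda>n \<omega>. \<phi> (X n \<omega>)))"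

definition lg_E :: "LG_elem \<Rightarrow> real" where
  "lg_E a = (THE r. \<forall>X\<in>a. (\<lambda>n. Ehat (X n)) \<longlonglongrightarrow> r)"

definition lg_cond :: "real \<Rightarrow> LG_elem \<Rightarrow> LG_elem" where
  "lg_cond s a = (\<Union>X\<in>a. lg_class 1 (\<lambda>n. Ehat_cond s (X n)))"

text \<open>\<open>a \<cdot> (B\<^sub>v - B\<^sub>u)\<close> for \<open>a \<in> LG_upto 2 u\<close>.  Only representatives in \<open>Lip_upto u\<close> are used:
  multiplication by the increment is bounded in the 2-norm there, by independence, but not on
  all of \<open>Lip\<close>.\<close>

definition lg_times_incr :: "LG_elem \<Rightarrow> real \<Rightarrow> real \<Rightarrow> LG_elem" where
  "lg_times_incr a u v =
     (\<Union>X\<in>{X\<in>a. \<forall>n. X n \<in> Lip_upto u}. lg_class 2 (\<lambda>n \<omega>. X n \<omega> * (B v \<omega> - B u \<omega>)))"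

definition step_process :: "real list \<Rightarrow> (nat \<Rightarrow> LG_elem) \<Rightarrow> real \<Rightarrow> LG_elem" where
  "step_process ts x t =
     lg_sum 2 (length ts - 1) (\<lambda>k. lg_scale 2 (indicator {ts ! k..<ts ! Suc k} t) (x k))"

definition step_rep :: "real \<Rightarrow> (real \<Rightarrow> LG_elem) \<Rightarrow> real list \<Rightarrow> (nat \<Rightarrow> LG_elem) \<Rightarrow> bool" where
  "step_rep T \<eta> ts x \<longleftrightarrow> grid ts \<and> last ts = T \<and> (\<forall>k < length ts - 1. x k \<in> LG_upto 2 (ts ! k)) \<and>
     \<eta> = step_process ts x"

definition MG20 :: "real \<Rightarrow> (real \<Rightarrow> LG_elem) set" where
  "MG20 T = {\<eta>. \<exists>ts x. step_rep T \<eta> ts x}"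

text \<open>\<open>\<integral>\<^sub>0\<^sup>T \<bar>\<eta>\<^sub>t\<bar>\<^sup>2 dt \<in> LG 1\<close> and \<open>\<integral>\<^sub>0\<^sup>T \<eta>\<^sub>t dB\<^sub>t \<in> LG 2\<close> for step processes; again the
  choice of the representation is immaterial.\<close>

definition step_sq_integral :: "real \<Rightarrow> (real \<Rightarrow> LG_elem) \<Rightarrow> LG_elem" where
  "step_sq_integral T \<eta> = (case SOME (ts, x). step_rep T \<eta> ts x of (ts, x) \<Rightarrow>
     lg_sum 1 (length ts - 1) (\<lambda>k. lg_scale 1 (ts ! Suc k - ts ! k) (lg_square (x k))))"

definition step_integral :: "real \<Rightarrow> (real \<Rightarrow> LG_elem) \<Rightarrow> LG_elem" where
  "step_integral T \<eta> = (case SOME (ts, x). step_rep T \<eta> ts x of (ts, x) \<Rightarrow>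
     lg_sum 2 (length ts - 1) (\<lambda>k. lg_times_incr (x k) (ts ! k) (ts ! Suc k)))"

definition MG2_dist :: "real \<Rightarrow> (real \<Rightarrow> LG_elem) \<Rightarrow> (real \<Rightarrow> LG_elem) \<Rightarrow> real" where
  "MG2_dist T \<eta> \<zeta> = sqrt (lg_E (step_sq_integral T (\<lambda>t. lg_diff 2 (\<eta> t) (\<zeta> t))))"

definition MG2 :: "real \<Rightarrow> (nat \<Rightarrow> real \<Rightarrow> LG_elem) set set" where
  "MG2 T = completion (MG20 T) (MG2_dist T)"

definition ito_integral :: "real \<Rightarrow> (nat \<Rightarrow> real \<Rightarrow> LG_elem) set \<Rightarrow> LG_elem" where
  "ito_integral T c = (THE Z. Z \<in> LG_upto 2 T \<and>
     (\<forall>\<eta>\<in>c. (\<lambda>N. completion_dist (Lp_dist 2) (step_integral T (\<eta> N)) Z) \<longlonglongrightarrow> 0))"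

text \<open>\<open>B\<close> as an element of \<open>MG2 T\<close>: the common limit of its discretizations
  \<open>\<Sum>\<^sub>k B\<^bsub>t\<^sub>k\<^esub> 1\<^bsub>[t\<^sub>k, t\<^sub>k\<^sub>+\<^sub>1)\<^esub>\<close> along all sequences of partitions of \<open>[0,T]\<close> with mesh tending to \<open>0\<close>.\<close>

definition vanishing_mesh :: "real \<Rightarrow> (nat \<Rightarrow> real list) \<Rightarrow> bool" where
  "vanishing_mesh T \<pi> \<longleftrightarrow> (\<forall>N. grid (\<pi> N) \<and> last (\<pi> N) = T) \<and>
     (\<forall>e>0. \<forall>\<^sub>F N in sequentially. \<forall>k < length (\<pi> N) - 1. \<pi> N ! Suc k - \<pi> N ! k < e)"

definition B_process :: "real \<Rightarrow> (nat \<Rightarrow> real \<Rightarrow> LG_elem) set" where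
  "B_process T = (THE c. c \<in> MG2 T \<and> (\<forall>\<pi>. vanishing_mesh T \<pi> \<longrightarrow>
     (\<lambda>N. step_process (\<pi> N) (\<lambda>k. lg_embed 2 (B (\<pi> N ! k)))) \<in> c))"

definition QV :: "real \<Rightarrow> LG_elem" where
  "QV t = lg_diff 2 (lg_embed 2 (\<lambda>\<omega>. (B t \<omega>)\<^sup>2)) (lg_scale 2 2 (ito_integral t (B_process t)))"

definition identically_distributed :: "LG_elem \<Rightarrow> LG_elem \<Rightarrow> bool" where
  "identically_distributed X Y \<longleftrightarrow> X \<in> LG 1 \<and> Y \<in> LG 1 \<and>
     (\<forall>\<phi>\<in>CbLip. lg_E (lg_comp \<phi> X) = lg_E (lg_comp \<phi> Y))"

definition independent_from_past :: "real \<Rightarrow> LG_elem \<Rightarrow> bool" where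
  "independent_from_past s Y \<longleftrightarrow> Y \<in> LG 1 \<and>
     (\<forall>\<phi>\<in>CbLip. lg_cond s (lg_comp \<phi> Y) = lg_embed 1 (\<lambda>_. lg_E (lg_comp \<phi> Y)))"

end

end

theory Submission
  imports Defs
begin

text \<open>
  The law of a G-normal variable is determined by \<open>G\<close>.  Indeed, \<open>T\<^sub>h f x = E[f (x + sqrt h \<xi>)]\<close> is a
  semigroup by stability, its generator on smooth functions is given by \<open>G\<close>, and since \<open>T\<^sub>h\<close> is
  sublinear, mollifying \<open>T\<^sub>h f\<close> yields a smooth supersolution for the semigroup of any other
  G-normal variable; no regularity theory for the G-heat equation is needed.

  Consequently the G-expectation of a cylinder function does not depend on its representation, and
  conditioning at time \<open>s\<close> means averaging over the path after \<open>s\<close>: the conditional expectation of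
  \<open>X\<close> at \<open>\<omega>\<close> is the G-expectation of \<open>\<omega>' \<mapsto> X (conc s \<omega> \<omega>')\<close>, where \<open>conc s\<close> concatenates paths at
  time \<open>s\<close>.

  By Ito's inequality, the quadratic variation over \<open>[0,T]\<close> is the limit of the sums of squared
  increments along any partitions with vanishing mesh.  With partitions of \<open>[0,s+t]\<close> that contain
  \<open>s\<close>, its increment over \<open>[s,s+t]\<close> becomes a limit of sums over partitions of \<open>[s,s+t]\<close>, and such a
  sum, evaluated at \<open>conc s \<omega> \<omega>'\<close>, is the corresponding sum over \<open>[0,t]\<close> evaluated at \<open>\<omega>'\<close>.  So its
  conditional law is that of the sum over \<open>[0,t]\<close>, whatever \<open>\<omega>\<close>.
\<close>

subsection \<open>Locally Lipschitz functions of polynomial growth\<close>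

text \<open>The definitions, not the final computation, are the obstacle. \<open>Ehat\<close> and
  \<open>Ehat_cond\<close> choose a representation of a cylinder function, and the variables
  \<open>\<xi> i\<close> are assumed to be G-normal one by one; before a grid may be refined, they
  must be shown to have a common law, which is where uniqueness is needed. Then every expectation is
  an iterated one in \<open>\<xi> 0\<close> alone, stability merges adjacent cells, and the choice
  becomes harmless. Likewise \<open>B_process\<close> and \<open>ito_integral\<close> are definite
  descriptions: that all discretizations are equivalent is part of their being meaningful, and it
  also supplies the freedom to choose the mesh.

  Sublinearity shapes the estimates. Hence averages are handled by Riemann sums with explicit
  errors, Schwarz' and Minkowski's inequalities are obtained from pointwise inequalities with a free
  parameter, and Ito's inequality is proved for a difference kept under one expectation.\<close>

definition vnorm :: "nat \<Rightarrow> real list \<Rightarrow> real" where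
  "vnorm n x = (\<Sum>i<n. \<bar>x ! i\<bar>)"

text \<open>The sum norm replaces the Euclidean one: it is additive when an entry is appended to a
  list, which integrating out the last variable relies on, and by \<open>ClLip_iff\<close> it
  defines the same class of functions.\<close>

definition vdist :: "nat \<Rightarrow> real list \<Rightarrow> real list \<Rightarrow> real" where
  "vdist n x y = (\<Sum>i<n. \<bar>x ! i - y ! i\<bar>)"

lemma vnorm_nonneg [simp]: "0 \<le> vnorm n x"
  by (simp add: vnorm_def sum_nonneg)

lemma vdist_nonneg [simp]: "0 \<le> vdist n x y"
  by (simp add: vdist_def sum_nonneg)

lemma sum_abs_le_L2_set: "(\<Sum>i<n. \<bar>f i\<bar>) \<le> real n * L2_set f {..<n}"
proof -
  have "L2_set (\<lambda>i. \<bar>f i\<bar>) {..<n} = L2_set f {..<n}"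
    by (simp add: L2_set_def)
  then have "(\<Sum>i<n. \<bar>f i\<bar>) \<le> (\<Sum>i<n. L2_set f {..<n})"
    by (intro sum_mono) (metis finite_lessThan member_le_L2_set)
  then show ?thesis by simp
qed

lemma power_sum3_le:
  fixes a b :: real
  assumes "0 \<le> a" "0 \<le> b"
  shows "(1 + a + b) ^ m \<le> 3 ^ m * (1 + a ^ m + b ^ m)"
proof -
  define M where "M = max 1 (max a b)"
  have "(1 + a + b) ^ m \<le> (3 * M) ^ m"
    using assms by (intro power_mono) (auto simp: M_def)
  also have "\<dots> = 3 ^ m * M ^ m" by (rule power_mult_distrib)
  also have "M ^ m \<le> 1 + a ^ m + b ^ m"
    using assms by (auto simp: M_def max_def)
  finally show ?thesis by simp
qed

text \<open>The weight \<open>(1 + \<bar>x\<bar> + \<bar>y\<bar>) ^ m\<close> is multiplicative in \<open>m\<close> and its base is at least 1, which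
  makes the closure properties easy.\<close>

lemma ClLip_iff:
  "\<phi> \<in> ClLip n \<longleftrightarrow> (\<exists>C m. 0 \<le> C \<and> (\<forall>x y. length x = n \<longrightarrow> length y = n \<longrightarrow>
     \<bar>\<phi> x - \<phi> y\<bar> \<le> C * (1 + vnorm n x + vnorm n y) ^ m * vdist n x y))"
  (is "_ \<longleftrightarrow> ?R")
proof
  assume "\<phi> \<in> ClLip n"
  then obtain C m where C: "C > 0" and le: "\<And>x y. length x = n \<Longrightarrow> length y = n \<Longrightarrow>
     \<bar>\<phi> x - \<phi> y\<bar> \<le> C * (1 + L2_set (\<lambda>i. x ! i) {..<n} ^ m + L2_set (\<lambda>i. y ! i) {..<n} ^ m)
                    * L2_set (\<lambda>i. x ! i - y ! i) {..<n}"
    unfolding ClLip_def by blast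
  show ?R
  proof (intro exI conjI allI impI)
    show "0 \<le> 3 * C" using C by simp
    fix x y :: "real list" assume l: "length x = n" "length y = n"
    let ?a = "L2_set (\<lambda>i. x ! i) {..<n}" and ?b = "L2_set (\<lambda>i. y ! i) {..<n}"
    let ?W = "1 + vnorm n x + vnorm n y"
    have "?a \<le> vnorm n x" "?b \<le> vnorm n y"
      unfolding vnorm_def by (rule L2_set_le_sum_abs)+
    then have "?a ^ m \<le> ?W ^ m" "?b ^ m \<le> ?W ^ m"
      by (intro power_mono; simp add: L2_set_nonneg add_increasing add_increasing2)+
    moreover have "1 \<le> ?W ^ m" by (intro one_le_power) simp
    ultimately have "1 + ?a ^ m + ?b ^ m \<le> 3 * ?W ^ m" by linarith
    moreover have "L2_set (\<lambda>i. x ! i - y ! i) {..<n} \<le> vdist n x y"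
      unfolding vdist_def by (rule L2_set_le_sum_abs)
    ultimately have "C * (1 + ?a ^ m + ?b ^ m) * L2_set (\<lambda>i. x ! i - y ! i) {..<n}
        \<le> C * (3 * ?W ^ m) * vdist n x y"
      using C by (intro mult_mono) (auto simp: L2_set_nonneg)
    with le[OF l] show "\<bar>\<phi> x - \<phi> y\<bar> \<le> 3 * C * ?W ^ m * vdist n x y"
      by (simp add: mult_ac)
  qed
next
  assume ?R
  then obtain C m where C: "C \<ge> 0" and le: "\<And>x y. length x = n \<Longrightarrow> length y = n \<Longrightarrow>
     \<bar>\<phi> x - \<phi> y\<bar> \<le> C * (1 + vnorm n x + vnorm n y) ^ m * vdist n x y"
    by blast
  let ?K = "(3 * (real n + 1)) ^ m"
  show "\<phi> \<in> ClLip n"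
    unfolding ClLip_def
  proof (intro CollectI exI conjI allI impI)
    \<comment> \<open>The summand 1 keeps the constant strictly positive, as \<open>ClLip\<close>
      demands, even if \<open>C\<close> or \<open>n\<close> is 0.\<close>
    show "0 < C * ?K * real n + 1" using C by (simp add: add_nonneg_pos)
    fix x y :: "real list" assume l: "length x = n" "length y = n"
    let ?a = "L2_set (\<lambda>i. x ! i) {..<n}" and ?b = "L2_set (\<lambda>i. y ! i) {..<n}"
    let ?d = "L2_set (\<lambda>i. x ! i - y ! i) {..<n}"
    have "(1 + vnorm n x + vnorm n y) ^ m \<le> ((real n + 1) * (1 + ?a + ?b)) ^ m"
      using sum_abs_le_L2_set[where n = n and f = "\<lambda>i. x ! i"] sum_abs_le_L2_set[where n = n and f
          = "\<lambda>i. y ! i"] L2_set_nonneg[of "\<lambda>i. x ! i" "{..<n}"]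
        L2_set_nonneg[of "\<lambda>i. y ! i" "{..<n}"]
      unfolding vnorm_def[symmetric] by (intro power_mono) (auto simp: algebra_simps intro:
          order_trans add_mono)
    also have "\<dots> = (real n + 1) ^ m * (1 + ?a + ?b) ^ m" by (rule power_mult_distrib)
    also have "\<dots> \<le> (real n + 1) ^ m * (3 ^ m * (1 + ?a ^ m + ?b ^ m))"
      by (intro mult_left_mono power_sum3_le) (auto simp: L2_set_nonneg)
    finally have W: "(1 + vnorm n x + vnorm n y) ^ m \<le> ?K * (1 + ?a ^ m + ?b ^ m)"
      by (simp only: power_mult_distrib mult_ac)
    have "\<bar>\<phi> x - \<phi> y\<bar> \<le> C * (1 + vnorm n x + vnorm n y) ^ m * vdist n x y" by (rule le[OF l])
    also have "\<dots> \<le> C * (?K * (1 + ?a ^ m + ?b ^ m)) * (real n * ?d)"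
      using C W sum_abs_le_L2_set[where n = n and f = "\<lambda>i. x ! i - y ! i"]
          unfolding vdist_def[symmetric]
      by (intro mult_mono) (auto simp: L2_set_nonneg)
    also have "\<dots> = (C * ?K * real n) * ((1 + ?a ^ m + ?b ^ m) * ?d)" by (simp add: mult_ac)
    also have "\<dots> \<le> (C * ?K * real n + 1) * ((1 + ?a ^ m + ?b ^ m) * ?d)"
      by (intro mult_right_mono) (auto simp: L2_set_nonneg)
    finally show "\<bar>\<phi> x - \<phi> y\<bar> \<le> (C * ?K * real n + 1) * (1 + ?a ^ m + ?b ^ m) * ?d"
      by (simp add: mult_ac)
  qed
qed

lemma ClLipI:
  assumes "0 \<le> C" "\<And>x y. length x = n \<Longrightarrow> length y = n \<Longrightarrow>
     \<bar>\<phi> x - \<phi> y\<bar> \<le> C * (1 + vnorm n x + vnorm n y) ^ m * vdist n x y"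
  shows "\<phi> \<in> ClLip n"
  using assms by (auto simp: ClLip_iff)

lemma ClLipE:
  assumes "\<phi> \<in> ClLip n"
  obtains C m where "0 \<le> C" "\<And>x y. length x = n \<Longrightarrow> length y = n \<Longrightarrow>
     \<bar>\<phi> x - \<phi> y\<bar> \<le> C * (1 + vnorm n x + vnorm n y) ^ m * vdist n x y"
  using assms by (auto simp: ClLip_iff)

lemma ClLip_cong:
  assumes "\<And>x. length x = n \<Longrightarrow> \<phi> x = \<psi> x"
  shows "\<phi> \<in> ClLip n \<longleftrightarrow> \<psi> \<in> ClLip n"
  unfolding ClLip_iff by (simp add: assms)

lemma ClLip_const [simp]: "(\<lambda>_. c) \<in> ClLip n"
  by (rule ClLipI[of 0 _ _ 0]) auto

lemma ClLip_nth: "i < n \<Longrightarrow> (\<lambda>x. x ! i) \<in> ClLip n"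
  by (rule ClLipI[of 1 _ _ 0])
     (auto simp: vdist_def intro: member_le_sum[where f = "\<lambda>i. \<bar>_ ! i - _ ! i\<bar>"])

text \<open>The chain rule for polynomial weights. The components of \<open>g\<close> share a weight
  of degree \<open>m\<close>, so \<open>g\<close> itself grows at most with degree
  \<open>m + 1\<close>; inserted into the weight of degree \<open>p\<close> of \<phi> this gives the
  degree \<open>Suc m * p + m\<close>. The arithmetic closure properties are read off from
  it.\<close>

lemma ClLip_comp:
  assumes \<phi>: "\<phi> \<in> ClLip k" and len: "\<And>x. length x = n \<Longrightarrow> length (g x) = k"
    and g: "\<And>i. i < k \<Longrightarrow> (\<lambda>x. g x ! i) \<in> ClLip n"
  shows "(\<lambda>x. \<phi> (g x)) \<in> ClLip n"
proof -
  obtain C p where C: "0 \<le> C" and \<phi>le: "\<And>x y. length x = k \<Longrightarrow> length y = k \<Longrightarrow>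
     \<bar>\<phi> x - \<phi> y\<bar> \<le> C * (1 + vnorm k x + vnorm k y) ^ p * vdist k x y"
    using ClLipE[OF \<phi>] by blast
  have "\<forall>i. \<exists>D m. i < k \<longrightarrow> 0 \<le> D \<and> (\<forall>x y. length x = n \<longrightarrow> length y = n \<longrightarrow>
     \<bar>g x ! i - g y ! i\<bar> \<le> D * (1 + vnorm n x + vnorm n y) ^ m * vdist n x y)"
    using g unfolding ClLip_iff by blast
  then obtain D q where Dq: "\<And>i. i < k \<Longrightarrow> (0::real) \<le> D i"
    "\<And>i x y. i < k \<Longrightarrow> length x = n \<Longrightarrow> length y = n \<Longrightarrow>
     \<bar>g x ! i - g y ! i\<bar> \<le> D i * (1 + vnorm n x + vnorm n y) ^ q i * vdist n x y"
    by metis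
  define m where "m = (\<Sum>i<k. q i)"
  define A where "A = (\<Sum>i<k. D i)"
  have A: "0 \<le> A" unfolding A_def by (intro sum_nonneg) (auto simp: Dq)
  have gd: "vdist k (g x) (g y) \<le> A * (1 + vnorm n x + vnorm n y) ^ m * vdist n x y"
    if l: "length x = n" "length y = n" for x y
  proof -
    have "vdist k (g x) (g y) \<le> (\<Sum>i<k. D i * (1 + vnorm n x + vnorm n y) ^ m * vdist n x y)"
      unfolding vdist_def[of k]
    proof (intro sum_mono)
      fix i assume i: "i \<in> {..<k}"
      have "q i \<le> m" unfolding m_def using i by (intro member_le_sum) auto
      then have "(1 + vnorm n x + vnorm n y) ^ q i \<le> (1 + vnorm n x + vnorm n y) ^ m"
        by (intro power_increasing) auto
      then have "D i * (1 + vnorm n x + vnorm n y) ^ q i * vdist n x y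
          \<le> D i * (1 + vnorm n x + vnorm n y) ^ m * vdist n x y"
        using Dq(1) i by (intro mult_right_mono mult_left_mono) auto
      then show "\<bar>g x ! i - g y ! i\<bar> \<le> D i * (1 + vnorm n x + vnorm n y) ^ m * vdist n x y"
        using Dq(2)[of i x y] l i by simp
    qed
    also have "\<dots> = A * (1 + vnorm n x + vnorm n y) ^ m * vdist n x y"
      by (simp add: A_def sum_distrib_right)
    finally show ?thesis .
  qed
  \<comment> \<open>Comparison with the origin turns the bound on differences of \<open>g\<close>
    into a growth bound.\<close>
  let ?z = "replicate n (0::real)"
  define K where "K = vnorm k (g ?z) + A"
  have K: "0 \<le> K" using A by (simp add: K_def)
  have z: "vnorm n ?z = 0" "vdist n x ?z = vnorm n x" for x
    by (simp_all add: vnorm_def vdist_def)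
  have gn: "vnorm k (g x) \<le> K * W ^ Suc m" if l: "length x = n" and W: "1 + vnorm n x \<le> W" for x W
  proof -
    have W1: "1 \<le> W" using W by (smt (verit) vnorm_nonneg)
    have "vnorm k (g x) \<le> vnorm k (g ?z) + vdist k (g x) (g ?z)"
      unfolding vnorm_def vdist_def sum.distrib[symmetric] by (intro sum_mono) auto
    also have "vdist k (g x) (g ?z) \<le> A * (1 + vnorm n x) ^ m * vnorm n x"
      using gd[of x ?z] l z by simp
    also have "\<dots> \<le> A * W ^ m * W"
      using A W W1 by (intro mult_mono power_mono) auto
    also have "vnorm k (g ?z) \<le> vnorm k (g ?z) * W ^ Suc m"
      using mult_left_mono[OF one_le_power[OF W1, of "Suc m"] vnorm_nonneg[of k "g ?z"]] by simp
    finally show ?thesis by (simp add: K_def algebra_simps)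
  qed
  show ?thesis
  proof (rule ClLipI)
    show "0 \<le> C * (1 + 2 * K) ^ p * A" using A C K by simp
    fix x y :: "real list" assume l: "length x = n" "length y = n"
    define W where "W = 1 + vnorm n x + vnorm n y"
    have W1: "1 \<le> W" by (simp add: W_def)
    have "1 + vnorm k (g x) + vnorm k (g y) \<le> W ^ Suc m + K * W ^ Suc m + K * W ^ Suc m"
      by (intro add_mono gn l one_le_power W1) (auto simp: W_def)
    then have "(1 + vnorm k (g x) + vnorm k (g y)) ^ p \<le> ((1 + 2 * K) * W ^ Suc m) ^ p"
      by (intro power_mono) (auto simp: algebra_simps)
    then have 1: "(1 + vnorm k (g x) + vnorm k (g y)) ^ p \<le> (1 + 2 * K) ^ p * W ^ (Suc m * p)"
      by (simp only: power_mult_distrib power_mult[symmetric])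
    have "\<bar>\<phi> (g x) - \<phi> (g y)\<bar>
        \<le> C * (1 + vnorm k (g x) + vnorm k (g y)) ^ p * vdist k (g x) (g y)"
      by (intro \<phi>le len l)
    also have "\<dots> \<le> C * ((1 + 2 * K) ^ p * W ^ (Suc m * p)) * (A * W ^ m * vdist n x y)"
      using 1 gd[OF l] C K W1 by (intro mult_mono) (auto simp: W_def)
    also have "\<dots> = C * (1 + 2 * K) ^ p * A * W ^ (Suc m * p + m) * vdist n x y"
      by (simp only: power_add mult_ac)
    finally show "\<bar>\<phi> (g x) - \<phi> (g y)\<bar> \<le>
      C * (1 + 2 * K) ^ p * A * (1 + vnorm n x + vnorm n y) ^ (Suc m * p + m) * vdist n x y"
      by (simp only: W_def)
  qed
qed

lemma ClLip_comp1:
  assumes "(\<lambda>l. h (l ! 0)) \<in> ClLip 1" "f \<in> ClLip n"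
  shows "(\<lambda>x. h (f x)) \<in> ClLip n"
  using ClLip_comp[OF assms(1), of n "\<lambda>x. [f x]"] assms(2) by simp

lemma ClLip_comp2:
  assumes "(\<lambda>l. h (l ! 0) (l ! 1)) \<in> ClLip 2" "f \<in> ClLip n" "g \<in> ClLip n"
  shows "(\<lambda>x. h (f x) (g x)) \<in> ClLip n"
proof -
  have "(\<lambda>x. [f x, g x] ! i) \<in> ClLip n" if "i < 2" for i
    using that assms(2,3) by (cases i) auto
  then show ?thesis
    using ClLip_comp[OF assms(1), of n "\<lambda>x. [f x, g x]"] by simp
qed

lemma ClLip_add: "f \<in> ClLip n \<Longrightarrow> g \<in> ClLip n \<Longrightarrow> (\<lambda>x. f x + g x) \<in> ClLip n"
  by (rule ClLip_comp2[of "(+)"], rule ClLipI[of 1 _ _ 0])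
     (auto simp: vdist_def numeral_2_eq_2)

lemma ClLip_mult: "f \<in> ClLip n \<Longrightarrow> g \<in> ClLip n \<Longrightarrow> (\<lambda>x. f x * g x) \<in> ClLip n"
proof (rule ClLip_comp2[of "(*)"], rule ClLipI[of 1 _ _ 1])
  fix x y :: "real list"
  have "x ! 0 * x ! 1 - y ! 0 * y ! 1 = x ! 0 * (x ! 1 - y ! 1) + y ! 1 * (x ! 0 - y ! 0)"
    by algebra
  then have "\<bar>x ! 0 * x ! 1 - y ! 0 * y ! 1\<bar>
      \<le> \<bar>x ! 0\<bar> * \<bar>x ! 1 - y ! 1\<bar> + \<bar>y ! 1\<bar> * \<bar>x ! 0 - y ! 0\<bar>"
    by (metis abs_mult abs_triangle_ineq)
  also have "\<dots> \<le> (1 + vnorm 2 x + vnorm 2 y) * \<bar>x ! 1 - y ! 1\<bar>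
      + (1 + vnorm 2 x + vnorm 2 y) * \<bar>x ! 0 - y ! 0\<bar>"
    by (intro add_mono mult_right_mono) (auto simp: vnorm_def numeral_2_eq_2)
  finally show "\<bar>x ! 0 * x ! 1 - y ! 0 * y ! 1\<bar>
      \<le> 1 * (1 + vnorm 2 x + vnorm 2 y) ^ 1 * vdist 2 x y"
    by (simp add: vdist_def numeral_2_eq_2 algebra_simps)
qed auto

lemma ClLip_Lipschitz:
  assumes "L-lipschitz_on UNIV h" "f \<in> ClLip n"
  shows "(\<lambda>x. h (f x)) \<in> ClLip n"
proof (rule ClLip_comp1[OF _ assms(2)], rule ClLipI[of L _ _ 0])
  show "0 \<le> L" using assms(1) by (rule lipschitz_on_nonneg)
  fix x y :: "real list"
  show "\<bar>h (x ! 0) - h (y ! 0)\<bar> \<le> L * (1 + vnorm 1 x + vnorm 1 y) ^ 0 * vdist 1 x y"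
    using lipschitz_onD[OF assms(1), of "x ! 0" "y ! 0"] by (simp add: dist_real_def vdist_def)
qed

lemma ClLip_abs: "f \<in> ClLip n \<Longrightarrow> (\<lambda>x. \<bar>f x\<bar>) \<in> ClLip n"
  by (rule ClLip_Lipschitz[of 1]) (auto simp: lipschitz_on_def dist_real_def)

lemma ClLip_cmult: "f \<in> ClLip n \<Longrightarrow> (\<lambda>x. c * f x) \<in> ClLip n"
  by (intro ClLip_mult ClLip_const)

lemma ClLip_diff: "f \<in> ClLip n \<Longrightarrow> g \<in> ClLip n \<Longrightarrow> (\<lambda>x. f x - g x) \<in> ClLip n"
  using ClLip_add[of f n "\<lambda>x. -1 * g x"] ClLip_cmult[of g n "-1"] by simp

lemma ClLip_uminus: "f \<in> ClLip n \<Longrightarrow> (\<lambda>x. - f x) \<in> ClLip n"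
  using ClLip_cmult[of f n "-1"] by simp

lemma ClLip_power: "f \<in> ClLip n \<Longrightarrow> (\<lambda>x. f x ^ k) \<in> ClLip n"
  by (induction k) (auto intro: ClLip_mult)

lemma ClLip_sum:
  "(\<And>i. i \<in> I \<Longrightarrow> f i \<in> ClLip n) \<Longrightarrow> (\<lambda>x. \<Sum>i\<in>I. f i x) \<in> ClLip n"
  by (induction I rule: infinite_finite_induct) (auto intro: ClLip_add)

lemmas ClLip_intros = ClLip_const ClLip_nth ClLip_add ClLip_diff ClLip_uminus ClLip_mult ClLip_abs
  ClLip_power

subsection \<open>Moving averages\<close>

lemma ex_antiderivative:
  fixes f :: "real \<Rightarrow> real"
  assumes "continuous_on UNIV f"
  shows "\<exists>F. \<forall>x. (F has_real_derivative f x) (at x)"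
proof -
  have "isCont f x" for x using assms continuous_on_eq_continuous_at by blast
  then obtain F where "\<forall>x. -\<infinity> < ereal x \<longrightarrow> ereal x < \<infinity> \<longrightarrow> (F has_vector_derivative f x) (at x)"
    using einterval_antiderivative[of "-\<infinity>" "\<infinity>" f] by auto
  then show ?thesis by (auto simp: has_real_derivative_iff_has_vector_derivative)
qed

text \<open>The mean of \<open>f\<close> over the interval of length \<open>e\<close> that starts at
  \<open>x\<close>. Written with an antiderivative, whose choice cancels in the difference, it needs
  no integral: derivatives are immediate and bounds come from the mean value theorem.\<close>

definition moving_avg :: "real \<Rightarrow> (real \<Rightarrow> real) \<Rightarrow> real \<Rightarrow> real" where
  "moving_avg e f x = (let F = SOME F. \<forall>x. (F has_real_derivative f x) (at x) in (F (x + e)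
      - F x) / e)"

lemma moving_avgE:
  assumes "continuous_on UNIV f"
  obtains F where "\<And>x. (F has_real_derivative f x) (at x)"
    "\<And>e x. moving_avg e f x = (F (x + e) - F x) / e"
  using someI_ex[OF ex_antiderivative[OF assms]] by (auto simp: moving_avg_def Let_def)

lemma lipschitz_real_iff:
  "L-lipschitz_on UNIV f \<longleftrightarrow> 0 \<le> L \<and> (\<forall>x y. \<bar>f x - f y\<bar> \<le> L * \<bar>x - y\<bar>)"
  for f :: "real \<Rightarrow> real"
  by (auto simp: lipschitz_on_def dist_real_def)

lemma lipschitz_continuous: "L-lipschitz_on UNIV f \<Longrightarrow> continuous_on UNIV f"
  by (rule lipschitz_on_continuous_on)

lemma DERIV_translate:
  "(F has_real_derivative D) (at (a + u)) \<Longrightarrow> ((\<lambda>u. F (a + u)) has_real_derivative D) (at u)"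
  for F :: "real \<Rightarrow> real"
  by (simp only: add.commute[of a] DERIV_shift)

lemma moving_avg_deriv:
  assumes "continuous_on UNIV f"
  shows "(moving_avg e f has_real_derivative (f (x + e) - f x) / e) (at x)"
proof -
  obtain F where F: "\<And>x. (F has_real_derivative f x) (at x)"
    "\<And>e x. moving_avg e f x = (F (x + e) - F x) / e"
    using moving_avgE[OF assms] by blast
  have "((\<lambda>x. F (x + e)) has_real_derivative f (x + e)) (at x)"
    using F(1)[of "x + e"] by (simp add: DERIV_shift)
  then have "((\<lambda>x. (F (x + e) - F x) / e) has_real_derivative (f (x + e) - f x) / e) (at x)"
    by (intro DERIV_cdivide DERIV_diff F(1))
  then show ?thesis using F(2)[of e] by presburger
qed

text \<open>For antiderivatives \<open>F\<close> and \<open>G\<close> of \<open>f\<close> and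
  \<open>g\<close>, the mean value theorem is applied once to \<open>F (x + u) - G (y + u)\<close>,
  so that the same \<open>z\<close> serves both functions. Monotonicity, the Lipschitz bound and the
  distance to \<open>f\<close> are all special cases.\<close>

lemma moving_avg_mvt:
  assumes "continuous_on UNIV f" "continuous_on UNIV g" "0 < e"
  obtains z where "0 < z" "z < e" "moving_avg e f x - moving_avg e g y = f (x + z) - g (y + z)"
proof -
  obtain F where F: "\<And>x. (F has_real_derivative f x) (at x)"
    "\<And>e x. moving_avg e f x = (F (x + e) - F x) / e"
    using moving_avgE[OF assms(1)] by blast
  obtain G where G: "\<And>x. (G has_real_derivative g x) (at x)"
    "\<And>e x. moving_avg e g x = (G (x + e) - G x) / e"
    using moving_avgE[OF assms(2)] by blast
  have D: "((\<lambda>u. F (x + u) - G (y + u)) has_real_derivative f (x + u) - g (y + u)) (at u)" for u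
    by (intro DERIV_diff DERIV_translate F(1) G(1))
  obtain z where z: "0 < z" "z < e" "(F (x + e) - G (y + e)) - (F (x + 0) - G (y + 0))
      = (e - 0) * (f (x + z) - g (y + z))"
    using MVT2[OF \<open>0 < e\<close> D] by auto
  have "moving_avg e f x - moving_avg e g y = ((F (x + e) - G (y + e)) - (F (x + 0) - G (y
      + 0))) / e"
    by (simp add: F(2) G(2) diff_divide_distrib)
  also have "\<dots> = f (x + z) - g (y + z)" using z(3) \<open>0 < e\<close> by simp
  finally show thesis using z that by blast
qed

lemma moving_avg_const: "0 < e \<Longrightarrow> moving_avg e (\<lambda>_. c) x = c"
proof -
  assume e: "0 < e"
  obtain F where F: "\<And>x. (F has_real_derivative c) (at x)"
    "\<And>e x. moving_avg e (\<lambda>_. c) x = (F (x + e) - F x) / e"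
    using moving_avgE[of "\<lambda>_. c"] by auto
  obtain z where "F (x + e) - F x = (x + e - x) * c"
    using MVT2[of x "x + e" F "\<lambda>_. c"] F(1) e by auto
  then show ?thesis using e by (simp add: F(2))
qed

lemma moving_avg_mono:
  assumes "continuous_on UNIV f" "continuous_on UNIV g" "0 < e" "\<And>x. f x \<le> g x"
  shows "moving_avg e f x \<le> moving_avg e g x"
  using moving_avg_mvt[OF assms(1-3), of x x] assms(4) by (metis diff_le_0_iff_le)

lemma moving_avg_lipschitz:
  assumes "L-lipschitz_on UNIV f" "0 < e"
  shows "L-lipschitz_on UNIV (moving_avg e f)"
  unfolding lipschitz_real_iff
proof (intro conjI allI)
  show "0 \<le> L" using assms(1) by (rule lipschitz_on_nonneg)
  fix x y
  note c = lipschitz_continuous[OF assms(1)]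
  obtain z where "moving_avg e f x - moving_avg e f y = f (x + z) - f (y + z)"
    using moving_avg_mvt[OF c c assms(2)] by metis
  moreover have "\<bar>f (x + z) - f (y + z)\<bar> \<le> L * \<bar>(x + z) - (y + z)\<bar>"
    using assms(1) unfolding lipschitz_real_iff by blast
  ultimately show "\<bar>moving_avg e f x - moving_avg e f y\<bar> \<le> L * \<bar>x - y\<bar>" by simp
qed

lemma moving_avg_close:
  assumes "L-lipschitz_on UNIV f" "0 < e"
  shows "\<bar>moving_avg e f x - f x\<bar> \<le> L * e"
proof -
  obtain z where z: "0 < z" "z < e" "moving_avg e f x - moving_avg e (\<lambda>_. f x) x = f (x + z) - f x"
    using moving_avg_mvt[OF lipschitz_continuous[OF assms(1)] continuous_on_const assms(2)] by metis
  have L: "0 \<le> L" "\<bar>f (x + z) - f x\<bar> \<le> L * \<bar>(x + z) - x\<bar>"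
    using assms(1) unfolding lipschitz_real_iff by blast+
  have "L * z \<le> L * e" using L(1) z(2) by (simp add: mult_left_mono)
  then show ?thesis using z L(2) moving_avg_const[OF assms(2), of "f x" x] by simp
qed

text \<open>The average over length \<open>e\<close> is exactly the mean of the \<open>n\<close>
  averages over the consecutive pieces of length \<open>e / n\<close>, by telescoping; each of these
  is within \<open>L * e / n\<close> of the value at the left end of its piece.\<close>

lemma moving_avg_riemann:
  assumes "L-lipschitz_on UNIV f" "0 < e" "0 < n"
  shows "\<bar>moving_avg e f x - (\<Sum>k<n. f (x + real k * (e / real n))) / real n\<bar> \<le> L * e / real n"
proof -
  define d where "d = e / real n"
  have d: "0 < d" using assms by (simp add: d_def)
  obtain F where F: "\<And>x. (F has_real_derivative f x) (at x)"
    "\<And>e x. moving_avg e f x = (F (x + e) - F x) / e"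
    using moving_avgE[OF lipschitz_continuous[OF assms(1)]] by metis
  have "(\<Sum>k<n. moving_avg d f (x + real k * d))
      = (\<Sum>k<n. F (x + real (Suc k) * d) - F (x + real k * d)) / d"
    by (simp add: F(2) sum_divide_distrib algebra_simps)
  also have "\<dots> = (F (x + e) - F x) / d"
    using assms(3) by (subst sum_lessThan_telescope[of "\<lambda>k. F (x + real k * d)"]) (simp add: d_def)
  also have "\<dots> = real n * moving_avg e f x"
    using assms(3) by (simp add: F(2) d_def)
  finally have eq: "moving_avg e f x = (\<Sum>k<n. moving_avg d f (x + real k * d)) / real n"
    using assms(3) by simp
  have "\<bar>(\<Sum>k<n. moving_avg d f (x + real k * d)) - (\<Sum>k<n. f (x + real k * d))\<bar>
      \<le> (\<Sum>k<n. \<bar>moving_avg d f (x + real k * d) - f (x + real k * d)\<bar>)"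
    unfolding sum_subtractf[symmetric] by (rule sum_abs)
  also have "\<dots> \<le> (\<Sum>k<n. L * d)"
    by (intro sum_mono moving_avg_close assms(1) d)
  also have "\<dots> = L * e" using assms(3) by (simp add: d_def)
  finally show ?thesis
    unfolding eq d_def[symmetric] diff_divide_distrib[symmetric] using assms(3)
    by (simp add: divide_right_mono)
qed

text \<open>A Lipschitz second derivative makes the Lagrange remainder cubic. With an argument of
  size \<open>sqrt h\<close> this is of order \<open>h * sqrt h\<close>, small enough to vanish
  after \<open>1 / h\<close> steps.\<close>

lemma taylor2_lipschitz:
  fixes g :: "real \<Rightarrow> real"
  assumes g1: "\<And>x. (g has_real_derivative g1 x) (at x)"
    and g2: "\<And>x. (g1 has_real_derivative g2 x) (at x)"
    and K: "K-lipschitz_on UNIV g2"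
  shows "\<bar>g (x + y) - (g x + g1 x * y + g2 x / 2 * y\<^sup>2)\<bar> \<le> K * \<bar>y\<bar> ^ 3"
proof (cases "y = 0")
  case False
  define df where "df m = (if m = 0 then g else if m = Suc 0 then g1 else g2)" for m
  have "\<exists>t. (if x + y < x then x + y < t \<and> t < x else x < t \<and> t < x + y) \<and>
    g (x + y) = (\<Sum>m<2. df m x / fact m * (x + y - x) ^ m) + df 2 t / fact 2 * (x + y - x) ^ 2"
    using False g1 g2
    by (intro Taylor[of 2 df g "min x (x + y)" "max x (x + y)"])
       (auto simp: df_def less_2_cases_iff)
  then obtain t where t0: "if x + y < x then x + y < t \<and> t < x else x < t \<and> t < x + y"
    "g (x + y) = (\<Sum>m<2. df m x / fact m * (x + y - x) ^ m) + df 2 t / fact 2 * (x + y - x) ^ 2"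
    by blast
  have t: "\<bar>t - x\<bar> \<le> \<bar>y\<bar>" "g (x + y) = g x + g1 x * y + g2 t / 2 * y\<^sup>2"
    using t0 by (auto simp: df_def numeral_2_eq_2 split: if_splits)
  have "\<bar>g2 t - g2 x\<bar> \<le> K * \<bar>t - x\<bar>" and K0: "0 \<le> K" using K unfolding lipschitz_real_iff by blast+
  then have le: "\<bar>g2 t - g2 x\<bar> \<le> K * \<bar>y\<bar>" using t(1) by (meson mult_left_mono order_trans)
  have "g (x + y) - (g x + g1 x * y + g2 x / 2 * y\<^sup>2) = (g2 t - g2 x) * (y\<^sup>2 / 2)"
    unfolding t(2) by (simp add: algebra_simps diff_divide_distrib)
  then have "\<bar>g (x + y) - (g x + g1 x * y + g2 x / 2 * y\<^sup>2)\<bar> = \<bar>g2 t - g2 x\<bar> * (y\<^sup>2 / 2)"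
    by (simp only: abs_mult abs_divide) simp
  also have "\<dots> \<le> (K * \<bar>y\<bar>) * y\<^sup>2"
    using le K0 by (intro mult_mono) auto
  finally show ?thesis by (simp add: power3_eq_cube power2_eq_square mult_ac)
qed simp

subsection \<open>Uniqueness of the G-normal law\<close>

text \<open>\<open>PG\<close> is for polynomial growth: the test functions of one variable, freed
  from one-element lists, so that functionals on them can be treated without reference to a space of
  random variables.\<close>

definition PG :: "(real \<Rightarrow> real) set" where
  "PG = {f. (\<lambda>l. f (l ! 0)) \<in> ClLip 1}"

lemma PG_lipschitz: "L-lipschitz_on UNIV f \<Longrightarrow> f \<in> PG"
  unfolding PG_def by (auto intro: ClLip_Lipschitz ClLip_nth)

lemma PG_affine:
  assumes "f \<in> PG"
  shows "(\<lambda>x. f (a + b * x)) \<in> PG"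
proof -
  have "(\<lambda>l. f (a + b * l ! 0)) \<in> ClLip 1"
    by (rule ClLip_comp1[of f]) (use assms in \<open>auto simp: PG_def intro!: ClLip_intros\<close>)
  then show ?thesis by (simp add: PG_def)
qed

lemma PG_const: "(\<lambda>_. c) \<in> PG" and PG_id: "(\<lambda>x. x) \<in> PG"
  and PG_add: "f \<in> PG \<Longrightarrow> g \<in> PG \<Longrightarrow> (\<lambda>x. f x + g x) \<in> PG"
  and PG_diff: "f \<in> PG \<Longrightarrow> g \<in> PG \<Longrightarrow> (\<lambda>x. f x - g x) \<in> PG"
  and PG_mult: "f \<in> PG \<Longrightarrow> g \<in> PG \<Longrightarrow> (\<lambda>x. f x * g x) \<in> PG"
  and PG_abs: "f \<in> PG \<Longrightarrow> (\<lambda>x. \<bar>f x\<bar>) \<in> PG"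
  and PG_uminus: "f \<in> PG \<Longrightarrow> (\<lambda>x. - f x) \<in> PG"
  and PG_power: "f \<in> PG \<Longrightarrow> (\<lambda>x. f x ^ k) \<in> PG"
  and PG_sum: "(\<And>i. i \<in> I \<Longrightarrow> h i \<in> PG) \<Longrightarrow> (\<lambda>x. \<Sum>i\<in>I. h i x) \<in> PG"
  unfolding PG_def by (auto intro!: ClLip_intros ClLip_sum)

lemmas PG_intros = PG_const PG_id PG_add PG_diff PG_mult PG_abs PG_uminus PG_power PG_affine

text \<open>\<open>N f\<close> stands for the expectation of \<open>f X\<close> with \<open>X\<close> G-normal; \<open>V \<alpha>\<close> is \<open>2 * G \<alpha>\<close>.\<close>

locale gnormal_functional =
  fixes N :: "(real \<Rightarrow> real) \<Rightarrow> real" and V :: "real \<Rightarrow> real"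
  assumes N_mono: "f \<in> PG \<Longrightarrow> g \<in> PG \<Longrightarrow> (\<And>x. f x \<le> g x) \<Longrightarrow> N f \<le> N g"
    and N_const: "N (\<lambda>_. c) = c"
    and N_subadd: "f \<in> PG \<Longrightarrow> g \<in> PG \<Longrightarrow> N (\<lambda>x. f x + g x) \<le> N f + N g"
    and N_poshom: "f \<in> PG \<Longrightarrow> 0 \<le> c \<Longrightarrow> N (\<lambda>x. c * f x) = c * N f"
    and N_stable: "f \<in> PG \<Longrightarrow> 0 \<le> a \<Longrightarrow> 0 \<le> b \<Longrightarrow>
      N (\<lambda>x. N (\<lambda>y. f (a * x + b * y))) = N (\<lambda>x. f (sqrt (a\<^sup>2 + b\<^sup>2) * x))"
    and N_variance: "N (\<lambda>x. \<alpha> * x\<^sup>2) = V \<alpha>"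
begin

lemma N_le_diff: "f \<in> PG \<Longrightarrow> g \<in> PG \<Longrightarrow> N f - N g \<le> N (\<lambda>x. f x - g x)"
  using N_subadd[of "\<lambda>x. f x - g x" g] by (simp add: PG_diff)

lemma N_le_abs_diff: "f \<in> PG \<Longrightarrow> g \<in> PG \<Longrightarrow> N f - N g \<le> N (\<lambda>x. \<bar>f x - g x\<bar>)"
  using N_le_diff[of f g] N_mono[of "\<lambda>x. f x - g x" "\<lambda>x. \<bar>f x - g x\<bar>"]
  by (force intro: PG_diff PG_abs)

lemma N_abs_diff: "f \<in> PG \<Longrightarrow> g \<in> PG \<Longrightarrow> \<bar>N f - N g\<bar> \<le> N (\<lambda>x. \<bar>f x - g x\<bar>)"
  using N_le_abs_diff[of f g] N_le_abs_diff[of g f] by (simp add: abs_minus_commute abs_le_iff)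

lemma N_add_const: "f \<in> PG \<Longrightarrow> N (\<lambda>x. f x + c) = N f + c"
  using N_subadd[of f "\<lambda>_. c"] N_subadd[of "\<lambda>x. f x + c" "\<lambda>_. - c"]
  by (simp add: PG_intros N_const)

lemma N_le_const: "f \<in> PG \<Longrightarrow> (\<And>x. f x \<le> c) \<Longrightarrow> N f \<le> c"
  using N_mono[of f "\<lambda>_. c"] by (simp add: PG_intros N_const)

lemma N_sum:
  assumes "finite I" "\<And>i. i \<in> I \<Longrightarrow> f i \<in> PG"
  shows "N (\<lambda>x. \<Sum>i\<in>I. f i x) \<le> (\<Sum>i\<in>I. N (f i))"
  using assms
proof (induction I rule: finite_induct)
  case (insert i I)
  then show ?case
    using N_subadd[of "f i" "\<lambda>x. \<Sum>i\<in>I. f i x"] by (simp add: PG_sum)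
qed (simp add: N_const)

text \<open>Stability with \<open>a = b = 1\<close> says that twice the mean is
  \<open>sqrt 2\<close> times the mean. As \<open>N\<close> is only positively homogeneous,
  \<open>c = 1\<close> and \<open>c = -1\<close> are treated separately and every other
  \<open>c\<close> is reduced to them.\<close>

lemma N_mean: "N (\<lambda>x. c * x) = 0"
proof -
  have *: "N (\<lambda>x. c * x) = 0" if "c = 1 \<or> c = -1" for c
  proof -
    let ?m = "N (\<lambda>x. c * x)"
    have PG: "(\<lambda>x. c * x) \<in> PG" by (intro PG_intros)
    have "N (\<lambda>x. N (\<lambda>y. c * (1 * x + 1 * y))) = N (\<lambda>x. c * (sqrt (1\<^sup>2 + 1\<^sup>2) * x))"
      by (rule N_stable[of "\<lambda>z. c * z"]) (simp_all add: PG)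
    also have "\<dots> = sqrt 2 * ?m"
      using N_poshom[OF PG, of "sqrt 2"] by (simp add: mult_ac)
    also have "(\<lambda>x. N (\<lambda>y. c * (1 * x + 1 * y))) = (\<lambda>x. c * x + ?m)"
      using N_add_const[OF PG] by (simp add: algebra_simps)
    also have "N (\<lambda>x. c * x + ?m) = ?m + ?m" by (rule N_add_const[OF PG])
    finally have "(2 - sqrt 2) * ?m = 0" by (simp add: algebra_simps)
    moreover have "sqrt 2 \<noteq> 2" using real_sqrt_eq_iff[of 2 4] by simp
    ultimately show ?thesis by simp
  qed
  have PG: "(\<lambda>x. -1 * x) \<in> PG" "(\<lambda>x. 1 * x) \<in> PG" by (intro PG_intros)+
  show ?thesis
  proof (cases "0 \<le> c")
    case True then show ?thesis using N_poshom[OF PG(2), of c] *[of 1] by simp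
  next
    case False then show ?thesis using N_poshom[OF PG(1), of "-c"] *[of "-1"] by simp
  qed
qed

definition T :: "real \<Rightarrow> (real \<Rightarrow> real) \<Rightarrow> real \<Rightarrow> real" where
  "T h f x = N (\<lambda>y. f (x + sqrt h * y))"

lemma T_lipschitz:
  assumes "L-lipschitz_on UNIV f"
  shows "L-lipschitz_on UNIV (T h f)"
  unfolding lipschitz_real_iff
proof (intro conjI allI)
  show "0 \<le> L" using assms by (rule lipschitz_on_nonneg)
  fix x y
  have PG: "f \<in> PG" using assms by (rule PG_lipschitz)
  have "\<bar>T h f x - T h f y\<bar> \<le> N (\<lambda>z. \<bar>f (x + sqrt h * z) - f (y + sqrt h * z)\<bar>)"
    unfolding T_def by (intro N_abs_diff PG_intros PG)
  also have "\<dots> \<le> L * \<bar>x - y\<bar>"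
  proof (rule N_le_const)
    show "(\<lambda>z. \<bar>f (x + sqrt h * z) - f (y + sqrt h * z)\<bar>) \<in> PG" by (intro PG_intros PG)
    fix z
    have "\<bar>f (x + sqrt h * z) - f (y + sqrt h * z)\<bar> \<le> L * \<bar>(x + sqrt h * z) - (y + sqrt h * z)\<bar>"
      using assms unfolding lipschitz_real_iff by blast
    then show "\<bar>f (x + sqrt h * z) - f (y + sqrt h * z)\<bar> \<le> L * \<bar>x - y\<bar>" by simp
  qed
  finally show "\<bar>T h f x - T h f y\<bar> \<le> L * \<bar>x - y\<bar>" .
qed

lemma T_add:
  assumes "f \<in> PG" "0 \<le> h" "0 \<le> k"
  shows "T (h + k) f = T h (T k f)"
proof
  fix x
  have "N (\<lambda>y. N (\<lambda>z. f (x + 1 * (sqrt h * y + sqrt k * z))))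
      = N (\<lambda>y. f (x + 1 * (sqrt ((sqrt h)\<^sup>2 + (sqrt k)\<^sup>2) * y)))"
    using assms by (intro N_stable[of "\<lambda>u. f (x + 1 * u)"] PG_intros) auto
  then show "T (h + k) f x = T h (T k f) x"
    using assms by (simp add: T_def add.assoc)
qed

lemma T_mono: "f \<in> PG \<Longrightarrow> g \<in> PG \<Longrightarrow> (\<And>x. f x \<le> g x) \<Longrightarrow> T h f x \<le> T h g x"
  unfolding T_def by (intro N_mono PG_affine) auto

lemma T_add_const: "f \<in> PG \<Longrightarrow> T h (\<lambda>x. f x + c) x = T h f x + c"
  unfolding T_def by (intro N_add_const PG_affine)

lemma T_zero: "T 0 f = f"
  by (simp add: T_def N_const fun_eq_iff)

text \<open>Jensen's inequality for the sublinear operator \<open>T h\<close>, by Riemann sums.\<close>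

lemma T_moving_avg:
  assumes L: "L-lipschitz_on UNIV f" and e: "0 < e"
  shows "T h (moving_avg e f) x \<le> moving_avg e (T h f) x"
proof (rule LIMSEQ_le_const)
  show "(\<lambda>n. moving_avg e (T h f) x + 2 * (L * e) / real n) \<longlonglongrightarrow> moving_avg e (T h f) x"
    using tendsto_add[OF tendsto_const lim_const_over_n, of "moving_avg e (T h f) x"] by simp
  have PG: "f \<in> PG" using L by (rule PG_lipschitz)
  have PGa: "moving_avg e f \<in> PG" using moving_avg_lipschitz[OF L e] by (rule PG_lipschitz)
  \<comment> \<open>The Riemann error \<open>L * e / n\<close> enters twice: for \<open>f\<close>
    and, when the sum is turned back into an average, for \<open>T h f\<close>, which has the same
    Lipschitz constant. In between, subadditivity handles the finite sum.\<close>
  have "T h (moving_avg e f) x \<le> moving_avg e (T h f) x + 2 * (L * e) / real n" if n: "0 < n" for n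
  proof -
    define d where "d = e / real n"
    have PGs: "(\<lambda>x. \<Sum>k<n. f (x + real k * d)) \<in> PG"
      using PG_affine[OF PG, of "real k * d" 1 for k] by (intro PG_sum) (simp add: add.commute)
    have PGr: "(\<lambda>x. (1 / real n) * (\<Sum>k<n. f (x + real k * d))) \<in> PG"
      by (rule PG_mult[OF PG_const PGs])
    have PGk: "(\<lambda>y. \<Sum>k<n. f ((x + real k * d) + sqrt h * y)) \<in> PG"
      by (intro PG_sum PG_affine PG)
    have "T h (moving_avg e f) x \<le> T h (\<lambda>x. (1 / real n) * (\<Sum>k<n. f (x + real k * d))
        + L * e / real n) x"
    proof (rule T_mono)
      show "moving_avg e f y \<le> (1 / real n) * (\<Sum>k<n. f (y + real k * d)) + L * e / real n" for y
        using moving_avg_riemann[OF L e n, of y] unfolding d_def[symmetric]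
            by (simp add: abs_le_iff)
    qed (intro PGa PG_add[OF PGr PG_const])+
    also have "\<dots> = T h (\<lambda>x. (1 / real n) * (\<Sum>k<n. f (x + real k * d))) x + L * e / real n"
      by (rule T_add_const[OF PGr])
    also have "T h (\<lambda>x. (1 / real n) * (\<Sum>k<n. f (x + real k * d))) x
        = (1 / real n) * N (\<lambda>y. \<Sum>k<n. f ((x + real k * d) + sqrt h * y))"
      unfolding T_def using N_poshom[OF PGk, of "1 / real n"] by (simp add: add_ac)
    also have "\<dots> \<le> (1 / real n) * (\<Sum>k<n. T h f (x + real k * d))"
      unfolding T_def using n by (intro mult_left_mono N_sum PG_affine PG) auto
    also have "\<dots> \<le> moving_avg e (T h f) x + L * e / real n"
      using moving_avg_riemann[OF T_lipschitz[OF L] e n, of h x] unfolding d_def[symmetric]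
      by (simp add: abs_le_iff)
    finally show ?thesis by simp
  qed
  then show "\<exists>N. \<forall>n\<ge>N. T h (moving_avg e f) x \<le> moving_avg e (T h f) x + 2 * (L * e) / real n"
    by (intro exI[of _ 1]) auto
qed

text \<open>The expectation of the second order Taylor polynomial is computed exactly, although
  \<open>N\<close> is not additive, because its linear term has mean zero with either sign. Only the
  Taylor remainder contributes to the error.\<close>

lemma T_consistent:
  assumes g1: "\<And>x. (g has_real_derivative g1 x) (at x)"
    and g2: "\<And>x. (g1 has_real_derivative g2 x) (at x)"
    and K: "K-lipschitz_on UNIV g2" and PG: "g \<in> PG" and h: "0 \<le> h"
  shows "\<bar>T h g x - (g x + V (g2 x / 2 * h))\<bar> \<le> K * N (\<lambda>y. \<bar>y\<bar> ^ 3) * (h * sqrt h)"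
proof -
  let ?q = "\<lambda>y. g x + g1 x * (sqrt h * y) + g2 x / 2 * (sqrt h * y)\<^sup>2"
  have q: "?q \<in> PG" by (intro PG_intros)
  have q2: "(\<lambda>y. g2 x / 2 * (sqrt h * y)\<^sup>2) \<in> PG" by (intro PG_intros)
  have q1: "(\<lambda>y. g1 x * (sqrt h * y)) \<in> PG" "(\<lambda>y. g1 x * (- sqrt h * y)) \<in> PG" by (intro PG_intros)+
  have m: "N (\<lambda>y. g1 x * (sqrt h * y)) = 0" "N (\<lambda>y. g1 x * (- sqrt h * y)) = 0"
    using N_mean[of "g1 x * sqrt h"] N_mean[of "g1 x * - sqrt h"] by (simp_all only: mult.assoc)
  have v: "N (\<lambda>y. g2 x / 2 * (sqrt h * y)\<^sup>2) = V (g2 x / 2 * h)"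
    using N_variance[of "g2 x / 2 * h"] h by (simp add: power_mult_distrib mult.assoc)
  have c: "N ?q = N (\<lambda>y. g1 x * (sqrt h * y) + g2 x / 2 * (sqrt h * y)\<^sup>2) + g x"
    using N_add_const[OF PG_add[OF q1(1) q2], of "g x"] by (simp add: add_ac)
  have "N ?q \<le> g x + V (g2 x / 2 * h)"
    using N_subadd[OF q1(1) q2] c m v by simp
  \<comment> \<open>Adding the linear term with the opposite sign removes it again, so subadditivity
    yields the lower bound as well.\<close>
  moreover have "N ?q \<ge> g x + V (g2 x / 2 * h)"
    using N_subadd[OF PG_add[OF q1(1) q2] q1(2)] c m v by (simp add: algebra_simps)
  ultimately have Nq: "N ?q = g x + V (g2 x / 2 * h)" by simp
  have "\<bar>T h g x - N ?q\<bar> \<le> N (\<lambda>y. \<bar>g (x + sqrt h * y) - ?q y\<bar>)"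
    unfolding T_def by (intro N_abs_diff PG_affine PG q)
  also have "\<dots> \<le> N (\<lambda>y. (K * (h * sqrt h)) * \<bar>y\<bar> ^ 3)"
  proof (rule N_mono)
    fix y
    have "\<bar>g (x + sqrt h * y) - ?q y\<bar> \<le> K * \<bar>sqrt h * y\<bar> ^ 3"
      by (rule taylor2_lipschitz[OF g1 g2 K])
    also have "\<dots> = (K * (h * sqrt h)) * \<bar>y\<bar> ^ 3"
      using h by (simp add: abs_mult power_mult_distrib power3_eq_cube mult_ac)
    finally show "\<bar>g (x + sqrt h * y) - ?q y\<bar> \<le> (K * (h * sqrt h)) * \<bar>y\<bar> ^ 3" .
  qed (intro PG_intros PG)+
  also have "\<dots> = (K * (h * sqrt h)) * N (\<lambda>y. \<bar>y\<bar> ^ 3)"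
    using h lipschitz_on_nonneg[OF K] by (intro N_poshom PG_intros) auto
  finally show ?thesis unfolding Nq by (simp add: mult_ac)
qed

end

text \<open>Let \<open>S\<close>, \<open>T\<close> be the semigroups of the two functionals and \<open>A\<close> the moving average.  By Jensen's
  inequality \<open>v j = A (A (T (j h) f))\<close> satisfies \<open>T h (v j) \<le> v (j + 1)\<close>, and on the smooth function
  \<open>v j\<close> the operators \<open>S h\<close> and \<open>T h\<close> agree up to \<open>O(h powr (3/2))\<close>.  Summing up \<open>1/h\<close> steps yields
  \<open>S 1 (A (A f)) \<le> A (A (T 1 f))\<close>.\<close>

lemma gnormal_functional_le:
  assumes N: "gnormal_functional N V" and M: "gnormal_functional M V" and L: "L-lipschitz_on UNIV f"
  shows "M f \<le> N f"
proof -
  interpret N: gnormal_functional N V by (rule N)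
  interpret M: gnormal_functional M V by (rule M)
  have L0: "0 \<le> L" using L by (rule lipschitz_on_nonneg)
  have main: "M.T 1 f 0 \<le> N.T 1 f 0 + 4 * L * e" if e: "0 < e" for e
  proof -
    define A where "A = moving_avg e"
    \<comment> \<open>Averaging twice makes a Lipschitz function twice differentiable with Lipschitz
      second derivative, which is the regularity that \<open>T_consistent\<close> asks for.\<close>
    define v where "v u = A (A u)" for u
    \<comment> \<open>The second derivative of \<open>v u\<close> is a second difference of
      \<open>u\<close> divided by \<open>e\<^sup>2\<close>; its coefficients 1, -2, 1 give the
      factor 4. The constant blows up as \<open>e\<close> tends to 0, which is harmless because
      \<open>e\<close> is fixed while \<open>h\<close> tends to 0.\<close>
    define K where "K = 4 * L / e\<^sup>2"
    define c where "c = K * N (\<lambda>y. \<bar>y\<bar> ^ 3) + K * M (\<lambda>y. \<bar>y\<bar> ^ 3)"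
    have AL: "L-lipschitz_on UNIV (A u)" if "L-lipschitz_on UNIV u" for u
      unfolding A_def by (rule moving_avg_lipschitz[OF that e])
    have vL: "L-lipschitz_on UNIV (v u)" if "L-lipschitz_on UNIV u" for u
      unfolding v_def by (intro AL that)
    have step: "M.T h (v u) x \<le> v (N.T h u) x + c * (h * sqrt h)"
      if u: "L-lipschitz_on UNIV u" and h: "0 \<le> h" for u h x
    proof -
      define g1 where "g1 x = (A u (x + e) - A u x) / e" for x
      define g2 where "g2 x = ((u (x + e + e) - u (x + e)) / e - (u (x + e) - u x) / e) / e" for x
      have d1: "(v u has_real_derivative g1 x) (at x)" for x
        unfolding v_def g1_def A_def
        by (intro moving_avg_deriv lipschitz_continuous[OF AL[OF u, unfolded A_def]])
      have dA: "(A u has_real_derivative (u (x + e) - u x) / e) (at x)" for x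
        unfolding A_def by (intro moving_avg_deriv lipschitz_continuous[OF u])
      have d2: "(g1 has_real_derivative g2 x) (at x)" for x
        unfolding g1_def g2_def
        by (intro DERIV_cdivide DERIV_diff dA) (use dA[of "x + e"] in \<open>simp add: DERIV_shift\<close>)
      have "K-lipschitz_on UNIV g2"
        unfolding lipschitz_real_iff
      proof (intro conjI allI)
        show "0 \<le> K" using L0 by (simp add: K_def)
        fix x y
        have *: "\<bar>u (x + a) - u (y + a)\<bar> \<le> L * \<bar>x - y\<bar>" for a
        proof -
          have "\<bar>u (x + a) - u (y + a)\<bar> \<le> L * \<bar>(x + a) - (y + a)\<bar>"
            using u unfolding lipschitz_real_iff by blast
          then show ?thesis by simp
        qed
        have "\<bar>(u (x + (e + e)) - 2 * u (x + e) + u (x + 0)) - (u (y + (e + e)) - 2 * u (y + e)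
            + u (y + 0))\<bar>
            \<le> 4 * L * \<bar>x - y\<bar>"
          using *[of "e + e"] *[of e] *[of 0] by linarith
        then have "\<bar>(u (x + (e + e)) - 2 * u (x + e) + u (x + 0)) - (u (y + (e + e)) - 2 * u (y
            + e) + u (y + 0))\<bar> / e\<^sup>2
            \<le> 4 * L * \<bar>x - y\<bar> / e\<^sup>2"
          by (intro divide_right_mono) auto
        moreover have "g2 x - g2 y = ((u (x + (e + e)) - 2 * u (x + e) + u (x + 0)) - (u (y + (e
            + e)) - 2 * u (y + e) + u (y + 0))) / e\<^sup>2"
          unfolding g2_def using e by (simp add: field_simps power2_eq_square)
        ultimately show "\<bar>g2 x - g2 y\<bar> \<le> K * \<bar>x - y\<bar>" by (simp add: K_def abs_divide)
      qed
      note cons = d1 d2 this PG_lipschitz[OF vL[OF u]] h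
      have "M.T h (v u) x \<le> N.T h (v u) x + c * (h * sqrt h)"
        using N.T_consistent[OF cons, of x] M.T_consistent[OF cons, of x]
        by (simp add: c_def algebra_simps abs_le_iff)
      also have "N.T h (v u) x \<le> A (N.T h (A u)) x"
        unfolding v_def A_def by (rule N.T_moving_avg[OF AL[OF u, unfolded A_def] e])
      also have "\<dots> \<le> A (A (N.T h u)) x"
        unfolding A_def
      proof (rule moving_avg_mono[OF _ _ e])
        show "N.T h (moving_avg e u) y \<le> moving_avg e (N.T h u) y" for y
          by (rule N.T_moving_avg[OF u e])
      qed (intro lipschitz_continuous[of L] N.T_lipschitz AL[unfolded A_def] u)+
      finally show ?thesis by (simp add: v_def)
    qed
    have iter: "M.T (real j * h) (v f) x \<le> v (N.T (real j * h) f) x + real j * (c * (h * sqrt h))"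
      if h: "0 \<le> h" for j h x
    proof (induction j arbitrary: x)
      case 0 then show ?case by (simp add: M.T_zero N.T_zero)
    next
      case (Suc j)
      let ?u = "N.T (real j * h) f"
      have uL: "L-lipschitz_on UNIV ?u" by (rule N.T_lipschitz[OF L])
      have PG: "M.T (real j * h) (v f) \<in> PG" "v ?u \<in> PG"
        by (intro PG_lipschitz[of L] M.T_lipschitz vL L uL)+
      have S: "real (Suc j) * h = h + real j * h" by (simp add: algebra_simps)
      have "M.T (real (Suc j) * h) (v f) x = M.T h (M.T (real j * h) (v f)) x"
        unfolding S using h by (subst M.T_add) (auto intro: PG_lipschitz vL[OF L])
      also have "\<dots> \<le> M.T h (\<lambda>x. v ?u x + real j * (c * (h * sqrt h))) x"
        by (intro M.T_mono Suc.IH PG PG_add PG_const)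
      also have "\<dots> = M.T h (v ?u) x + real j * (c * (h * sqrt h))"
        by (rule M.T_add_const[OF PG(2)])
      also have "M.T h (v ?u) x \<le> v (N.T h ?u) x + c * (h * sqrt h)"
        by (rule step[OF uL h])
      also have "N.T h ?u = N.T (real (Suc j) * h) f"
        unfolding S using h by (subst N.T_add) (auto intro: PG_lipschitz L)
      finally show ?case by (simp add: algebra_simps)
    qed
    \<comment> \<open>With \<open>h = 1 / n\<close> and \<open>n\<close> steps the accumulated error
      is \<open>n * c * h * sqrt h = c * sqrt (1 / n)\<close>.\<close>
    have le1: "M.T 1 (v f) 0 \<le> v (N.T 1 f) 0"
    proof (rule LIMSEQ_le_const)
      have "(\<lambda>n. c * sqrt (1 / real n)) \<longlonglongrightarrow> c * sqrt 0"
        by (intro tendsto_intros lim_1_over_n)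
      then show "(\<lambda>n. v (N.T 1 f) 0 + c * sqrt (1 / real n)) \<longlonglongrightarrow> v (N.T 1 f) 0"
        using tendsto_add[OF tendsto_const[of "v (N.T 1 f) 0"]] by fastforce
      have "M.T 1 (v f) 0 \<le> v (N.T 1 f) 0 + c * sqrt (1 / real n)" if "1 \<le> n" for n
        using iter[of "1 / real n" n 0] that by simp
      then show "\<exists>N0. \<forall>n\<ge>N0. M.T 1 (v f) 0 \<le> v (N.T 1 f) 0 + c * sqrt (1 / real n)" by blast
    qed
    \<comment> \<open>Each of the two averages moves a function by at most \<open>L * e\<close>. The
      estimate is used for \<open>f\<close> and for \<open>N.T 1 f\<close>, which makes the total
      \<open>4 * L * e\<close>.\<close>
    have vclose: "\<bar>v u x - u x\<bar> \<le> 2 * (L * e)" if u: "L-lipschitz_on UNIV u" for u x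
      using moving_avg_close[OF AL[OF u] e, of x] moving_avg_close[OF u e, of x]
      unfolding v_def A_def by linarith
    have "M.T 1 f 0 \<le> M.T 1 (\<lambda>x. v f x + 2 * (L * e)) 0"
    proof (rule M.T_mono)
      show "f x \<le> v f x + 2 * (L * e)" for x using vclose[OF L, of x] by linarith
    qed (intro PG_add PG_const PG_lipschitz[of L] vL L)+
    also have "\<dots> = M.T 1 (v f) 0 + 2 * (L * e)"
      by (intro M.T_add_const PG_lipschitz[of L] vL L)
    finally have "M.T 1 f 0 \<le> M.T 1 (v f) 0 + 2 * (L * e)" .
    then show ?thesis
      using le1 vclose[OF N.T_lipschitz[OF L, of 1], of 0] by linarith
  qed
  have "M.T 1 f 0 \<le> N.T 1 f 0"
  proof (rule field_le_epsilon)
    fix d :: real assume d: "0 < d"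
    have "4 * L * (d / (4 * L + 1)) \<le> d" using L0 d by (simp add: field_simps)
    then show "M.T 1 f 0 \<le> N.T 1 f 0 + d"
      using main[of "d / (4 * L + 1)"] L0 d by simp
  qed
  then show ?thesis by (simp add: M.T_def N.T_def)
qed

text \<open>Functions of polynomial growth are reduced to Lipschitz functions by clamping the argument.\<close>

theorem gnormal_functional_unique:
  assumes N: "gnormal_functional N V" and M: "gnormal_functional M V" and f: "f \<in> PG"
  shows "M f = N f"
proof -
  have le: "M f \<le> N f" if N: "gnormal_functional N V" and M: "gnormal_functional M V" for N M
  proof -
    interpret N: gnormal_functional N V by (rule N)
    interpret M: gnormal_functional M V by (rule M)
    obtain C m where C: "0 \<le> C" and le: "\<And>x y. \<bar>f x - f y\<bar> \<le> C * (1 + \<bar>x\<bar> + \<bar>y\<bar>) ^ m * \<bar>x - y\<bar>"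
    proof -
      obtain C m where C: "0 \<le> C" and *: "\<And>x y. length x = 1 \<Longrightarrow> length y = 1 \<Longrightarrow>
        \<bar>f (x ! 0) - f (y ! 0)\<bar> \<le> C * (1 + vnorm 1 x + vnorm 1 y) ^ m * vdist 1 x y"
        using ClLipE[OF f[unfolded PG_def mem_Collect_eq]] by metis
      have "\<bar>f x - f y\<bar> \<le> C * (1 + \<bar>x\<bar> + \<bar>y\<bar>) ^ m * \<bar>x - y\<bar>" for x y
        using *[of "[x]" "[y]"] by (simp add: vnorm_def vdist_def)
      with C that show thesis by blast
    qed
    \<comment> \<open>A majorant, independent of \<open>n\<close>, of \<open>n\<close> times the
      error made by clamping the argument to the interval from \<open>-n\<close> to
      \<open>n\<close>: points inside do not move, and for the others
      \<open>1 \<le> \<bar>y\<bar> / n\<close>.\<close>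
    define r where "r y = C * ((1 + 2 * \<bar>y\<bar>) ^ m * (\<bar>y\<bar> * \<bar>y\<bar>))" for y :: real
    have r: "r \<in> PG" unfolding r_def by (intro PG_intros)
    have "M f \<le> N f + (M r + N r) / real n" if n: "1 \<le> n" for n
    proof -
      define cl where "cl y = max (- real n) (min (real n) y)" for y
      define fn where "fn y = f (cl y)" for y
      have cl: "\<bar>cl y\<bar> \<le> real n" "\<bar>cl y\<bar> \<le> \<bar>y\<bar>" "\<bar>cl x - cl y\<bar> \<le> \<bar>x - y\<bar>" "\<bar>y - cl y\<bar> \<le> \<bar>y\<bar>" for x y
        by (auto simp: cl_def max_def min_def)
      have lip: "(C * (1 + 2 * real n) ^ m)-lipschitz_on UNIV fn"
        unfolding lipschitz_real_iff
      proof (intro conjI allI)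
        show "0 \<le> C * (1 + 2 * real n) ^ m" using C by simp
        fix x y
        have "\<bar>fn x - fn y\<bar> \<le> C * (1 + \<bar>cl x\<bar> + \<bar>cl y\<bar>) ^ m * \<bar>cl x - cl y\<bar>"
          unfolding fn_def by (rule le)
        also have "\<dots> \<le> C * (1 + 2 * real n) ^ m * \<bar>x - y\<bar>"
        proof (intro mult_mono mult_left_mono power_mono)
          show "1 + \<bar>cl x\<bar> + \<bar>cl y\<bar> \<le> 1 + 2 * real n" using cl(1)[of x] cl(1)[of y] by simp
        qed (use C cl(3) in auto)
        finally show "\<bar>fn x - fn y\<bar> \<le> C * (1 + 2 * real n) ^ m * \<bar>x - y\<bar>" .
      qed
      then have fnPG: "fn \<in> PG" by (rule PG_lipschitz)
      have rn: "\<bar>f y - fn y\<bar> \<le> (1 / real n) * r y" for y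
      proof -
        have "\<bar>f y - fn y\<bar> \<le> C * (1 + \<bar>y\<bar> + \<bar>cl y\<bar>) ^ m * \<bar>y - cl y\<bar>"
          unfolding fn_def by (rule le)
        also have "\<dots> \<le> C * (1 + 2 * \<bar>y\<bar>) ^ m * ((1 / real n) * (\<bar>y\<bar> * \<bar>y\<bar>))"
        proof (intro mult_mono mult_left_mono power_mono)
          show "1 + \<bar>y\<bar> + \<bar>cl y\<bar> \<le> 1 + 2 * \<bar>y\<bar>" using cl(2)[of y] by simp
          show "\<bar>y - cl y\<bar> \<le> 1 / real n * (\<bar>y\<bar> * \<bar>y\<bar>)"
          proof (cases "\<bar>y\<bar> \<le> real n")
            case True then have "cl y = y" by (auto simp: cl_def max_def min_def)
            then show ?thesis by simp
          next
            case False
            then have "real n * \<bar>y\<bar> \<le> \<bar>y\<bar> * \<bar>y\<bar>" by (intro mult_right_mono) auto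
            then have "\<bar>y\<bar> \<le> 1 / real n * (\<bar>y\<bar> * \<bar>y\<bar>)" using n by (simp add: field_simps)
            with cl(4)[of y] show ?thesis by linarith
          qed
        qed (use C in auto)
        also have "\<dots> = (1 / real n) * r y" by (simp add: r_def)
        finally show ?thesis .
      qed
      have PGd: "(\<lambda>y. \<bar>f y - fn y\<bar>) \<in> PG" "(\<lambda>y. (1 / real n) * r y) \<in> PG"
        by (intro PG_intros f fnPG r)+
      have "M f - M fn \<le> M (\<lambda>y. \<bar>f y - fn y\<bar>)" by (rule M.N_le_abs_diff[OF f fnPG])
      also have "\<dots> \<le> M (\<lambda>y. (1 / real n) * r y)" by (rule M.N_mono[OF PGd rn])
      also have "\<dots> = (1 / real n) * M r" by (rule M.N_poshom[OF r]) simp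
      finally have 1: "M f - M fn \<le> (1 / real n) * M r" .
      have "N fn - N f \<le> N (\<lambda>y. \<bar>f y - fn y\<bar>)"
        using N.N_le_abs_diff[OF fnPG f] by (simp add: abs_minus_commute)
      also have "\<dots> \<le> N (\<lambda>y. (1 / real n) * r y)" by (rule N.N_mono[OF PGd rn])
      also have "\<dots> = (1 / real n) * N r" by (rule N.N_poshom[OF r]) simp
      finally have 2: "N fn - N f \<le> (1 / real n) * N r" .
      have "M fn \<le> N fn" by (rule gnormal_functional_le[OF N M lip])
      with 1 2 show ?thesis by (simp add: add_divide_distrib)
    qed
    moreover have "(\<lambda>n. N f + (M r + N r) / real n) \<longlonglongrightarrow> N f"
      using tendsto_add[OF tendsto_const lim_const_over_n, of "N f"] by simp
    ultimately show ?thesis by (intro LIMSEQ_le_const) auto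
  qed
  show ?thesis using le[OF N M] le[OF M N] by simp
qed

subsection \<open>Grids, increments and paths\<close>

text \<open>Consecutive pairs, that is, the cells of a grid. Increments, durations and sums over
  cells become maps over this list, and splitting a grid at a point becomes an append;
  \<open>map_cpairs\<close> translates from the definitions by indices.\<close>

definition cpairs :: "'b list \<Rightarrow> ('b \<times> 'b) list" where
  "cpairs ts = zip ts (tl ts)"

lemma cpairs_simps [simp]:
  "cpairs [] = []" "cpairs [a] = []" "cpairs (a # b # ts) = (a, b) # cpairs (b # ts)"
  by (simp_all add: cpairs_def)

lemma length_cpairs [simp]: "length (cpairs ts) = length ts - 1"
  by (simp add: cpairs_def)

lemma cpairs_append: "cpairs (as @ a # bs) = cpairs (as @ [a]) @ cpairs (a # bs)"
proof (induction as)
  case (Cons x as)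
  then show ?case by (cases as) auto
qed simp

lemma map_cpairs:
  "map (\<lambda>k. f (ts ! k) (ts ! Suc k)) [0..<length ts - 1] = map (\<lambda>(a, b). f a b) (cpairs ts)"
  by (rule nth_equalityI) (auto simp: cpairs_def nth_tl)

lemma cpairs_map: "cpairs (map f ts) = map (\<lambda>(a, b). (f a, f b)) (cpairs ts)"
  by (induction ts rule: induct_list012) auto

lemma set_cpairs_sorted:
  "sorted_wrt (<) ts \<Longrightarrow> (a, b) \<in> set (cpairs ts) \<Longrightarrow> a \<in> set ts \<and> b \<in> set ts \<and> a < b"
proof (induction ts rule: induct_list012)
  case (3 x y zs)
  then show ?case by auto
qed auto

definition durations :: "real list \<Rightarrow> real list" where
  "durations ts = map (\<lambda>(a, b). b - a) (cpairs ts)"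

lemma length_durations [simp]: "length (durations ts) = length ts - 1"
  by (simp add: durations_def)

lemma durations_append: "durations (as @ a # bs) = durations (as @ [a]) @ durations (a # bs)"
  unfolding durations_def by (subst cpairs_append) simp

lemma durations_Cons: "durations (a # b # bs) = (b - a) # durations (b # bs)"
  by (simp add: durations_def)

lemma durations_alt: "durations ts = map (\<lambda>k. ts ! Suc k - ts ! k) [0..<length ts - 1]"
  by (simp add: durations_def map_cpairs[symmetric])

lemma increments_alt: "increments ts \<omega> = map (\<lambda>(a, b). B b \<omega> - B a \<omega>) (cpairs ts)"
  by (simp add: increments_def map_cpairs[symmetric, of "\<lambda>a b. B b \<omega> - B a \<omega>"])

lemma length_increments [simp]: "length (increments ts \<omega>) = length ts - 1"
  by (simp add: increments_def)

lemma increments_append: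
  "increments (as @ a # bs) \<omega> = increments (as @ [a]) \<omega> @ increments (a # bs) \<omega>"
  unfolding increments_alt by (subst cpairs_append) simp

lemma increments_Cons: "increments (a # b # bs) \<omega> = (B b \<omega> - B a \<omega>) # increments (b # bs) \<omega>"
  by (simp add: increments_alt)

lemma increments_Nil [simp]: "increments [] \<omega> = []" "increments [a] \<omega> = []"
  by (simp_all add: increments_alt)

lemma path_at_props: "continuous_on {0..} (path_at \<omega>) \<and> path_at \<omega> 0 = 0 \<and> (\<forall>t<0. path_at \<omega> t = 0)"
  using path_at[of \<omega>] by (rule CollectD)

lemma B_neg: "t < 0 \<Longrightarrow> B t \<omega> = 0"
  using path_at_props[of \<omega>] unfolding B_def by blast

lemma B_0 [simp]: "B 0 \<omega> = 0"
  using path_at_props[of \<omega>] unfolding B_def by blast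

lemma B_continuous: "continuous_on {0..} (\<lambda>t. B t \<omega>)"
  using path_at_props[of \<omega>] unfolding B_def by blast

lemma B_Abs:
  "continuous_on {0..} w \<Longrightarrow> w 0 = 0 \<Longrightarrow> (\<And>t. t < 0 \<Longrightarrow> w t = 0) \<Longrightarrow> B t (Abs_cpath w) = w t"
  by (simp add: B_def Abs_cpath_inverse)

lemma grid_nonneg: "grid ts \<Longrightarrow> t \<in> set ts \<Longrightarrow> 0 \<le> t"
  unfolding grid_def by (cases ts) auto

lemma grid_0_in: "grid ts \<Longrightarrow> 0 \<in> set ts"
  unfolding grid_def by (cases ts) auto

lemma grid_nth_mono: "grid ts \<Longrightarrow> i < j \<Longrightarrow> j < length ts \<Longrightarrow> ts ! i < ts ! j"
  unfolding grid_def by (simp add: sorted_wrt_nth_less)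

lemma grid_nth_0: "grid ts \<Longrightarrow> ts ! 0 = 0"
  unfolding grid_def by (metis hd_conv_nth)

lemma grid_sorted_list:
  assumes "finite S" "\<And>t. t \<in> S \<Longrightarrow> 0 \<le> t"
  shows "grid (sorted_list_of_set (insert 0 S))"
      "set (sorted_list_of_set (insert 0 S)) = insert 0 S"
proof -
  let ?l = "sorted_list_of_set (insert 0 S)"
  show s: "set ?l = insert 0 S" by (rule set_sorted_list_of_set) (simp add: assms(1))
  have sw: "sorted_wrt (<) ?l" by (rule strict_sorted_list_of_set)
  have ne: "?l \<noteq> []" using s by (metis empty_set insert_not_empty)
  then obtain x xs where l: "?l = x # xs" by (cases ?l) auto
  have "x \<le> 0" using sw s unfolding l by (metis insertI1 less_imp_le order_refl set_ConsD
      sorted_wrt.simps(2))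
  moreover have "0 \<le> x" using s assms(2) unfolding l
      by (metis insertE list.set_intros(1) order_refl)
  ultimately have "hd ?l = 0" unfolding l by simp
  with sw ne show "grid ?l" unfolding grid_def by simp
qed

lemma grid_insert:
  assumes "grid (as @ a # bs)" "a < m" "\<And>b. b \<in> set bs \<Longrightarrow> m < b"
  shows "grid (as @ a # m # bs)"
proof -
  have sw: "sorted_wrt (<) (as @ a # bs)" and hd: "hd (as @ a # bs) = 0"
    using assms(1) unfolding grid_def by auto
  have "\<forall>x\<in>set as. x < a" using sw by (simp add: sorted_wrt_append)
  then have "\<forall>x\<in>set as. x < m" using assms(2) by (meson less_trans)
  then have "sorted_wrt (<) (as @ a # m # bs)"
    using sw assms(2,3) by (simp add: sorted_wrt_append)
  moreover have "hd (as @ a # m # bs) = 0" using hd by (cases as) auto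
  ultimately show ?thesis unfolding grid_def by simp
qed

text \<open>A missing point lies inside a cell or beyond the last point, but never before the first,
  as every grid starts at 0; so two kinds of steps suffice. The extension case records
  \<open>m \<in> set us\<close>, which lets a common last point exclude it.\<close>

lemma grid_refine_induct [consumes 3, case_names base insert extend]:
  assumes "grid ts" "grid us" "set ts \<subseteq> set us"
    and base: "P ts"
    and ins: "\<And>as a b bs m. grid (as @ a # b # bs) \<Longrightarrow> grid (as @ a # m # b # bs) \<Longrightarrow>
       a < m \<Longrightarrow> m < b \<Longrightarrow> P (as @ a # b # bs) \<Longrightarrow> P (as @ a # m # b # bs)"
    and ext: "\<And>as a m. grid (as @ [a]) \<Longrightarrow> a < m \<Longrightarrow> grid (as @ [a, m]) \<Longrightarrow> m \<in> set us \<Longrightarrow> P (as @ [a])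
        \<Longrightarrow> P (as @ [a, m])"
  shows "P us"
  using assms(1,3,4)
proof (induction "card (set us - set ts)" arbitrary: ts rule: less_induct)
  case less
  show ?case
  proof (cases "set us \<subseteq> set ts")
    case True
    then have "set ts = set us" using less.prems by simp
    moreover have "sorted_wrt (<) ts" "sorted_wrt (<) us" using less.prems(1) assms(2)
        unfolding grid_def by auto
    ultimately have "ts = us"
      by (metis strict_sorted_equal)
    then show ?thesis using less.prems by simp
  next
    case False
    then obtain m where m: "m \<in> set us" "m \<notin> set ts" by blast
    have m0: "0 < m" using grid_nonneg[OF assms(2) m(1)] grid_0_in[OF less.prems(1)] m(2)
        by (cases "m = 0") auto
    have sw: "sorted_wrt (<) ts" and hd0: "ts \<noteq> []" "hd ts = 0" using less.prems(1)
        unfolding grid_def by auto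
    define l where "l = takeWhile (\<lambda>t. t < m) ts"
    define bs where "bs = dropWhile (\<lambda>t. t < m) ts"
    have tlb: "ts = l @ bs" by (simp add: l_def bs_def)
    have l: "t < m" if "t \<in> set l" for t using that unfolding l_def by (auto dest: set_takeWhileD)
    have "l \<noteq> []" using hd0 m0 unfolding l_def by (cases ts) auto
    then obtain as a where la: "l = as @ [a]" by (metis rev_exhaust)
    have ts: "ts = as @ a # bs" using tlb la by simp
    have am: "a < m" using l la by simp
    have bm: "m < b" if b: "b \<in> set bs" for b
    proof (cases bs)
      case (Cons c cs)
      have "\<not> c < m" using Cons hd_dropWhile[of "\<lambda>t. t < m" ts] unfolding bs_def
          by (metis list.discI list.sel(1))
      moreover have "c \<noteq> m" using m(2) Cons ts by auto
      moreover have "c \<le> b" using b sw unfolding ts Cons by (auto simp: sorted_wrt_append)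
      ultimately show ?thesis by simp
    qed (use b in simp)
    let ?ts = "as @ a # m # bs"
    have g: "grid ?ts" using grid_insert[OF less.prems(1)[unfolded ts] am bm] by blast
    have "P ?ts"
    proof (cases bs)
      case Nil
      then show ?thesis using ext[of as a m] less.prems am g m(1) unfolding ts by simp
    next
      case (Cons b cs)
      then show ?thesis using ins[of as a b cs m] less.prems am g bm unfolding ts by simp
    qed
    moreover have "set us - set ?ts = (set us - set ts) - {m}" unfolding ts by auto
    then have "card (set us - set ?ts) < card (set us - set ts)"
      using m by (metis DiffI List.finite_set card_Diff1_less finite_Diff)
    moreover have "set ?ts \<subseteq> set us" using less.prems(2) m(1) unfolding ts by auto
    ultimately show ?thesis using less.hyps[of ?ts] g by blast
  qed
qed

text \<open>The witness is piecewise linear.\<close>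

lemma increments_surj:
  assumes "grid ts" "length l = length ts - 1"
  obtains \<omega> where "increments ts \<omega> = l"
proof -
  define n where "n = length ts - 1"
  \<comment> \<open>The \<open>k\<close>-th summand rises from 0 to \<open>l ! k\<close> across the
    \<open>k\<close>-th cell and is constant outside of it.\<close>
  define w where "w t = (\<Sum>k<n. l ! k * max 0 (min 1 ((t - ts ! k) / (ts ! Suc k - ts ! k))))" for t
  have lt: "ts ! k < ts ! Suc k" if "k < n" for k
    using grid_nth_mono[OF assms(1), of k "Suc k"] that unfolding n_def by simp
  have le: "ts ! i \<le> ts ! j" if "i \<le> j" "j \<le> n" for i j
  proof (cases "i = j")
    case False
    have "0 < length ts" using assms(1) unfolding grid_def by simp
    then have "j < length ts" using that(2) unfolding n_def by linarith
    then show ?thesis using grid_nth_mono[OF assms(1), of i j] that(1) False by simp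
  qed simp
  have c: "continuous_on {0..} w" unfolding w_def
    by (intro continuous_intros) (use lt in force)
  have w0: "w t = 0" if "t \<le> 0" for t
    unfolding w_def
  proof (intro sum.neutral ballI)
    fix k assume k: "k \<in> {..<n}"
    have "0 \<le> ts ! k" using le[of 0 k] k grid_nth_0[OF assms(1)] by simp
    then have "(t - ts ! k) / (ts ! Suc k - ts ! k) \<le> 0"
      using lt[of k] k that by (simp add: divide_le_0_iff)
    then show "l ! k * max 0 (min 1 ((t - ts ! k) / (ts ! Suc k - ts ! k))) = 0" by simp
  qed
  have wj: "w (ts ! j) = (\<Sum>k<j. l ! k)" if j: "j \<le> n" for j
  proof -
    have "w (ts ! j) = (\<Sum>k<n. if k < j then l ! k else 0)"
      unfolding w_def
    proof (intro sum.cong refl)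
      fix k assume k: "k \<in> {..<n}"
      note ltk = lt[of k]
      show "l ! k * max 0 (min 1 ((ts ! j - ts ! k) / (ts ! Suc k - ts ! k))) = (if k
          < j then l ! k else 0)"
      proof (cases "k < j")
        case True
        then have "ts ! Suc k \<le> ts ! j" using le[of "Suc k" j] j by simp
        then have "1 \<le> (ts ! j - ts ! k) / (ts ! Suc k - ts ! k)" using ltk k
            by (simp add: le_divide_eq)
        then show ?thesis using True by simp
      next
        case False
        then have "ts ! j \<le> ts ! k" using le[of j k] k by simp
        then have "(ts ! j - ts ! k) / (ts ! Suc k - ts ! k) \<le> 0" using ltk k
            by (simp add: divide_le_0_iff)
        then show ?thesis using False by simp
      qed
    qed
    also have "\<dots> = (\<Sum>k<j. l ! k)"
      using j by (simp add: sum.If_cases[of "{..<n}"] lessThan_def[symmetric] Int_absorb1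
          lessThan_subset_iff)
    finally show ?thesis .
  qed
  have "increments ts (Abs_cpath w) = l"
  proof (rule nth_equalityI)
    fix k assume "k < length (increments ts (Abs_cpath w))"
    then have k: "k < n" by (simp add: n_def)
    then show "increments ts (Abs_cpath w) ! k = l ! k"
      using wj[of k] wj[of "Suc k"] by (simp add: increments_def n_def B_Abs[OF c] w0)
  qed (use assms in simp)
  then show thesis by (rule that)
qed

text \<open>Every list of the right length is the increment vector of some path, so \<open>X\<close>
  determines the representing function there. On lists of other lengths it is arbitrary.\<close>

lemma incr_rep_unique:
  assumes "incr_rep X ts \<phi>" "incr_rep X ts \<psi>" "length l = length ts - 1"
  shows "\<phi> l = \<psi> l"
  using increments_surj[of ts l] assms unfolding incr_rep_def by metis

subsection \<open>Concatenation of paths\<close>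

text \<open>The path \<omega> is frozen at time \<open>s\<close> and \<omega>', delayed by
  \<open>s\<close>, is added. Since \<omega>' starts at 0, it contributes nothing before
  \<open>s\<close>, so one formula covers all times and continuity is immediate.\<close>

definition conc :: "real \<Rightarrow> cpath \<Rightarrow> cpath \<Rightarrow> cpath" where
  "conc s \<omega> \<omega>' = Abs_cpath (\<lambda>t. B (min t s) \<omega> + B (max (t - s) 0) \<omega>')"

lemma B_conc:
  assumes "0 \<le> s"
  shows "B t (conc s \<omega> \<omega>') = B (min t s) \<omega> + B (max (t - s) 0) \<omega>'"
  unfolding conc_def
proof (rule B_Abs)
  show "continuous_on {0..} (\<lambda>t. B (min t s) \<omega> + B (max (t - s) 0) \<omega>')"
    using assms
    by (intro continuous_intros continuous_on_compose2[OF B_continuous]) auto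
qed (use assms in \<open>auto simp: min_def B_neg\<close>)

lemma B_conc_le: "0 \<le> s \<Longrightarrow> t \<le> s \<Longrightarrow> B t (conc s \<omega> \<omega>') = B t \<omega>"
  and B_conc_ge: "0 \<le> s \<Longrightarrow> s \<le> t \<Longrightarrow> B t (conc s \<omega> \<omega>') = B s \<omega> + B (t - s) \<omega>'"
  by (simp_all add: B_conc)

lemma grid_splitD:
  assumes "grid (as @ s # bs)"
  shows "0 \<le> s" "grid (as @ [s])" "\<And>t. t \<in> set as \<Longrightarrow> t < s" "\<And>t. t \<in> set bs \<Longrightarrow> s < t"
    "grid (map (\<lambda>t. t - s) (s # bs))"
  using assms grid_nonneg[OF assms, of s] unfolding grid_def
  by (cases as; auto simp: sorted_wrt_append sorted_wrt_map)+

lemma increments_cong: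
  "(\<And>a b. (a, b) \<in> set (cpairs ts) \<Longrightarrow> B b \<omega> - B a \<omega> = B b \<omega>' - B a \<omega>') \<Longrightarrow>
   increments ts \<omega> = increments ts \<omega>'"
  by (auto simp: increments_alt)

text \<open>As \<open>s\<close> is a grid point, no cell straddles it: cells before \<open>s\<close>
  see only \<omega>, and in cells after \<open>s\<close> the common offset
  \<open>B s \<omega>\<close> cancels.\<close>

lemma increments_conc:
  assumes "grid (as @ s # bs)"
  shows "increments (as @ s # bs) (conc s \<omega> \<omega>') =
    increments (as @ [s]) \<omega> @ increments (map (\<lambda>t. t - s) (s # bs)) \<omega>'"
proof -
  note g = grid_splitD[OF assms]
  have s1: "sorted_wrt (<) (as @ [s])" "sorted_wrt (<) (s # bs)"
    using assms unfolding grid_def by (auto simp: sorted_wrt_append)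
  have "increments (as @ [s]) (conc s \<omega> \<omega>') = increments (as @ [s]) \<omega>"
  proof (rule increments_cong)
    fix a b assume "(a, b) \<in> set (cpairs (as @ [s]))"
    from set_cpairs_sorted[OF s1(1) this] have "a \<le> s" "b \<le> s" using g(3) by force+
    then show "B b (conc s \<omega> \<omega>') - B a (conc s \<omega> \<omega>') = B b \<omega> - B a \<omega>"
      using g(1) by (simp add: B_conc_le)
  qed
  moreover have "increments (s # bs) (conc s \<omega> \<omega>') = increments (map (\<lambda>t. t - s) (s # bs)) \<omega>'"
    unfolding increments_alt cpairs_map map_map
  proof (rule map_cong[OF refl], clarsimp)
    fix a b assume "(a, b) \<in> set (cpairs (s # bs))"
    from set_cpairs_sorted[OF s1(2) this] have "s \<le> a" "s \<le> b" using g(4) by force+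
    then show "B b (conc s \<omega> \<omega>') - B a (conc s \<omega> \<omega>') = B (b - s) \<omega>' - B (a - s) \<omega>'"
      using g(1) by (simp add: B_conc_ge)
  qed
  ultimately show ?thesis by (subst increments_append) simp
qed

subsection \<open>Cylinder functions\<close>

text \<open>Covers \<open>Lip\<close> and \<open>Lip_upto\<close> at once, so that each closure
  property is proved a single time.\<close>

definition Lip_on :: "real set \<Rightarrow> (cpath \<Rightarrow> real) set" where
  "Lip_on I = {\<lambda>\<omega>. \<phi> (map (\<lambda>t. B t \<omega>) ts) | \<phi> ts. set ts \<subseteq> I \<and> \<phi> \<in> ClLip (length ts)}"

lemma Lip_eq: "Lip = Lip_on {0..}"
  unfolding Lip_def Lip_on_def by (simp add: subset_eq)

lemma Lip_upto_eq: "Lip_upto T = Lip_on {0..T}"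
  unfolding Lip_upto_def Lip_on_def by (simp add: subset_eq)

lemma Lip_on_mono: "I \<subseteq> J \<Longrightarrow> Lip_on I \<subseteq> Lip_on J"
  unfolding Lip_on_def by blast

lemma Lip_upto_Lip: "X \<in> Lip_upto T \<Longrightarrow> X \<in> Lip"
  using Lip_on_mono[of "{0..T}" "{0..}"] by (auto simp: Lip_eq Lip_upto_eq)

lemma Lip_upto_mono: "X \<in> Lip_upto S \<Longrightarrow> S \<le> T \<Longrightarrow> X \<in> Lip_upto T"
  using Lip_on_mono[of "{0..S}" "{0..T}"] by (auto simp: Lip_upto_eq)

lemma ClLip_take: "\<phi> \<in> ClLip m \<Longrightarrow> m \<le> n \<Longrightarrow> (\<lambda>l. \<phi> (take m l)) \<in> ClLip n"
  by (rule ClLip_comp[of \<phi> m]) (auto intro: ClLip_nth)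

lemma ClLip_drop: "\<phi> \<in> ClLip m \<Longrightarrow> (\<lambda>l. \<phi> (drop n l)) \<in> ClLip (n + m)"
proof (rule ClLip_comp[of \<phi> m])
  fix i assume "i < m"
  have "(\<lambda>x. drop n x ! i) \<in> ClLip (n + m) \<longleftrightarrow> (\<lambda>x. x ! (n + i)) \<in> ClLip (n + m)"
    by (rule ClLip_cong) simp
  then show "(\<lambda>x. drop n x ! i) \<in> ClLip (n + m)" using \<open>i < m\<close> by (simp add: ClLip_nth)
qed auto

lemma Lip_on_comp2:
  assumes h: "(\<lambda>l. h (l ! 0) (l ! 1)) \<in> ClLip 2" and X: "X \<in> Lip_on I" and Y: "Y \<in> Lip_on I"
  shows "(\<lambda>\<omega>. h (X \<omega>) (Y \<omega>)) \<in> Lip_on I"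
proof -
  obtain \<phi> ts where p: "X = (\<lambda>\<omega>. \<phi> (map (\<lambda>t. B t \<omega>) ts))" "set ts \<subseteq> I" "\<phi> \<in> ClLip (length ts)"
    using X unfolding Lip_on_def by blast
  obtain \<psi> us where q: "Y = (\<lambda>\<omega>. \<psi> (map (\<lambda>t. B t \<omega>) us))" "set us \<subseteq> I" "\<psi> \<in> ClLip (length us)"
    using Y unfolding Lip_on_def by blast
  have "(\<lambda>l. h (\<phi> (take (length ts) l)) (\<psi> (drop (length ts) l))) \<in> ClLip (length ts + length us)"
    by (rule ClLip_comp2[OF h]) (use p q in \<open>auto intro: ClLip_take ClLip_drop\<close>)
  then show ?thesis unfolding Lip_on_def using p q
    by (intro CollectI exI[of _ "\<lambda>l. h (\<phi> (take (length ts) l)) (\<psi> (drop (length ts) l))"] exI[of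
        _ "ts @ us"]) auto
qed

lemma Lip_on_const: "(\<lambda>_. c) \<in> Lip_on I"
  unfolding Lip_on_def by (intro CollectI exI[of _ "\<lambda>_. c"] exI[of _ "[]"]) simp

lemma Lip_on_B: "t \<in> I \<Longrightarrow> B t \<in> Lip_on I"
  unfolding Lip_on_def by (intro CollectI exI[of _ "\<lambda>l. l ! 0"] exI[of _ "[t]"]) (simp add:
      ClLip_nth)

lemma Lip_on_comp1:
  assumes "(\<lambda>l. h (l ! 0)) \<in> ClLip 1" "X \<in> Lip_on I"
  shows "(\<lambda>\<omega>. h (X \<omega>)) \<in> Lip_on I"
  using Lip_on_comp2[of "\<lambda>a b. h a", OF ClLip_comp1[OF assms(1)] assms(2,2)]
      by (simp add: ClLip_nth)

lemma Lip_on_add: "X \<in> Lip_on I \<Longrightarrow> Y \<in> Lip_on I \<Longrightarrow> (\<lambda>\<omega>. X \<omega> + Y \<omega>) \<in> Lip_on I"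
  by (rule Lip_on_comp2[of "\<lambda>a b. a + b"]) (simp_all add: ClLip_add ClLip_nth)

lemma Lip_on_diff: "X \<in> Lip_on I \<Longrightarrow> Y \<in> Lip_on I \<Longrightarrow> (\<lambda>\<omega>. X \<omega> - Y \<omega>) \<in> Lip_on I"
  by (rule Lip_on_comp2[of "\<lambda>a b. a - b"]) (simp_all add: ClLip_diff ClLip_nth)

lemma Lip_on_mult: "X \<in> Lip_on I \<Longrightarrow> Y \<in> Lip_on I \<Longrightarrow> (\<lambda>\<omega>. X \<omega> * Y \<omega>) \<in> Lip_on I"
  by (rule Lip_on_comp2[of "\<lambda>a b. a * b"]) (simp_all add: ClLip_mult ClLip_nth)

lemma Lip_on_abs: "X \<in> Lip_on I \<Longrightarrow> (\<lambda>\<omega>. \<bar>X \<omega>\<bar>) \<in> Lip_on I"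
  by (rule Lip_on_comp1[of abs]) (simp_all add: ClLip_abs ClLip_nth)

lemma Lip_on_power: "X \<in> Lip_on I \<Longrightarrow> (\<lambda>\<omega>. X \<omega> ^ n) \<in> Lip_on I"
  by (rule Lip_on_comp1[of "\<lambda>a. a ^ n"]) (simp_all add: ClLip_power ClLip_nth)

lemma Lip_on_uminus: "X \<in> Lip_on I \<Longrightarrow> (\<lambda>\<omega>. - X \<omega>) \<in> Lip_on I"
  by (rule Lip_on_comp1[of uminus]) (simp_all add: ClLip_uminus ClLip_nth)

lemma Lip_on_lipschitz: "L-lipschitz_on UNIV h \<Longrightarrow> X \<in> Lip_on I \<Longrightarrow> (\<lambda>\<omega>. h (X \<omega>)) \<in> Lip_on I"
  by (rule Lip_on_comp1) (auto intro: ClLip_Lipschitz ClLip_nth)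

lemmas Lip_on_intros = Lip_on_const Lip_on_add Lip_on_diff Lip_on_mult Lip_on_abs Lip_on_power
  Lip_on_uminus
lemmas Lip_intros = Lip_on_intros[where I = "{0..}", folded Lip_eq]
lemmas Lip_upto_intros = Lip_on_intros[where I = "{0..T}" for T, folded Lip_upto_eq]

text \<open>The cells left of \<open>t\<close> are described by a condition on \<open>t\<close>
  rather than by the index of \<open>t\<close> in the grid, so that the right-hand side can be used
  as a function of \<open>t\<close> and of the increment vector when representations are
  built.\<close>

lemma B_grid_sum:
  assumes g: "grid us" and t: "t \<in> set us"
  shows "B t \<omega> = (\<Sum>k\<in>{k. k < length us - 1 \<and> us ! Suc k \<le> t}. increments us \<omega> ! k)"
proof -
  obtain i where i: "i < length us" "us ! i = t" using t by (auto simp: in_set_conv_nth)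
  have *: "us ! Suc k \<le> t \<longleftrightarrow> k < i" if "k < length us - 1" for k
  proof (cases "k < i")
    case True
    then have "us ! Suc k \<le> us ! i"
      using grid_nth_mono[OF g, of "Suc k" i] i by (cases "Suc k = i") auto
    then show ?thesis using True i by simp
  next
    case False
    then have "us ! i < us ! Suc k" using grid_nth_mono[OF g, of i "Suc k"] that by simp
    then show ?thesis using False i by simp
  qed
  have "{k. k < length us - 1 \<and> us ! Suc k \<le> t} = {..<i}"
  proof (intro set_eqI iffI)
    fix k assume "k \<in> {k. k < length us - 1 \<and> us ! Suc k \<le> t}"
    then show "k \<in> {..<i}" using *[of k] by blast
  next
    fix k assume "k \<in> {..<i}"
    then have "k < i" "k < length us - 1" using i(1) by simp_all
    then show "k \<in> {k. k < length us - 1 \<and> us ! Suc k \<le> t}" using *[of k] by blast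
  qed
  moreover have "(\<Sum>k<i. increments us \<omega> ! k) = (\<Sum>k<i. B (us ! Suc k) \<omega> - B (us ! k) \<omega>)"
  proof (intro sum.cong refl)
    fix k assume "k \<in> {..<i}"
    then have "k < length us - 1" using i(1) by simp
    then show "increments us \<omega> ! k = B (us ! Suc k) \<omega> - B (us ! k) \<omega>"
      by (simp add: increments_def)
  qed
  moreover have "(\<Sum>k<i. B (us ! Suc k) \<omega> - B (us ! k) \<omega>) = B (us ! i) \<omega> - B (us ! 0) \<omega>"
    by (rule sum_lessThan_telescope[of "\<lambda>k. B (us ! k) \<omega>"])
  moreover have "B (us ! 0) \<omega> = 0" unfolding grid_nth_0[OF g] by (rule B_0)
  ultimately show ?thesis unfolding i(2) by simp
qed

lemma ex_incr_rep:
  assumes \<phi>: "\<phi> \<in> ClLip (length ts)" and g: "grid us" and sub: "set ts \<subseteq> set us"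
  shows "\<exists>\<psi>. incr_rep (\<lambda>\<omega>. \<phi> (map (\<lambda>t. B t \<omega>) ts)) us \<psi>"
proof -
  let ?f = "\<lambda>t l. \<Sum>k\<in>{k. k < length us - 1 \<and> us ! Suc k \<le> t}. l ! k"
  let ?\<psi> = "\<lambda>l. \<phi> (map (\<lambda>t. ?f t l) ts)"
  have "?\<psi> \<in> ClLip (length us - 1)"
    by (rule ClLip_comp[OF \<phi>]) (auto intro!: ClLip_sum ClLip_nth)
  moreover have "map (\<lambda>t. B t \<omega>) ts = map (\<lambda>t. ?f t (increments us \<omega>)) ts" for \<omega>
    by (rule map_cong[OF refl], rule B_grid_sum[OF g]) (use sub in blast)
  then have "(\<lambda>\<omega>. \<phi> (map (\<lambda>t. B t \<omega>) ts)) = (\<lambda>\<omega>. ?\<psi> (increments us \<omega>))" by (simp only:)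
  ultimately have "incr_rep (\<lambda>\<omega>. \<phi> (map (\<lambda>t. B t \<omega>) ts)) us ?\<psi>"
    using g unfolding incr_rep_def by blast
  then show ?thesis by blast
qed

text \<open>Only the finitely many times involved are recorded, not a grid: several functions can
  then be represented on one grid that contains all their times and, if required,
  \<open>s\<close>.\<close>

lemma Lip_ex_incr_rep:
  assumes "X \<in> Lip_on I" "I \<subseteq> {0..}"
  shows "\<exists>S. finite S \<and> S \<subseteq> I \<and> (\<forall>us. grid us \<longrightarrow> S \<subseteq> set us \<longrightarrow> (\<exists>\<phi>. incr_rep X us \<phi>))"
proof -
  obtain \<phi> ts where p: "X = (\<lambda>\<omega>. \<phi> (map (\<lambda>t. B t \<omega>) ts))" "set ts \<subseteq> I" "\<phi> \<in> ClLip (length ts)"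
    using assms unfolding Lip_on_def by blast
  then show ?thesis by (intro exI[of _ "set ts"]) (auto intro: ex_incr_rep)
qed

lemma incr_rep_Lip_on:
  assumes "incr_rep X ts \<phi>" "set ts \<subseteq> I"
  shows "X \<in> Lip_on I"
proof -
  have \<phi>: "\<phi> \<in> ClLip (length ts - 1)" and X: "X = (\<lambda>\<omega>. \<phi> (increments ts \<omega>))"
    using assms(1) unfolding incr_rep_def by auto
  let ?\<psi> = "\<lambda>l. \<phi> (map (\<lambda>k. l ! Suc k - l ! k) [0..<length ts - 1])"
  have "?\<psi> \<in> ClLip (length ts)"
    by (rule ClLip_comp[OF \<phi>]) (auto intro!: ClLip_intros)
  moreover have "increments ts \<omega> = map (\<lambda>k. map (\<lambda>t. B t \<omega>) ts ! Suc k
      - map (\<lambda>t. B t \<omega>) ts ! k) [0..<length ts - 1]" for \<omega>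
    by (auto simp: increments_def)
  ultimately show ?thesis
    unfolding Lip_on_def X using assms(2) by (intro CollectI exI[of _ ?\<psi>] exI[of _ ts]) auto
qed

lemma Lip_common_rep:
  assumes "X \<in> Lip" "Y \<in> Lip" "0 \<le> s"
  obtains us \<phi> \<psi> where "incr_rep X us \<phi>" "incr_rep Y us \<psi>" "s \<in> set us" "grid us"
proof -
  obtain S where S: "finite S" "S \<subseteq> {0..}" "\<And>us. grid us \<Longrightarrow> S \<subseteq> set us \<Longrightarrow> \<exists>\<phi>. incr_rep X us \<phi>"
    using Lip_ex_incr_rep[of X "{0..}"] assms(1) unfolding Lip_eq by auto
  obtain R where R: "finite R" "R \<subseteq> {0..}" "\<And>us. grid us \<Longrightarrow> R \<subseteq> set us \<Longrightarrow> \<exists>\<phi>. incr_rep Y us \<phi>"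
    using Lip_ex_incr_rep[of Y "{0..}"] assms(2) unfolding Lip_eq by auto
  define us where "us = sorted_list_of_set (insert 0 (insert s (S \<union> R)))"
  have "grid us" "set us = insert 0 (insert s (S \<union> R))"
    unfolding us_def using S R assms(3) by (intro grid_sorted_list; auto)+
  then show thesis using S(3)[of us] R(3)[of us] that by auto
qed

subsection \<open>Iterated expectations\<close>

lemma vnorm_snoc: "length ys = k \<Longrightarrow> vnorm (Suc k) (ys @ [z]) = vnorm k ys + \<bar>z\<bar>"
  by (auto simp: vnorm_def nth_append intro!: sum.cong)

lemma vdist_snoc: "length ys = k \<Longrightarrow> length zs = k \<Longrightarrow> vdist (Suc k) (ys @ [z]) (zs @ [z])
    = vdist k ys zs"
  by (auto simp: vdist_def nth_append intro!: sum.cong)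

lemma ClLip_append:
  assumes "\<phi> \<in> ClLip (length ys + n)"
  shows "(\<lambda>xs. \<phi> (ys @ xs)) \<in> ClLip n"
proof (rule ClLip_comp[OF assms])
  fix i assume "i < length ys + n"
  then show "(\<lambda>x. (ys @ x) ! i) \<in> ClLip n"
    by (cases "i < length ys") (auto simp: nth_append intro: ClLip_nth)
qed simp

lemma PG_snoc:
  assumes "\<phi> \<in> ClLip (Suc (length ys))"
  shows "(\<lambda>z. \<phi> (ys @ [c * z])) \<in> PG"
  unfolding PG_def mem_Collect_eq
proof (rule ClLip_comp[OF assms])
  fix i assume "i < Suc (length ys)"
  then show "(\<lambda>x. (ys @ [c * x ! 0]) ! i) \<in> ClLip 1"
    by (cases "i < length ys") (auto simp: nth_append less_Suc_eq intro: ClLip_cmult ClLip_nth)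
qed simp

lemma PG_ClLip1: "\<phi> \<in> ClLip 1 \<Longrightarrow> (\<lambda>z. \<phi> [c * z]) \<in> PG"
  using PG_snoc[of \<phi> "[]"] by simp

context sublinear_expectation_space
begin

lemma H_PG: "X \<in> H \<Longrightarrow> f \<in> PG \<Longrightarrow> (\<lambda>w. f (X w)) \<in> H"
  using comp_closed[of "[X]" "\<lambda>l. f (l ! 0)"] by (simp add: PG_def vec_at_def)

lemma diff_closed: "X \<in> H \<Longrightarrow> Y \<in> H \<Longrightarrow> (\<lambda>\<omega>. X \<omega> - Y \<omega>) \<in> H"
  using add_closed[of X "\<lambda>\<omega>. -1 * Y \<omega>"] scale_closed[of Y "-1"] by simp

lemma E_diff_le_abs: "X \<in> H \<Longrightarrow> Y \<in> H \<Longrightarrow> E X - E Y \<le> E (\<lambda>\<omega>. \<bar>X \<omega> - Y \<omega>\<bar>)"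
proof -
  assume XY: "X \<in> H" "Y \<in> H"
  have "E X \<le> E (\<lambda>\<omega>. (X \<omega> - Y \<omega>) + Y \<omega>)" by simp
  also have "\<dots> \<le> E (\<lambda>\<omega>. X \<omega> - Y \<omega>) + E Y" by (intro subadditive diff_closed XY)
  also have "E (\<lambda>\<omega>. X \<omega> - Y \<omega>) \<le> E (\<lambda>\<omega>. \<bar>X \<omega> - Y \<omega>\<bar>)"
    by (intro mono abs_closed diff_closed XY) simp
  finally show ?thesis by simp
qed

text \<open>The weight \<open>1 + |x| + |y| + 2 |z|\<close> is at most
  \<open>(1 + |x| + |y|) * (1 + 2 |z|)\<close>, so the last variable \<open>z\<close> separates and
  its share integrates to the constant \<open>M\<close>.\<close>

lemma ClLip_partial_expectation:
  assumes \<psi>: "\<psi> \<in> ClLip (Suc k)" and X: "X \<in> H"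
  shows "(\<lambda>ys. E (\<lambda>w. \<psi> (ys @ [c * X w]))) \<in> ClLip k"
proof -
  obtain C m where C: "0 \<le> C" and le: "\<And>x y. length x = Suc k \<Longrightarrow> length y = Suc k \<Longrightarrow>
     \<bar>\<psi> x - \<psi> y\<bar> \<le> C * (1 + vnorm (Suc k) x + vnorm (Suc k) y) ^ m * vdist (Suc k) x y"
    using ClLipE[OF \<psi>] by blast
  define M where "M = E (\<lambda>w. (1 + 2 * \<bar>c * X w\<bar>) ^ m)"
  have PGM: "(\<lambda>z. (1 + 2 * \<bar>c * z\<bar>) ^ m) \<in> PG" by (intro PG_intros)
  have M0: "0 \<le> M"
    using mono[OF const_closed H_PG[OF X PGM], of 0] by (simp add: const_preserving M_def)
  have H: "(\<lambda>w. \<psi> (ys @ [c * X w])) \<in> H" if "length ys = k" for ys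
    using H_PG[OF X PG_snoc[of \<psi> ys c]] \<psi> that by simp
  have bd: "E (\<lambda>w. \<psi> (x @ [c * X w])) - E (\<lambda>w. \<psi> (y @ [c * X w]))
      \<le> C * M * (1 + vnorm k x + vnorm k y) ^ m * vdist k x y"
    if l: "length x = k" "length y = k" for x y
  proof -
    let ?a = "1 + vnorm k x + vnorm k y"
    have a: "1 \<le> ?a" by simp
    have "E (\<lambda>w. \<psi> (x @ [c * X w])) - E (\<lambda>w. \<psi> (y @ [c * X w]))
      \<le> E (\<lambda>w. \<bar>\<psi> (x @ [c * X w]) - \<psi> (y @ [c * X w])\<bar>)"
      by (intro E_diff_le_abs H l)
    also have "\<dots> \<le> E (\<lambda>w. (C * ?a ^ m * vdist k x y) * (1 + 2 * \<bar>c * X w\<bar>) ^ m)"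
    proof (rule mono)
      fix w
      let ?z = "c * X w"
      have "\<bar>\<psi> (x @ [?z]) - \<psi> (y @ [?z])\<bar> \<le> C * (1 + (vnorm k x + \<bar>?z\<bar>) + (vnorm k y
          + \<bar>?z\<bar>)) ^ m * vdist k x y"
        using le[of "x @ [?z]" "y @ [?z]"] l vnorm_snoc[OF l(1)] vnorm_snoc[OF l(2)] vdist_snoc[OF
            l] by simp
      also have "\<dots> \<le> C * (?a * (1 + 2 * \<bar>?z\<bar>)) ^ m * vdist k x y"
      proof -
        have "1 * (2 * \<bar>?z\<bar>) \<le> ?a * (2 * \<bar>?z\<bar>)" by (intro mult_right_mono a) simp
        then have "1 + (vnorm k x + \<bar>?z\<bar>) + (vnorm k y + \<bar>?z\<bar>) \<le> ?a * (1 + 2 * \<bar>?z\<bar>)"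
          by (simp only: distrib_left) simp
        then show ?thesis
          using C by (intro mult_right_mono mult_left_mono power_mono) auto
      qed
      also have "\<dots> = (C * ?a ^ m * vdist k x y) * (1 + 2 * \<bar>?z\<bar>) ^ m"
        by (simp only: power_mult_distrib mult_ac)
      finally show "\<bar>\<psi> (x @ [?z]) - \<psi> (y @ [?z])\<bar>
          \<le> (C * ?a ^ m * vdist k x y) * (1 + 2 * \<bar>?z\<bar>) ^ m" .
    qed (intro abs_closed diff_closed H l scale_closed H_PG[OF X PGM])+
    also have "\<dots> = (C * ?a ^ m * vdist k x y) * M"
      unfolding M_def using C by (intro pos_homogeneous H_PG[OF X PGM]) simp
    finally show ?thesis by (simp only: mult_ac)
  qed
  have sym: "vdist k x y = vdist k y x" for x y by (simp add: vdist_def abs_minus_commute)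
  show ?thesis
  proof (rule ClLipI[of "C * M"])
    show "0 \<le> C * M" using C M0 by simp
    fix x y :: "real list" assume l: "length x = k" "length y = k"
    show "\<bar>E (\<lambda>w. \<psi> (x @ [c * X w])) - E (\<lambda>w. \<psi> (y @ [c * X w]))\<bar>
        \<le> C * M * (1 + vnorm k x + vnorm k y) ^ m * vdist k x y"
      using bd[OF l] bd[OF l(2,1)] by (simp add: abs_le_iff sym[of y x] add_ac)
  qed
qed

text \<open>Independence turns the joint expectation of \<open>X\<close> and its copy into an
  iterated one, and equality in law replaces the copy by \<open>X\<close> in the inner expectation.
  What remains is a statement about the law of \<open>X\<close> alone.\<close>

lemma gnormal_functional:
  assumes "G_normal H E G X"
  shows "gnormal_functional (\<lambda>f. E (\<lambda>w. f (X w))) (\<lambda>\<alpha>. 2 * G \<alpha>)"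
proof -
  have X: "X \<in> H" and var: "\<And>\<alpha>. E (\<lambda>\<omega>. \<alpha> * (X \<omega>)\<^sup>2) = 2 * G \<alpha>"
  proof -
    show "X \<in> H" using assms unfolding G_normal_def by blast
    have "1 / 2 * E (\<lambda>\<omega>. \<alpha> * (X \<omega>)\<^sup>2) = G \<alpha>" for \<alpha> using assms unfolding G_normal_def by blast
    then show "E (\<lambda>\<omega>. \<alpha> * (X \<omega>)\<^sup>2) = 2 * G \<alpha>" for \<alpha> by (simp add: field_simps)
  qed
  obtain X' where X': "X' \<in> H" "eq_in_distr E X' X" "independent_from E [X] X'"
    "\<And>a b. 0 \<le> a \<Longrightarrow> 0 \<le> b \<Longrightarrow>
      eq_in_distr E (\<lambda>\<omega>. a * X \<omega> + b * X' \<omega>) (\<lambda>\<omega>. sqrt (a\<^sup>2 + b\<^sup>2) * X \<omega>)"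
    using assms unfolding G_normal_def by blast
  have eqd: "E (\<lambda>w. f (Y w)) = E (\<lambda>w. f (Z w))" if "eq_in_distr E Y Z" "f \<in> PG" for f Y Z
    using that unfolding eq_in_distr_def PG_def by fastforce
  show ?thesis
  proof
    fix f :: "real \<Rightarrow> real" and a b :: real
    assume f: "f \<in> PG" and ab: "0 \<le> a" "0 \<le> b"
    have "(\<lambda>l. f (a * l ! 0 + b * l ! 1)) \<in> ClLip 2"
      by (rule ClLip_comp1[of f]) (use f in \<open>auto simp: PG_def intro!: ClLip_intros\<close>)
    then have "(\<lambda>l. f (a * l ! 0 + b * l ! 1)) \<in> ClLip (length [X] + 1)"
      by (simp add: numeral_2_eq_2)
    from bspec[OF X'(3)[unfolded independent_from_def] this]
    have "E (\<lambda>w. f (a * X w + b * X' w)) = E (\<lambda>w. E (\<lambda>w'. f (a * X w + b * X' w')))"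
      by (simp add: vec_at_def)
    also have "\<dots> = E (\<lambda>w. E (\<lambda>w'. f (a * X w + b * X w')))"
      by (simp only: eqd[OF X'(2) PG_affine[OF f]])
    finally have "E (\<lambda>w. f (a * X w + b * X' w)) = E (\<lambda>w. E (\<lambda>w'. f (a * X w + b * X w')))" .
    from this[symmetric] eqd[OF X'(4)[OF ab] f]
    show "E (\<lambda>w. E (\<lambda>w'. f (a * X w + b * X w'))) = E (\<lambda>w. f (sqrt (a\<^sup>2 + b\<^sup>2) * X w))"
      by (rule trans)
  next
    fix f g :: "real \<Rightarrow> real" assume fg: "f \<in> PG" "g \<in> PG"
    show "E (\<lambda>w. f (X w)) \<le> E (\<lambda>w. g (X w))" if "\<And>x. f x \<le> g x"
      by (rule mono[OF H_PG[OF X fg(1)] H_PG[OF X fg(2)] that])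
    show "E (\<lambda>w. f (X w) + g (X w)) \<le> E (\<lambda>w. f (X w)) + E (\<lambda>w. g (X w))"
      by (rule subadditive[OF H_PG[OF X fg(1)] H_PG[OF X fg(2)]])
    show "E (\<lambda>w. c * f (X w)) = c * E (\<lambda>w. f (X w))" if "0 \<le> c" for c
      by (rule pos_homogeneous[OF H_PG[OF X fg(1)] that])
  qed (rule const_preserving var)+
qed

end

locale G_setting = sublinear_expectation_space H E + G_expectation E \<xi>
  for H :: "('a \<Rightarrow> real) set" and E :: "('a \<Rightarrow> real) \<Rightarrow> real" and \<xi> :: "nat \<Rightarrow> 'a \<Rightarrow> real" +
  fixes \<sigma>_lo \<sigma>_hi :: real
  assumes normal: "\<And>i. G_normal H E (G_fun \<sigma>_lo \<sigma>_hi) (\<xi> i)"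
    and indep: "\<And>i. independent_from E (map \<xi> [0..<Suc i]) (\<xi> (Suc i))"
begin

lemma xi_H: "\<xi> i \<in> H"
  using normal unfolding G_normal_def by blast

sublocale gn: gnormal_functional "\<lambda>f. E (\<lambda>w. f (\<xi> 0 w))" "\<lambda>\<alpha>. 2 * G_fun \<sigma>_lo \<sigma>_hi \<alpha>"
  by (rule gnormal_functional[OF normal])

text \<open>Each \<open>\<xi> i\<close> is only assumed to be G-normal; that all of them share one
  law is the uniqueness theorem. It allows every expectation below to be written in terms of
  \<open>\<xi> 0\<close>.\<close>

lemma xi_identically_distributed: "f \<in> PG \<Longrightarrow> E (\<lambda>w. f (\<xi> i w)) = E (\<lambda>w. f (\<xi> 0 w))"
  by (rule gnormal_functional_unique[OF gnormal_functional[OF normal] gnormal_functional[OF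
      normal]])

text \<open>The expectation of \<open>\<phi> (sqrt d\<^sub>1 \<xi>\<^sub>1, \<dots>, sqrt d\<^sub>n \<xi>\<^sub>n)\<close> as an iterated expectation, the innermost
  one being taken with respect to the last variable.\<close>

primrec nest :: "real list \<Rightarrow> (real list \<Rightarrow> real) \<Rightarrow> real" where
  "nest [] \<phi> = \<phi> []"
| "nest (d # ds) \<phi> = E (\<lambda>w. nest ds (\<lambda>xs. \<phi> (sqrt d * \<xi> 0 w # xs)))"

lemma nest_cong: "(\<And>x. length x = length ds \<Longrightarrow> \<phi> x = \<psi> x) \<Longrightarrow> nest ds \<phi> = nest ds \<psi>"
proof (induction ds arbitrary: \<phi> \<psi>)
  case (Cons d ds)
  have "nest ds (\<lambda>xs. \<phi> (z # xs)) = nest ds (\<lambda>xs. \<psi> (z # xs))" for z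
    by (rule Cons.IH) (simp add: Cons.prems)
  then show ?case by simp
qed simp

lemma nest_append: "nest (ds @ es) \<phi> = nest ds (\<lambda>ys. nest es (\<lambda>xs. \<phi> (ys @ xs)))"
  by (induction ds arbitrary: \<phi>) simp_all

lemma nest_const: "nest ds (\<lambda>_. c) = c"
  by (induction ds) (simp_all add: const_preserving)

lemma ClLip_nest: "\<phi> \<in> ClLip (k + length ds) \<Longrightarrow> (\<lambda>ys. nest ds (\<lambda>xs. \<phi> (ys @ xs))) \<in> ClLip k"
proof (induction ds arbitrary: k)
  case (Cons d ds)
  have "(\<lambda>ys. nest ds (\<lambda>xs. \<phi> (ys @ xs))) \<in> ClLip (Suc k)"
    by (rule Cons.IH) (use Cons.prems in simp)
  from ClLip_partial_expectation[OF this xi_H[of 0], of "sqrt d"]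
  show ?case by simp
qed simp

lemma nest_H:
  assumes "\<phi> \<in> ClLip (Suc (length ds))"
  shows "(\<lambda>w. nest ds (\<lambda>xs. \<phi> (c * \<xi> 0 w # xs))) \<in> H"
proof -
  have "(\<lambda>ys. nest ds (\<lambda>xs. \<phi> (ys @ xs))) \<in> ClLip 1"
    by (rule ClLip_nest) (use assms in simp)
  from H_PG[OF xi_H[of 0] PG_ClLip1[OF this, of c]] show ?thesis by simp
qed

lemma ClLip_Cons: "\<phi> \<in> ClLip (Suc n) \<Longrightarrow> (\<lambda>xs. \<phi> (z # xs)) \<in> ClLip n"
  using ClLip_append[of \<phi> "[z]" n] by simp

lemma nest_mono:
  "\<phi> \<in> ClLip (length ds) \<Longrightarrow> \<psi> \<in> ClLip (length ds) \<Longrightarrow>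
   (\<And>x. length x = length ds \<Longrightarrow> \<phi> x \<le> \<psi> x) \<Longrightarrow> nest ds \<phi> \<le> nest ds \<psi>"
proof (induction ds arbitrary: \<phi> \<psi>)
  case (Cons d ds)
  show ?case
    unfolding nest.simps
    using Cons.prems by (intro mono nest_H Cons.IH ClLip_Cons) auto
qed simp

lemma nest_subadd:
  "\<phi> \<in> ClLip (length ds) \<Longrightarrow> \<psi> \<in> ClLip (length ds) \<Longrightarrow> nest ds (\<lambda>x. \<phi> x + \<psi> x) \<le> nest ds \<phi> + nest ds \<psi>"
proof (induction ds arbitrary: \<phi> \<psi>)
  case (Cons d ds)
  have p: "\<phi> \<in> ClLip (Suc (length ds))" "\<psi> \<in> ClLip (Suc (length ds))" using Cons.prems by auto
  note s = ClLip_add[OF p]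
  have "nest (d # ds) (\<lambda>x. \<phi> x + \<psi> x) \<le> E (\<lambda>w. nest ds (\<lambda>xs. \<phi> (sqrt d * \<xi> 0 w # xs))
      + nest ds (\<lambda>xs. \<psi> (sqrt d * \<xi> 0 w # xs)))"
    unfolding nest.simps
    by (intro mono nest_H[OF s] add_closed nest_H p Cons.IH ClLip_Cons)
  also have "\<dots> \<le> nest (d # ds) \<phi> + nest (d # ds) \<psi>"
    unfolding nest.simps by (intro subadditive nest_H p)
  finally show ?case .
qed simp

lemma nest_cmult:
  "\<phi> \<in> ClLip (length ds) \<Longrightarrow> 0 \<le> c \<Longrightarrow> nest ds (\<lambda>x. c * \<phi> x) = c * nest ds \<phi>"
proof (induction ds arbitrary: \<phi>)
  case (Cons d ds)
  then have p: "\<phi> \<in> ClLip (Suc (length ds))" by auto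
  have "nest (d # ds) (\<lambda>x. c * \<phi> x) = E (\<lambda>w. c * nest ds (\<lambda>xs. \<phi> (sqrt d * \<xi> 0 w # xs)))"
    unfolding nest.simps using Cons.IH[OF ClLip_Cons[OF p] Cons.prems(2)] by simp
  also have "\<dots> = c * nest (d # ds) \<phi>"
    unfolding nest.simps by (intro pos_homogeneous nest_H p Cons.prems)
  finally show ?case .
qed simp

text \<open>Stability in the form in which it is used: independent increments over adjacent cells of
  lengths \<open>d\<close> and \<open>e\<close> add up to an increment over one cell of length
  \<open>d + e\<close>.\<close>

lemma nest_split:
  assumes \<phi>: "\<phi> \<in> ClLip (Suc (length ds))" and "0 \<le> d" "0 \<le> e"
  shows "nest (d # e # ds) (\<lambda>l. \<phi> ((l ! 0 + l ! 1) # drop 2 l)) = nest ((d + e) # ds) \<phi>"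
proof -
  have "(\<lambda>ys. nest ds (\<lambda>xs. \<phi> (ys @ xs))) \<in> ClLip 1"
    by (rule ClLip_nest) (use \<phi> in simp)
  from PG_ClLip1[OF this, of 1] have "(\<lambda>z. nest ds (\<lambda>xs. \<phi> (z # xs))) \<in> PG" by simp
  from gn.N_stable[OF this, of "sqrt d" "sqrt e"] assms(2,3) show ?thesis
      by (simp add: numeral_2_eq_2)
qed

text \<open>The last variable is independent from all earlier ones, so it can be integrated out
  first and, by equality of laws, as a copy of \<open>\<xi> 0\<close>; the result is again a test
  function of the remaining ones.\<close>

lemma E_xi_eq_nest:
  "\<phi> \<in> ClLip n \<Longrightarrow> E (\<lambda>w. \<phi> (map (\<lambda>k. sqrt (d k) * \<xi> k w) [j..<j + n])) = nest (map d [j..<j + n]) \<phi>"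
proof (induction n arbitrary: \<phi>)
  case 0
  then show ?case by (simp add: const_preserving)
next
  case (Suc n)
  let ?L = "\<lambda>w. map (\<lambda>k. sqrt (d k) * \<xi> k w) [j..<j + n]"
  let ?s = "sqrt (d (j + n))"
  define g where "g ys = nest [d (j + n)] (\<lambda>xs. \<phi> (ys @ xs))" for ys
  have g: "g \<in> ClLip n"
    unfolding g_def by (rule ClLip_nest) (use Suc.prems in simp)
  have last: "E (\<lambda>w'. \<phi> (?L w @ [?s * \<xi> (j + n) w'])) = g (?L w)" for w
  proof -
    have "(\<lambda>z. \<phi> (?L w @ [?s * z])) \<in> PG"
      by (rule PG_snoc) (use Suc.prems in simp)
    from xi_identically_distributed[OF this, of "j + n"] show ?thesis by (simp add: g_def)
  qed
  have "E (\<lambda>w. \<phi> (?L w @ [?s * \<xi> (j + n) w])) = E (\<lambda>w. E (\<lambda>w'. \<phi> (?L w @ [?s * \<xi> (j + n) w'])))"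
  proof (cases "j + n")
    \<comment> \<open>There are no earlier variables and the independence hypothesis is silent; the
      inner expectation is a constant.\<close>
    case 0
    have "(\<lambda>z. \<phi> ([] @ [?s * z])) \<in> PG"
      by (rule PG_snoc) (use Suc.prems 0 in simp)
    then show ?thesis using 0 by (simp add: const_preserving)
  next
    case (Suc i)
    \<comment> \<open>Independence is assumed from all of \<open>\<xi> 0, ..., \<xi> i\<close>, so
      the integrand is read as a function of all of them that ignores the first
      \<open>j\<close>.\<close>
    let ?\<psi> = "\<lambda>l. \<phi> (map (\<lambda>k. sqrt (d k) * l ! k) [j..<Suc (j + n)])"
    have "?\<psi> \<in> ClLip (Suc (j + n))"
    proof (rule ClLip_comp[OF Suc.prems])
      fix i assume i: "i < Suc n"
      then have "map (\<lambda>k. sqrt (d k) * x ! k) [j..<Suc (j + n)] ! i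
          = sqrt (d (j + i)) * x ! (j + i)" for x
        by (simp add: nth_append del: upt_Suc)
      then show "(\<lambda>x. map (\<lambda>k. sqrt (d k) * x ! k) [j..<Suc (j + n)] ! i) \<in> ClLip (Suc (j + n))"
        using i by (auto intro!: ClLip_cmult ClLip_nth simp del: upt_Suc)
    qed simp
    moreover have "?\<psi> (vec_at (map \<xi> [0..<Suc i]) w @ [\<xi> (Suc i) w'])
        = \<phi> (?L w @ [?s * \<xi> (j + n) w'])" for w w'
    proof -
      let ?l = "vec_at (map \<xi> [0..<Suc i]) w @ [\<xi> (Suc i) w']"
      have "?l ! k = \<xi> k w" if "k < j + n" for k
        using that unfolding Suc vec_at_def by (simp add: nth_append del: upt_Suc)
      moreover have "?l ! (j + n) = \<xi> (j + n) w'" unfolding Suc vec_at_def by (simp add: nth_append)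
      ultimately have "map (\<lambda>k. sqrt (d k) * ?l ! k) [j..<Suc (j + n)] = ?L w @ [?s * \<xi> (j + n) w']"
        by (simp add: upt_Suc_append)
      then show ?thesis by (rule arg_cong)
    qed
    moreover have "length (map \<xi> [0..<Suc i]) + 1 = Suc (j + n)" using Suc by simp
    ultimately show ?thesis
      using bspec[OF indep[of i, unfolded independent_from_def], of ?\<psi>] by (simp only:)
  qed
  also have "\<dots> = E (\<lambda>w. g (?L w))" by (simp only: last)
  also have "\<dots> = nest (map d [j..<j + n]) g" by (rule Suc.IH[OF g])
  also have "\<dots> = nest (map d [j..<j + n] @ [d (j + n)]) \<phi>"
    unfolding nest_append g_def ..
  finally show ?case by simp
qed

lemma E_scaled_xi:
  assumes "\<phi> \<in> ClLip (length ts - 1 - j)" "j \<le> length ts - 1"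
  shows "E (\<lambda>w. \<phi> (scaled_xi ts j w)) = nest (drop j (durations ts)) \<phi>"
proof -
  have "j + (length ts - 1 - j) = length ts - 1" using assms(2) by simp
  then show ?thesis
    using E_xi_eq_nest[OF assms(1), of "\<lambda>k. ts ! Suc k - ts ! k" j]
    by (simp add: scaled_xi_def durations_alt drop_map)
qed

subsection \<open>The G-expectation of cylinder functions\<close>

text \<open>The increment over the cell from \<open>a\<close> to \<open>b\<close> is the sum of the
  two new increments, at position \<open>length as\<close> and the next one. The iterated
  expectations agree up to that cell, and there \<open>nest_split\<close> applies.\<close>

lemma incr_rep_insert:
  assumes rep: "incr_rep X (as @ a # b # bs) \<phi>" and g: "grid (as @ a # m # b # bs)" and m: "a < m"
      "m < b"
  shows "\<exists>\<psi>. incr_rep X (as @ a # m # b # bs) \<psi> \<and>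
    nest (durations (as @ a # m # b # bs)) \<psi> = nest (durations (as @ a # b # bs)) \<phi>"
proof -
  let ?n = "length as"
  define \<psi> where "\<psi> l = \<phi> (take ?n l @ (l ! ?n + l ! Suc ?n) # drop (?n + 2) l)" for l
  have \<phi>: "\<phi> \<in> ClLip (Suc (?n + length bs))" and X: "X = (\<lambda>\<omega>. \<phi> (increments (as @ a # b # bs) \<omega>))"
    using rep unfolding incr_rep_def by auto
  have "\<psi> \<in> ClLip (?n + length bs + 2)"
    unfolding \<psi>_def
  proof (rule ClLip_comp[OF \<phi>])
    fix i assume i: "i < Suc (?n + length bs)"
    show "(\<lambda>x. (take ?n x @ (x ! ?n + x ! Suc ?n) # drop (?n + 2) x) ! i)
        \<in> ClLip (?n + length bs + 2)"
    proof (cases i ?n rule: linorder_cases)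
      case less
      then have "(\<lambda>x. (take ?n x @ (x ! ?n + x ! Suc ?n) # drop (?n + 2) x) ! i)
          \<in> ClLip (?n + length bs + 2)
         \<longleftrightarrow> (\<lambda>x. x ! i) \<in> ClLip (?n + length bs + 2)"
        by (intro ClLip_cong) (simp add: nth_append)
      then show ?thesis using less by (simp add: ClLip_nth)
    next
      case equal
      then have "(\<lambda>x. (take ?n x @ (x ! ?n + x ! Suc ?n) # drop (?n + 2) x) ! i)
          \<in> ClLip (?n + length bs + 2)
         \<longleftrightarrow> (\<lambda>x. x ! ?n + x ! Suc ?n) \<in> ClLip (?n + length bs + 2)"
        by (intro ClLip_cong) (simp add: nth_append)
      then show ?thesis by (simp add: ClLip_nth ClLip_add)
    next
      case greater
      then obtain p where p: "i = ?n + Suc p" using less_imp_Suc_add by fastforce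
      then have "(\<lambda>x. (take ?n x @ (x ! ?n + x ! Suc ?n) # drop (?n + 2) x) ! i)
          \<in> ClLip (?n + length bs + 2)
         \<longleftrightarrow> (\<lambda>x. x ! Suc i) \<in> ClLip (?n + length bs + 2)"
        using i by (intro ClLip_cong) (simp add: nth_append)
      then show ?thesis using i by (simp add: ClLip_nth)
    qed
  qed simp
  moreover have "X = (\<lambda>\<omega>. \<psi> (increments (as @ a # m # b # bs) \<omega>))"
    unfolding X \<psi>_def
    by (subst (1 2 3 4 5) increments_append) (simp add: increments_Cons nth_append)
  moreover have "nest (durations (as @ a # m # b # bs)) \<psi> = nest (durations (as @ a # b # bs)) \<phi>"
  proof -
    have D: "nest (durations (as @ a # c # cs)) \<theta>
        = nest (durations (as @ [a])) (\<lambda>ys. nest ((c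
            - a) # durations (c # cs)) (\<lambda>xs. \<theta> (ys @ xs)))" for c cs and \<theta> :: "real list \<Rightarrow> real"
      by (subst durations_append) (simp add: nest_append durations_Cons)
    show ?thesis
      unfolding D
    proof (rule nest_cong)
      fix ys :: "real list" assume "length ys = length (durations (as @ [a]))"
      then have l: "length ys = ?n" by simp
      have \<phi>': "(\<lambda>xs. \<phi> (ys @ xs)) \<in> ClLip (Suc (length (durations (b # bs))))"
        by (rule ClLip_append) (use \<phi> l in \<open>simp add: add.commute\<close>)
      have "(\<lambda>xs. \<psi> (ys @ xs)) = (\<lambda>l. (\<lambda>xs. \<phi> (ys @ xs)) ((l ! 0 + l ! 1) # drop 2 l))"
        using l by (simp add: \<psi>_def nth_append)
      then show "nest ((m - a) # durations (m # b # bs)) (\<lambda>xs. \<psi> (ys @ xs))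
          = nest ((b - a) # durations (b # bs)) (\<lambda>xs. \<phi> (ys @ xs))"
        using nest_split[OF \<phi>', of "m - a" "b - m"] m by (simp add: durations_Cons del: nest.simps)
    qed
  qed
  ultimately show ?thesis using g unfolding incr_rep_def by (intro exI[of _ \<psi>]) simp
qed

lemma incr_rep_extend:
  assumes rep: "incr_rep X (as @ [a]) \<phi>" and g: "grid (as @ [a, m])"
  shows "\<exists>\<psi>. incr_rep X (as @ [a, m]) \<psi> \<and> nest (durations (as @ [a, m])) \<psi>
      = nest (durations (as @ [a])) \<phi>"
proof -
  let ?n = "length as"
  define \<psi> where "\<psi> l = \<phi> (take ?n l)" for l
  have \<phi>: "\<phi> \<in> ClLip ?n" and X: "X = (\<lambda>\<omega>. \<phi> (increments (as @ [a]) \<omega>))"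
    using rep unfolding incr_rep_def by auto
  have "\<psi> \<in> ClLip (Suc ?n)" unfolding \<psi>_def by (rule ClLip_take[OF \<phi>]) simp
  moreover have "X = (\<lambda>\<omega>. \<psi> (increments (as @ [a, m]) \<omega>))"
    unfolding X \<psi>_def by (subst (2) increments_append) simp
  moreover have "nest (durations (as @ [a, m])) \<psi>
      = nest (durations (as @ [a])) (\<lambda>ys. nest [m - a] (\<lambda>xs. \<psi> (ys @ xs)))"
    by (subst durations_append) (simp add: nest_append durations_Cons durations_def)
  moreover have "\<dots> = nest (durations (as @ [a])) \<phi>"
    by (rule nest_cong) (simp add: \<psi>_def const_preserving)
  ultimately show ?thesis using g unfolding incr_rep_def by (intro exI[of _ \<psi>]) simp
qed

lemma incr_rep_refine:
  assumes "incr_rep X ts \<phi>" "grid us" "set ts \<subseteq> set us"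
  shows "\<exists>\<psi>. incr_rep X us \<psi> \<and> nest (durations us) \<psi> = nest (durations ts) \<phi>"
proof -
  have "grid ts" using assms(1) unfolding incr_rep_def by blast
  then show ?thesis using assms(2,3)
  proof (induction rule: grid_refine_induct)
    case base
    then show ?case using assms(1) by blast
  next
    case (insert as a b bs m)
    then show ?case using incr_rep_insert by metis
  next
    case (extend as a m)
    then show ?case using incr_rep_extend by metis
  qed
qed

text \<open>Both representations are carried to the union of the two grids, where their functions
  must agree. This makes the choice in \<open>Ehat\<close> harmless.\<close>

lemma nest_unique:
  assumes "incr_rep X ts \<phi>" "incr_rep X us \<psi>"
  shows "nest (durations ts) \<phi> = nest (durations us) \<psi>"
proof -
  have g: "grid ts" "grid us" using assms unfolding incr_rep_def by auto
  define vs where "vs = sorted_list_of_set (insert 0 (set ts \<union> set us))"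
  have vs: "grid vs" "set vs = insert 0 (set ts \<union> set us)"
    unfolding vs_def using grid_nonneg g by (intro grid_sorted_list; auto)+
  obtain \<phi>' \<psi>' where
    "incr_rep X vs \<phi>'" "nest (durations vs) \<phi>' = nest (durations ts) \<phi>"
    "incr_rep X vs \<psi>'" "nest (durations vs) \<psi>' = nest (durations us) \<psi>"
    using incr_rep_refine[OF assms(1) vs(1)] incr_rep_refine[OF assms(2) vs(1)] vs(2) by auto
  moreover have "nest (durations vs) \<phi>' = nest (durations vs) \<psi>'"
    using calculation by (intro nest_cong incr_rep_unique) auto
  ultimately show ?thesis by simp
qed

lemma Ehat_eq_nest:
  assumes "incr_rep X ts \<phi>"
  shows "Ehat X = nest (durations ts) \<phi>"
proof -
  define p where "p = (SOME (ts, \<phi>). incr_rep X ts \<phi>)"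
  have "case p of (ts, \<phi>) \<Rightarrow> incr_rep X ts \<phi>"
    unfolding p_def by (rule someI[of _ "(ts, \<phi>)"]) (simp add: assms)
  then obtain us \<psi> where p: "p = (us, \<psi>)" "incr_rep X us \<psi>" by (cases p) auto
  then have "Ehat X = nest (durations us) \<psi>"
    using E_scaled_xi[of \<psi> us 0] unfolding Ehat_def p_def[symmetric] by (simp add: incr_rep_def)
  then show ?thesis using nest_unique[OF assms p(2)] by simp
qed

lemma incr_rep_conc:
  assumes rep: "incr_rep X (as @ s # bs) \<phi>"
  shows "incr_rep (\<lambda>\<omega>'. X (conc s \<omega> \<omega>')) (map (\<lambda>t. t
      - s) (s # bs)) (\<lambda>xs. \<phi> (increments (as @ [s]) \<omega> @ xs))"
proof -
  have g: "grid (as @ s # bs)" and \<phi>: "\<phi> \<in> ClLip (length as + length bs)"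
    and X: "X = (\<lambda>\<omega>. \<phi> (increments (as @ s # bs) \<omega>))"
    using rep unfolding incr_rep_def by auto
  have "(\<lambda>xs. \<phi> (increments (as @ [s]) \<omega> @ xs)) \<in> ClLip (length bs)"
    by (rule ClLip_append) (use \<phi> in simp)
  then show ?thesis
    using grid_splitD(5)[OF g] unfolding incr_rep_def X increments_conc[OF g] by simp
qed

lemma durations_shift: "durations (map (\<lambda>t. t - s) ts) = durations ts"
  by (auto simp: durations_def cpairs_map)

lemma Ehat_conc:
  assumes rep: "incr_rep X (as @ s # bs) \<phi>"
  shows "Ehat (\<lambda>\<omega>'. X (conc s \<omega> \<omega>')) = nest (durations (s # bs)) (\<lambda>xs. \<phi> (increments (as @ [s]) \<omega>
      @ xs))"
  using Ehat_eq_nest[OF incr_rep_conc[OF rep]] by (simp only: durations_shift)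

lemma incr_rep_Ehat_conc:
  assumes rep: "incr_rep X (as @ s # bs) \<phi>"
  shows "incr_rep (\<lambda>\<omega>. Ehat (\<lambda>\<omega>'. X (conc s \<omega> \<omega>'))) (as @ [s]) (\<lambda>ys. nest (durations (s # bs))
      (\<lambda>xs. \<phi> (ys @ xs)))"
proof -
  have g: "grid (as @ s # bs)" and \<phi>: "\<phi> \<in> ClLip (length as + length bs)"
    using rep unfolding incr_rep_def by auto
  have "(\<lambda>ys. nest (durations (s # bs)) (\<lambda>xs. \<phi> (ys @ xs))) \<in> ClLip (length as)"
    by (rule ClLip_nest) (use \<phi> in simp)
  then show ?thesis
    using grid_splitD(2)[OF g] Ehat_conc[OF rep] unfolding incr_rep_def by simp
qed

lemma rep_split: "incr_rep X us \<phi> \<Longrightarrow> s \<in> set us \<Longrightarrow> \<exists>as bs. incr_rep X (as @ s # bs) \<phi>"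
  by (metis split_list)

lemma Lip_rep_split:
  assumes "X \<in> Lip" "0 \<le> s"
  obtains as bs \<phi> where "incr_rep X (as @ s # bs) \<phi>"
  using Lip_common_rep[OF assms(1,1,2)] rep_split by metis

text \<open>On a grid through \<open>s\<close> the iterated expectation over all cells splits at
  \<open>s\<close>: the inner part is the expectation over the path after \<open>s\<close>, the
  outer part that over the path before.\<close>

lemma Ehat_tower:
  assumes "X \<in> Lip" "0 \<le> s"
  shows "Ehat (\<lambda>\<omega>. Ehat (\<lambda>\<omega>'. X (conc s \<omega> \<omega>'))) = Ehat X"
proof -
  obtain as bs \<phi> where rep: "incr_rep X (as @ s # bs) \<phi>" using Lip_rep_split[OF assms] .
  show ?thesis
    unfolding Ehat_eq_nest[OF incr_rep_Ehat_conc[OF rep]] Ehat_eq_nest[OF rep]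
    by (subst durations_append[of as s bs]) (rule nest_append[symmetric])
qed

lemma Ehat_conc_Lip_upto:
  assumes "X \<in> Lip" "0 \<le> s"
  shows "(\<lambda>\<omega>. Ehat (\<lambda>\<omega>'. X (conc s \<omega> \<omega>'))) \<in> Lip_upto s"
proof -
  obtain as bs \<phi> where rep: "incr_rep X (as @ s # bs) \<phi>" using Lip_rep_split[OF assms] .
  have g: "grid (as @ s # bs)" using rep unfolding incr_rep_def by blast
  have "0 \<le> t \<and> t \<le> s" if "t \<in> set (as @ [s])" for t
    using grid_nonneg[OF g, of t] grid_splitD(3)[OF g, of t] that by fastforce
  then show ?thesis
    unfolding Lip_upto_eq
    by (intro incr_rep_Lip_on[OF incr_rep_Ehat_conc[OF rep]]) (meson atLeastAtMost_iff subsetI)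
qed

lemma conc_Lip:
  assumes "X \<in> Lip" "0 \<le> s"
  shows "(\<lambda>\<omega>'. X (conc s \<omega> \<omega>')) \<in> Lip"
proof -
  obtain as bs \<phi> where rep: "incr_rep X (as @ s # bs) \<phi>" using Lip_rep_split[OF assms] .
  have "grid (map (\<lambda>t. t - s) (s # bs))"
    using incr_rep_conc[OF rep] unfolding incr_rep_def by blast
  from grid_nonneg[OF this] show ?thesis
    unfolding Lip_eq by (intro incr_rep_Lip_on[OF incr_rep_conc[OF rep]]) (meson atLeast_iff
        subsetI)
qed

lemma conc_Lip_upto:
  assumes "X \<in> Lip_upto s" "0 \<le> s"
  shows "X (conc s \<omega> \<omega>') = X \<omega>"
proof -
  obtain \<phi> ts where p: "X = (\<lambda>\<omega>. \<phi> (map (\<lambda>t. B t \<omega>) ts))" "set ts \<subseteq> {0..s}"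
    using assms unfolding Lip_upto_eq Lip_on_def by blast
  have "map (\<lambda>t. B t (conc s \<omega> \<omega>')) ts = map (\<lambda>t. B t \<omega>) ts"
    using p(2) assms(2) by (auto simp: B_conc_le)
  then show ?thesis unfolding p(1) by (rule arg_cong)
qed

text \<open>Removes the choice of a representation from the conditional expectation. The variables
  \<open>\<xi> k\<close> with \<open>k \<ge> j\<close> in the definition may be replaced by those
  driving a fresh path, because only the durations of the later cells matter.\<close>

lemma Ehat_cond_eq:
  assumes "X \<in> Lip" "0 \<le> s"
  shows "Ehat_cond s X = (\<lambda>\<omega>. Ehat (\<lambda>\<omega>'. X (conc s \<omega> \<omega>')))"
proof -
  define p where "p = (SOME (ts, \<phi>, j). incr_rep X ts \<phi> \<and> j < length ts \<and> ts ! j = s)"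
  obtain as bs \<phi> where rep: "incr_rep X (as @ s # bs) \<phi>" using Lip_rep_split[OF assms] .
  have "case p of (ts, \<phi>, j) \<Rightarrow> incr_rep X ts \<phi> \<and> j < length ts \<and> ts ! j = s"
    unfolding p_def by (rule someI[of _ "(as @ s # bs, \<phi>, length as)"]) (simp add: rep)
  then obtain ts \<psi> j where p: "p = (ts, \<psi>, j)" "incr_rep X ts \<psi>" "j < length ts" "ts ! j = s"
    by (cases p) auto
  define cs where "cs = take j ts"
  define ds where "ds = drop (Suc j) ts"
  have ts: "ts = cs @ s # ds" and j: "j = length cs"
    using id_take_nth_drop[OF p(3)] p(3,4) by (simp_all add: cs_def ds_def)
  have g: "\<psi> \<in> ClLip (length cs + length ds)" using p(2) unfolding incr_rep_def ts by simp
  show ?thesis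
  proof
    fix \<omega>
    have "(\<lambda>xs. \<psi> (increments (cs @ [s]) \<omega> @ xs)) \<in> ClLip (length ds)"
      by (rule ClLip_append) (use g in simp)
    then have "E (\<lambda>w. \<psi> (increments (cs @ [s]) \<omega> @ scaled_xi ts j w))
        = nest (drop j (durations ts)) (\<lambda>xs. \<psi> (increments (cs @ [s]) \<omega> @ xs))"
      by (intro E_scaled_xi[of "\<lambda>xs. \<psi> (increments (cs @ [s]) \<omega> @ xs)"]) (simp_all add: ts j)
    also have "drop j (durations ts) = durations (s # ds)"
      unfolding ts j by (subst durations_append) simp
    also have "nest (durations (s # ds)) (\<lambda>xs. \<psi> (increments (cs @ [s]) \<omega> @ xs))
        = Ehat (\<lambda>\<omega>'. X (conc s \<omega> \<omega>'))"
      using Ehat_conc[of X cs s ds \<psi>] p(2) ts by simp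
    also have "increments (cs @ [s]) \<omega> = take j (increments ts \<omega>)"
      unfolding ts j by (subst (2) increments_append) simp
    finally show "Ehat_cond s X \<omega> = Ehat (\<lambda>\<omega>'. X (conc s \<omega> \<omega>'))"
      unfolding Ehat_cond_def p_def[symmetric] p(1) by simp
  qed
qed

lemma Ehat_const: "Ehat (\<lambda>_. c) = c"
proof -
  have "incr_rep (\<lambda>_. c) [0] (\<lambda>_. c)" by (simp add: incr_rep_def grid_def)
  from Ehat_eq_nest[OF this] show ?thesis by (simp add: nest_const)
qed

text \<open>The order of \<open>X\<close> and \<open>Y\<close> on paths passes to the representing
  functions on all lists of the right length, since each of them is an increment vector.\<close>

lemma Ehat_mono:
  assumes "X \<in> Lip" "Y \<in> Lip" "\<And>\<omega>. X \<omega> \<le> Y \<omega>"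
  shows "Ehat X \<le> Ehat Y"
proof -
  obtain us \<phi> \<psi> where r: "incr_rep X us \<phi>" "incr_rep Y us \<psi>" "grid us"
    using Lip_common_rep[OF assms(1,2) order_refl] by metis
  show ?thesis
    unfolding Ehat_eq_nest[OF r(1)] Ehat_eq_nest[OF r(2)]
  proof (rule nest_mono)
    fix x :: "real list" assume "length x = length (durations us)"
    then obtain \<omega> where "increments us \<omega> = x" using increments_surj[OF r(3), of x] by auto
    then show "\<phi> x \<le> \<psi> x" using r assms(3)[of \<omega>] unfolding incr_rep_def by simp
  qed (use r in \<open>simp_all add: incr_rep_def\<close>)
qed

lemma Ehat_subadd:
  assumes "X \<in> Lip" "Y \<in> Lip"
  shows "Ehat (\<lambda>\<omega>. X \<omega> + Y \<omega>) \<le> Ehat X + Ehat Y"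
proof -
  obtain us \<phi> \<psi> where r: "incr_rep X us \<phi>" "incr_rep Y us \<psi>" "grid us"
    using Lip_common_rep[OF assms order_refl] by metis
  have "incr_rep (\<lambda>\<omega>. X \<omega> + Y \<omega>) us (\<lambda>x. \<phi> x + \<psi> x)"
    using r unfolding incr_rep_def by (simp add: ClLip_add)
  from Ehat_eq_nest[OF this] show ?thesis
    unfolding Ehat_eq_nest[OF r(1)] Ehat_eq_nest[OF r(2)]
    using nest_subadd[of \<phi> "durations us" \<psi>] r by (simp add: incr_rep_def)
qed

lemma Ehat_cmult:
  assumes "X \<in> Lip" "0 \<le> c"
  shows "Ehat (\<lambda>\<omega>. c * X \<omega>) = c * Ehat X"
proof -
  obtain us \<phi> where r: "incr_rep X us \<phi>"
    using Lip_common_rep[OF assms(1,1) order_refl] by metis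
  have "incr_rep (\<lambda>\<omega>. c * X \<omega>) us (\<lambda>x. c * \<phi> x)"
    using r unfolding incr_rep_def by (simp add: ClLip_cmult)
  from Ehat_eq_nest[OF this] show ?thesis
    unfolding Ehat_eq_nest[OF r] using nest_cmult[of \<phi> "durations us" c] r assms(2)
        by (simp add: incr_rep_def)
qed

lemma Ehat_B:
  assumes "0 \<le> h" "f \<in> PG"
  shows "Ehat (\<lambda>\<omega>. f (B h \<omega>)) = E (\<lambda>w. f (sqrt h * \<xi> 0 w))"
proof (cases "h = 0")
  \<comment> \<open>For \<open>h = 0\<close> the list \<open>[0, h]\<close> would not be strictly
    increasing.\<close>
  case False
  have "incr_rep (\<lambda>\<omega>. f (B h \<omega>)) [0, h] (\<lambda>l. f (l ! 0))"
    using assms False by (simp add: incr_rep_def grid_def PG_def increments_Cons)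
  from Ehat_eq_nest[OF this] show ?thesis by (simp add: durations_def)
qed (simp add: Ehat_const const_preserving)

lemma Ehat_B_mean: "0 \<le> h \<Longrightarrow> Ehat (\<lambda>\<omega>. c * B h \<omega>) = 0"
  using Ehat_B[of h "\<lambda>x. c * x"] gn.N_mean[of "c * sqrt h"] by (simp add: PG_intros mult.assoc)

lemma Ehat_B_square: "0 \<le> h \<Longrightarrow> 0 \<le> c \<Longrightarrow> Ehat (\<lambda>\<omega>. c * (B h \<omega>)\<^sup>2) = \<sigma>_hi\<^sup>2 * (c * h)"
  using Ehat_B[of h "\<lambda>x. c * x\<^sup>2"] gn.N_variance[of "c * h"]
  by (simp add: PG_intros power_mult_distrib mult.assoc G_fun_def)

end

subsection \<open>Completion of a pseudometric space\<close>

lemma LIMSEQ_0_dominated: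
  assumes "g \<longlonglongrightarrow> 0" "\<And>n::nat. 0 \<le> f n" "\<And>n. f n \<le> K * g n"
  shows "f \<longlonglongrightarrow> (0::real)"
proof (rule tendsto_sandwich[OF _ _ tendsto_const])
  show "(\<lambda>n. K * g n) \<longlonglongrightarrow> 0" using tendsto_mult_left[OF assms(1), of K] by simp
qed (simp_all add: assms)

locale pseudometric =
  fixes S :: "'x set" and d :: "'x \<Rightarrow> 'x \<Rightarrow> real"
  assumes d_refl: "x \<in> S \<Longrightarrow> d x x = 0"
    and d_sym: "x \<in> S \<Longrightarrow> y \<in> S \<Longrightarrow> d x y = d y x"
    and d_tri: "x \<in> S \<Longrightarrow> y \<in> S \<Longrightarrow> z \<in> S \<Longrightarrow> d x z \<le> d x y + d y z"
begin

lemma d_nonneg: "x \<in> S \<Longrightarrow> y \<in> S \<Longrightarrow> 0 \<le> d x y"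
  using d_tri[of x y x] d_sym[of x y] d_refl[of x] by simp

abbreviation CS :: "(nat \<Rightarrow> 'x) set" where "CS \<equiv> cauchy_seqs S d"
abbreviation cls :: "(nat \<Rightarrow> 'x) \<Rightarrow> (nat \<Rightarrow> 'x) set" where "cls X \<equiv> cauchy_rel S d `` {X}"

lemma CS_mem: "X \<in> CS \<Longrightarrow> X n \<in> S"
  by (simp add: cauchy_seqs_def)

lemma CS_const: "x \<in> S \<Longrightarrow> (\<lambda>_. x) \<in> CS"
  by (simp add: cauchy_seqs_def d_refl)

lemma CS_I:
  assumes "\<And>n. X n \<in> S" "\<And>e. 0 < e \<Longrightarrow> \<exists>N. \<forall>m\<ge>N. \<forall>n\<ge>N. d (X m) (X n) < e"
  shows "X \<in> CS"
  using assms by (simp add: cauchy_seqs_def)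

lemma CS_D: "X \<in> CS \<Longrightarrow> 0 < e \<Longrightarrow> \<exists>N. \<forall>m\<ge>N. \<forall>n\<ge>N. d (X m) (X n) < e"
  by (simp add: cauchy_seqs_def)

lemma rel_iff: "(X, Y) \<in> cauchy_rel S d \<longleftrightarrow> X \<in> CS \<and> Y \<in> CS \<and> (\<lambda>n. d (X n) (Y n)) \<longlonglongrightarrow> 0"
  by (simp add: cauchy_rel_def)

lemma rel_trans:
  assumes "(X, Y) \<in> cauchy_rel S d" "(Y, Z) \<in> cauchy_rel S d"
  shows "(X, Z) \<in> cauchy_rel S d"
proof -
  have m: "X n \<in> S" "Y n \<in> S" "Z n \<in> S" for n using assms by (auto simp: rel_iff CS_mem)
  have "(\<lambda>n. d (X n) (Y n) + d (Y n) (Z n)) \<longlonglongrightarrow> 0"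
    using tendsto_add[of "\<lambda>n. d (X n) (Y n)" 0 sequentially "\<lambda>n. d (Y n) (Z n)" 0] assms
    by (simp add: rel_iff)
  from LIMSEQ_0_dominated[OF this, of "\<lambda>n. d (X n) (Z n)" 1] assms show ?thesis
    by (simp add: rel_iff m d_nonneg d_tri)
qed

lemma rel_sym: "(X, Y) \<in> cauchy_rel S d \<Longrightarrow> (Y, X) \<in> cauchy_rel S d"
proof -
  assume a: "(X, Y) \<in> cauchy_rel S d"
  then have "d (X n) (Y n) = d (Y n) (X n)" for n by (simp add: rel_iff CS_mem d_sym)
  with a show ?thesis by (simp add: rel_iff)
qed

lemma rel_refl: "X \<in> CS \<Longrightarrow> (X, X) \<in> cauchy_rel S d"
  by (simp add: rel_iff CS_mem d_refl)

lemma cls_eq_iff: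
  assumes "X \<in> CS" "Y \<in> CS"
  shows "cls X = cls Y \<longleftrightarrow> (\<lambda>n. d (X n) (Y n)) \<longlonglongrightarrow> 0"
proof -
  have "cls X = cls Y \<longleftrightarrow> (X, Y) \<in> cauchy_rel S d"
    using rel_trans rel_sym rel_refl[OF assms(2)] by blast
  then show ?thesis using assms by (simp add: rel_iff)
qed

lemma cls_eqI: "(X, Y) \<in> cauchy_rel S d \<Longrightarrow> cls X = cls Y"
  using rel_trans rel_sym by blast

lemma completion_iff: "a \<in> completion S d \<longleftrightarrow> (\<exists>X\<in>CS. a = cls X)"
  by (auto simp: completion_def quotient_def)

lemma CS_Cauchy_dist:
  assumes "X \<in> CS" "Y \<in> CS"
  shows "Cauchy (\<lambda>n. d (X n) (Y n))"
proof (rule metric_CauchyI)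
  fix e :: real assume e: "0 < e"
  obtain N1 N2 where N: "\<forall>m\<ge>N1. \<forall>n\<ge>N1. d (X m) (X n) < e / 2" "\<forall>m\<ge>N2. \<forall>n\<ge>N2. d (Y m) (Y n) < e / 2"
    using CS_D[OF assms(1), of "e / 2"] CS_D[OF assms(2), of "e / 2"] e by auto
  have "dist (d (X m) (Y m)) (d (X n) (Y n)) < e" if mn: "m \<ge> max N1 N2" "n \<ge> max N1 N2" for m n
  proof -
    note S = CS_mem[OF assms(1)] CS_mem[OF assms(2)]
    have "d (X i) (Y i) \<le> d (X i) (X j) + d (X j) (Y j) + d (Y i) (Y j)" for i j
      using d_tri[of "X i" "X j" "Y i"] d_tri[of "X j" "Y j" "Y i"] d_sym[of "Y j" "Y i"] S by force
    from this[of m n] this[of n m] have "\<bar>d (X m) (Y m) - d (X n) (Y n)\<bar>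
        \<le> d (X m) (X n) + d (Y m) (Y n)"
      using d_sym[of "X m" "X n"] d_sym[of "Y m" "Y n"] S by force
    moreover have "d (X m) (X n) < e / 2" "d (Y m) (Y n) < e / 2" using N mn by auto
    ultimately show ?thesis by (simp add: dist_real_def)
  qed
  then show "\<exists>M. \<forall>m\<ge>M. \<forall>n\<ge>M. dist (d (X m) (Y m)) (d (X n) (Y n)) < e" by blast
qed

text \<open>Distances along Cauchy sequences converge, and replacing representatives changes them by
  at most \<open>d (X n) (X' n) + d (Y n) (Y' n)\<close>; hence the definite description in
  \<open>completion_dist\<close> is proper.\<close>

lemma completion_dist_LIMSEQ:
  assumes X: "X \<in> CS" and Y: "Y \<in> CS"
  shows "(\<lambda>n. d (X n) (Y n)) \<longlonglongrightarrow> completion_dist d (cls X) (cls Y)"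
proof -
  obtain l where l: "(\<lambda>n. d (X n) (Y n)) \<longlonglongrightarrow> l"
    using CS_Cauchy_dist[OF X Y] Cauchy_convergent convergent_def by blast
  have all: "(\<lambda>n. d (X' n) (Y' n)) \<longlonglongrightarrow> l" if "X' \<in> cls X" "Y' \<in> cls Y" for X' Y'
  proof -
    have r: "(X, X') \<in> cauchy_rel S d" "(Y, Y') \<in> cauchy_rel S d" using that by auto
    have S: "X n \<in> S" "X' n \<in> S" "Y n \<in> S" "Y' n \<in> S" for n using r by (auto simp: rel_iff CS_mem)
    have b: "\<bar>d (X' n) (Y' n) - d (X n) (Y n)\<bar> \<le> 1 * (d (X n) (X' n) + d (Y n) (Y' n))" for n
      using d_tri[of "X' n" "X n" "Y' n"] d_tri[of "X n" "Y n" "Y' n"] d_sym[of "X n" "X' n"]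
        d_tri[of "X n" "X' n" "Y n"] d_tri[of "X' n" "Y' n" "Y n"] d_sym[of "Y n" "Y' n"] S by force
    have "(\<lambda>n. d (X n) (X' n) + d (Y n) (Y' n)) \<longlonglongrightarrow> 0"
      using tendsto_add[of "\<lambda>n. d (X n) (X' n)" 0 sequentially "\<lambda>n. d (Y n) (Y' n)" 0] r
      by (simp add: rel_iff)
    from LIMSEQ_0_dominated[OF this _ b] have "(\<lambda>n. d (X' n) (Y' n) - d (X n) (Y n)) \<longlonglongrightarrow> 0"
      by (simp add: tendsto_rabs_zero_iff)
    from tendsto_add[OF this l] show ?thesis by simp
  qed
  have "completion_dist d (cls X) (cls Y) = l"
    unfolding completion_dist_def
  proof (rule the_equality)
    show "\<forall>X'\<in>cls X. \<forall>Y'\<in>cls Y. (\<lambda>n. d (X' n) (Y' n)) \<longlonglongrightarrow> l" using all by blast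
    fix r assume "\<forall>X'\<in>cls X. \<forall>Y'\<in>cls Y. (\<lambda>n. d (X' n) (Y' n)) \<longlonglongrightarrow> r"
    then have "(\<lambda>n. d (X n) (Y n)) \<longlonglongrightarrow> r" using rel_refl[OF X] rel_refl[OF Y] by blast
    then show "r = l" using l by (rule LIMSEQ_unique)
  qed
  with l show ?thesis by simp
qed

end

lemma UN_const: "x \<in> A \<Longrightarrow> (\<And>y. y \<in> A \<Longrightarrow> f y = c) \<Longrightarrow> (\<Union>y\<in>A. f y) = c"
  by auto

subsection \<open>Minkowski's and Schwarz' inequalities\<close>

text \<open>Minkowski's inequality in a form suited to sublinear expectations: the hypothesis comes
  from a pointwise inequality with nonnegative coefficients, and the best \<open>r\<close> is
  \<open>sqrt b / sqrt a\<close>.\<close>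

lemma sqrt_triangle:
  fixes a b c :: real
  assumes ab: "0 \<le> a" "0 \<le> b" and le: "\<And>r. 0 < r \<Longrightarrow> c \<le> (1 + r) * a + (1 + 1 / r) * b"
  shows "sqrt c \<le> sqrt a + sqrt b"
proof (rule field_le_epsilon)
  fix e :: real assume e: "0 < e"
  \<comment> \<open>The shift by \<open>e / 2\<close> makes the ratio \<open>y / x\<close>
    meaningful and positive when \<open>a\<close> or \<open>b\<close> vanishes.\<close>
  define x where "x = sqrt a + e / 2"
  define y where "y = sqrt b + e / 2"
  have xy: "0 < x" "0 < y" using ab e by (auto simp: x_def y_def add_nonneg_pos)
  have "a = (sqrt a)\<^sup>2" "b = (sqrt b)\<^sup>2" using ab by auto
  moreover have "(sqrt a)\<^sup>2 \<le> x\<^sup>2" "(sqrt b)\<^sup>2 \<le> y\<^sup>2"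
    unfolding x_def y_def using ab e by (intro power_mono; simp)+
  ultimately have le': "a \<le> x\<^sup>2" "b \<le> y\<^sup>2" by auto
  have "c \<le> (1 + y / x) * a + (1 + 1 / (y / x)) * b" by (rule le) (use xy in simp)
  also have "\<dots> \<le> (1 + y / x) * x\<^sup>2 + (1 + 1 / (y / x)) * y\<^sup>2"
    using xy le' by (intro add_mono mult_left_mono) auto
  also have "\<dots> = (x + y)\<^sup>2" using xy by (simp add: field_simps power2_eq_square)
  finally have "sqrt c \<le> x + y" using xy by (simp add: real_le_lsqrt)
  then show "sqrt c \<le> sqrt a + sqrt b + e" by (simp add: x_def y_def)
qed

text \<open>Derived from Minkowski's inequality with \<open>a + b + 2 * c\<close> in the role of the
  squared norm of the sum.\<close>

lemma sqrt_schwarz: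
  fixes a b c :: real
  assumes ab: "0 \<le> a" "0 \<le> b" and le: "\<And>r. 0 < r \<Longrightarrow> 2 * c \<le> r * a + 1 / r * b"
  shows "c \<le> sqrt a * sqrt b"
proof -
  have "sqrt (a + b + 2 * c) \<le> sqrt a + sqrt b"
    by (rule sqrt_triangle[OF ab]) (use le in \<open>simp add: algebra_simps\<close>)
  then have "a + b + 2 * c \<le> (sqrt a + sqrt b)\<^sup>2"
    by (rule sqrt_le_D)
  then show ?thesis using ab by (simp add: power2_sum)
qed

lemma young_ineq: "0 < r \<Longrightarrow> 2 * (x * y) \<le> r * x\<^sup>2 + 1 / r * y\<^sup>2" for x y r :: real
proof -
  assume r: "0 < r"
  have "r * x\<^sup>2 + 1 / r * y\<^sup>2 - 2 * (x * y) = (r * x - y)\<^sup>2 / r"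
    using r by (simp add: field_simps power2_eq_square)
  moreover have "0 \<le> (r * x - y)\<^sup>2 / r" using r by simp
  ultimately show ?thesis by linarith
qed

lemma young_square: "0 < r \<Longrightarrow> (x + y)\<^sup>2 \<le> (1 + r) * x\<^sup>2 + (1 + 1 / r) * y\<^sup>2" for x y r :: real
  using young_ineq[of r x y] by (simp add: power2_sum algebra_simps)

subsection \<open>The spaces of integrable elements\<close>

context G_setting
begin

lemma Ehat_nonneg: "X \<in> Lip \<Longrightarrow> (\<And>\<omega>. 0 \<le> X \<omega>) \<Longrightarrow> 0 \<le> Ehat X"
  using Ehat_mono[of "\<lambda>_. 0" X] by (simp add: Ehat_const Lip_intros)

lemma Ehat_le_combination:
  assumes "A \<in> Lip" "B' \<in> Lip" "C \<in> Lip" "0 \<le> \<alpha>" "0 \<le> \<beta>" "\<And>\<omega>. C \<omega> \<le> \<alpha> * A \<omega> + \<beta> * B' \<omega>"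
  shows "Ehat C \<le> \<alpha> * Ehat A + \<beta> * Ehat B'"
proof -
  have "Ehat C \<le> Ehat (\<lambda>\<omega>. \<alpha> * A \<omega> + \<beta> * B' \<omega>)"
    by (intro Ehat_mono assms Lip_intros)
  also have "\<dots> \<le> Ehat (\<lambda>\<omega>. \<alpha> * A \<omega>) + Ehat (\<lambda>\<omega>. \<beta> * B' \<omega>)"
    by (intro Ehat_subadd assms Lip_intros)
  finally show ?thesis using assms by (simp add: Ehat_cmult)
qed

lemma Ehat_sqrt_triangle:
  assumes "A \<in> Lip" "B' \<in> Lip" "C \<in> Lip" "\<And>\<omega>. 0 \<le> A \<omega>" "\<And>\<omega>. 0 \<le> B' \<omega>"
    "\<And>r \<omega>. 0 < r \<Longrightarrow> C \<omega> \<le> (1 + r) * A \<omega> + (1 + 1 / r) * B' \<omega>"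
  shows "sqrt (Ehat C) \<le> sqrt (Ehat A) + sqrt (Ehat B')"
  by (rule sqrt_triangle) (auto intro!: Ehat_nonneg Ehat_le_combination assms)

text \<open>Only the exponents 1 and 2 occur, and any \<open>p\<close> other than 1 is read as 2.
  This avoids \<open>powr\<close>; \<open>Lp_dist_eq\<close> is the link to the distance of the
  completion.\<close>

definition nrm :: "real \<Rightarrow> (cpath \<Rightarrow> real) \<Rightarrow> real" where
  "nrm p X = (if p = 1 then Ehat (\<lambda>\<omega>. \<bar>X \<omega>\<bar>) else sqrt (Ehat (\<lambda>\<omega>. (X \<omega>)\<^sup>2)))"

lemma nrm_1: "nrm 1 X = Ehat (\<lambda>\<omega>. \<bar>X \<omega>\<bar>)" and nrm_2: "nrm 2 X = sqrt (Ehat (\<lambda>\<omega>. (X \<omega>)\<^sup>2))"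
  by (simp_all add: nrm_def)

lemma Lp_dist_eq:
  assumes p: "p = 1 \<or> p = 2" and XY: "X \<in> Lip" "Y \<in> Lip"
  shows "Lp_dist p X Y = nrm p (\<lambda>\<omega>. X \<omega> - Y \<omega>)"
proof (cases "p = 1")
  case True
  have "0 \<le> Ehat (\<lambda>\<omega>. \<bar>X \<omega> - Y \<omega>\<bar>)" by (intro Ehat_nonneg Lip_intros XY) simp
  then show ?thesis using True by (simp add: Lp_dist_def nrm_1)
next
  case False
  have "0 \<le> Ehat (\<lambda>\<omega>. (X \<omega> - Y \<omega>)\<^sup>2)" by (intro Ehat_nonneg Lip_intros XY) simp
  then show ?thesis using False p by (simp add: Lp_dist_def nrm_2 powr_half_sqrt)
qed

lemma nrm_nonneg: "X \<in> Lip \<Longrightarrow> 0 \<le> nrm p X"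
  unfolding nrm_def by (auto intro!: Ehat_nonneg Lip_intros)

lemma nrm_triangle:
  assumes "X \<in> Lip" "Y \<in> Lip"
  shows "nrm p (\<lambda>\<omega>. X \<omega> + Y \<omega>) \<le> nrm p X + nrm p Y"
proof (cases "p = 1")
  case True
  have "Ehat (\<lambda>\<omega>. \<bar>X \<omega> + Y \<omega>\<bar>) \<le> 1 * Ehat (\<lambda>\<omega>. \<bar>X \<omega>\<bar>) + 1 * Ehat (\<lambda>\<omega>. \<bar>Y \<omega>\<bar>)"
    by (intro Ehat_le_combination Lip_intros assms) auto
  then show ?thesis using True by (simp add: nrm_1)
next
  case False
  then show ?thesis
    by (simp add: nrm_def) (intro Ehat_sqrt_triangle Lip_intros assms young_square; simp)
qed

lemma nrm_cmult:
  assumes "X \<in> Lip"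
  shows "nrm p (\<lambda>\<omega>. c * X \<omega>) = \<bar>c\<bar> * nrm p X"
  using Ehat_cmult[of "\<lambda>\<omega>. \<bar>X \<omega>\<bar>" "\<bar>c\<bar>"] Ehat_cmult[of "\<lambda>\<omega>. (X \<omega>)\<^sup>2" "c\<^sup>2"] assms
  by (simp add: nrm_def Lip_intros abs_mult power_mult_distrib real_sqrt_mult)

lemma nrm_mono:
  assumes "X \<in> Lip" "Y \<in> Lip" "\<And>\<omega>. \<bar>X \<omega>\<bar> \<le> \<bar>Y \<omega>\<bar>"
  shows "nrm p X \<le> nrm p Y"
  using assms unfolding nrm_def by (auto intro!: Ehat_mono Lip_intros simp: abs_le_square_iff)

lemma nrm_minus_commute: "nrm p (\<lambda>\<omega>. X \<omega> - Y \<omega>) = nrm p (\<lambda>\<omega>. Y \<omega> - X \<omega>)"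
  by (simp add: nrm_def abs_minus_commute power2_commute)

lemma nrm_const: "nrm p (\<lambda>_. c) = \<bar>c\<bar>"
  by (simp add: nrm_def Ehat_const)

lemma nrm_schwarz:
  assumes "X \<in> Lip" "Y \<in> Lip"
  shows "nrm 1 (\<lambda>\<omega>. X \<omega> * Y \<omega>) \<le> nrm 2 X * nrm 2 Y"
  unfolding nrm_1 nrm_2
proof (rule sqrt_schwarz)
  fix r :: real assume r: "0 < r"
  have "Ehat (\<lambda>\<omega>. 2 * \<bar>X \<omega> * Y \<omega>\<bar>) \<le> r * Ehat (\<lambda>\<omega>. (X \<omega>)\<^sup>2) + 1 / r * Ehat (\<lambda>\<omega>. (Y \<omega>)\<^sup>2)"
  proof (intro Ehat_le_combination Lip_intros assms)
    fix \<omega>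
    show "2 * \<bar>X \<omega> * Y \<omega>\<bar> \<le> r * (X \<omega>)\<^sup>2 + 1 / r * (Y \<omega>)\<^sup>2"
      using young_ineq[OF r, of "\<bar>X \<omega>\<bar>" "\<bar>Y \<omega>\<bar>"] by (simp add: abs_mult)
  qed (use r in auto)
  then show "2 * Ehat (\<lambda>\<omega>. \<bar>X \<omega> * Y \<omega>\<bar>) \<le> r * Ehat (\<lambda>\<omega>. (X \<omega>)\<^sup>2) + 1 / r * Ehat (\<lambda>\<omega>. (Y \<omega>)\<^sup>2)"
    by (simp add: Ehat_cmult Lip_intros assms)
qed (intro Ehat_nonneg Lip_intros assms; simp)+

lemma nrm_1_le_2: "X \<in> Lip \<Longrightarrow> nrm 1 X \<le> nrm 2 X"
  using nrm_schwarz[of X "\<lambda>_. 1"] by (simp add: Lip_intros nrm_const)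

lemma Ehat_diff_le: "X \<in> Lip \<Longrightarrow> Y \<in> Lip \<Longrightarrow> \<bar>Ehat X - Ehat Y\<bar> \<le> nrm 1 (\<lambda>\<omega>. X \<omega> - Y \<omega>)"
proof -
  have le: "Ehat X - Ehat Y \<le> nrm 1 (\<lambda>\<omega>. X \<omega> - Y \<omega>)" if "X \<in> Lip" "Y \<in> Lip" for X Y
  proof -
    have "Ehat X \<le> 1 * Ehat Y + 1 * Ehat (\<lambda>\<omega>. \<bar>X \<omega> - Y \<omega>\<bar>)"
      by (intro Ehat_le_combination Lip_intros that) auto
    then show ?thesis by (simp add: nrm_1)
  qed
  assume "X \<in> Lip" "Y \<in> Lip"
  then show ?thesis using le[of X Y] le[of Y X] nrm_minus_commute[of 1 X Y]
      by (simp add: abs_le_iff)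
qed

lemma pseudometric_Lp: "p = 1 \<or> p = 2 \<Longrightarrow> pseudometric Lip (Lp_dist p)"
proof
  fix X Y Z assume p: "p = 1 \<or> p = 2" and S: "X \<in> Lip" "Y \<in> Lip" "Z \<in> Lip"
  show "Lp_dist p X X = 0" using p S(1) by (simp add: Lp_dist_eq nrm_const)
  show "Lp_dist p X Y = Lp_dist p Y X" using p S by (simp only: Lp_dist_eq) (rule nrm_minus_commute)
  show "Lp_dist p X Z \<le> Lp_dist p X Y + Lp_dist p Y Z"
    using nrm_triangle[of "\<lambda>\<omega>. X \<omega> - Y \<omega>" "\<lambda>\<omega>. Y \<omega> - Z \<omega>" p] p S
        by (simp add: Lp_dist_eq Lip_intros)
qed

definition CS :: "real \<Rightarrow> (nat \<Rightarrow> cpath \<Rightarrow> real) set" where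
  "CS p = cauchy_seqs Lip (Lp_dist p)"

lemma CS_mem: "X \<in> CS p \<Longrightarrow> X n \<in> Lip"
  by (simp add: CS_def cauchy_seqs_def)

lemma CS_iff:
  assumes "p = 1 \<or> p = 2"
  shows "X \<in> CS p \<longleftrightarrow> (\<forall>n. X n \<in> Lip) \<and>
    (\<forall>e>0. \<exists>N. \<forall>m\<ge>N. \<forall>n\<ge>N. nrm p (\<lambda>\<omega>. X m \<omega> - X n \<omega>) < e)"
  unfolding CS_def cauchy_seqs_def using assms by (auto simp: Lp_dist_eq)

lemma CS_const: "p = 1 \<or> p = 2 \<Longrightarrow> X \<in> Lip \<Longrightarrow> (\<lambda>_. X) \<in> CS p"
  by (simp add: CS_iff nrm_const)

lemma CS_dominated:
  assumes p: "p = 1 \<or> p = 2" and q: "q = 1 \<or> q = 2" and X: "X \<in> CS p" and Z: "\<And>n. Z n \<in> Lip"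
    and le: "\<And>m n. nrm q (\<lambda>\<omega>. Z m \<omega> - Z n \<omega>) \<le> K * nrm p (\<lambda>\<omega>. X m \<omega> - X n \<omega>)"
  shows "Z \<in> CS q"
  unfolding CS_iff[OF q]
proof (intro conjI allI impI Z)
  fix e :: real assume e: "0 < e"
  have "0 < e / (\<bar>K\<bar> + 1)" using e by (simp add: add_nonneg_pos)
  then obtain N where N: "\<forall>m\<ge>N. \<forall>n\<ge>N. nrm p (\<lambda>\<omega>. X m \<omega> - X n \<omega>) < e / (\<bar>K\<bar> + 1)"
    using X unfolding CS_iff[OF p] by blast
  have "nrm q (\<lambda>\<omega>. Z m \<omega> - Z n \<omega>) < e" if "m \<ge> N" "n \<ge> N" for m n
  proof -
    have nn: "0 \<le> nrm p (\<lambda>\<omega>. X m \<omega> - X n \<omega>)" by (intro nrm_nonneg Lip_intros CS_mem[OF X])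
    have "K * nrm p (\<lambda>\<omega>. X m \<omega> - X n \<omega>) \<le> (\<bar>K\<bar> + 1) * nrm p (\<lambda>\<omega>. X m \<omega> - X n \<omega>)"
      using nn by (intro mult_right_mono) auto
    also have "\<dots> < (\<bar>K\<bar> + 1) * (e / (\<bar>K\<bar> + 1))"
      using N that by (intro mult_strict_left_mono) (auto simp: add_nonneg_pos)
    also have "\<dots> = e" by (simp add: add_nonneg_pos less_imp_neq[symmetric] field_simps)
    finally show ?thesis using le[of m n] by linarith
  qed
  then show "\<exists>N. \<forall>m\<ge>N. \<forall>n\<ge>N. nrm q (\<lambda>\<omega>. Z m \<omega> - Z n \<omega>) < e" by blast
qed

lemma CS_add:
  assumes p: "p = 1 \<or> p = 2" and X: "X \<in> CS p" and Y: "Y \<in> CS p"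
  shows "(\<lambda>n \<omega>. X n \<omega> + Y n \<omega>) \<in> CS p"
  unfolding CS_iff[OF p]
proof (intro conjI allI impI Lip_intros CS_mem[OF X] CS_mem[OF Y])
  fix e :: real assume e: "0 < e"
  obtain N1 N2 where N: "\<forall>m\<ge>N1. \<forall>n\<ge>N1. nrm p (\<lambda>\<omega>. X m \<omega> - X n \<omega>) < e / 2"
    "\<forall>m\<ge>N2. \<forall>n\<ge>N2. nrm p (\<lambda>\<omega>. Y m \<omega> - Y n \<omega>) < e / 2"
    using X Y e unfolding CS_iff[OF p] by (meson half_gt_zero)
  have "nrm p (\<lambda>\<omega>. X m \<omega> + Y m \<omega> - (X n \<omega> + Y n \<omega>)) < e" if "m \<ge> max N1 N2" "n \<ge> max N1 N2" for m n
  proof -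
    have "nrm p (\<lambda>\<omega>. (X m \<omega> - X n \<omega>) + (Y m \<omega> - Y n \<omega>))
        \<le> nrm p (\<lambda>\<omega>. X m \<omega> - X n \<omega>) + nrm p (\<lambda>\<omega>. Y m \<omega> - Y n \<omega>)"
      by (intro nrm_triangle Lip_intros CS_mem[OF X] CS_mem[OF Y])
    moreover have "nrm p (\<lambda>\<omega>. X m \<omega> - X n \<omega>) < e / 2" "nrm p (\<lambda>\<omega>. Y m \<omega> - Y n \<omega>) < e / 2"
        using N that by auto
    ultimately show ?thesis by (simp add: algebra_simps)
  qed
  then show "\<exists>N. \<forall>m\<ge>N. \<forall>n\<ge>N. nrm p (\<lambda>\<omega>. X m \<omega> + Y m \<omega> - (X n \<omega> + Y n \<omega>)) < e" by blast
qed

lemma CS_cmult: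
  assumes p: "p = 1 \<or> p = 2" and X: "X \<in> CS p"
  shows "(\<lambda>n \<omega>. c * X n \<omega>) \<in> CS p"
proof (rule CS_dominated[OF p p X, of _ "\<bar>c\<bar>"])
  show "(\<lambda>\<omega>. c * X n \<omega>) \<in> Lip" for n by (intro Lip_intros CS_mem[OF X])
  show "nrm p (\<lambda>\<omega>. c * X m \<omega> - c * X n \<omega>) \<le> \<bar>c\<bar> * nrm p (\<lambda>\<omega>. X m \<omega> - X n \<omega>)" for m n
    using nrm_cmult[of "\<lambda>\<omega>. X m \<omega> - X n \<omega>" p c] CS_mem[OF X]
        by (simp add: Lip_intros right_diff_distrib)
qed

lemma CS_diff:
  assumes p: "p = 1 \<or> p = 2" and X: "X \<in> CS p" and Y: "Y \<in> CS p"
  shows "(\<lambda>n \<omega>. X n \<omega> - Y n \<omega>) \<in> CS p"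
  using CS_add[OF p X CS_cmult[OF p Y, of "-1"]] by simp

lemma CS_bounded:
  assumes p: "p = 1 \<or> p = 2" and X: "X \<in> CS p"
  obtains M where "\<And>n. nrm p (X n) \<le> M"
proof -
  interpret Lp: pseudometric Lip "Lp_dist p" by (rule pseudometric_Lp[OF p])
  have "(\<lambda>_ _. 0) \<in> CS p" using p by (intro CS_const) (auto intro: Lip_intros)
  from Lp.CS_Cauchy_dist[OF X[unfolded CS_def] this[unfolded CS_def]]
  have "Bseq (\<lambda>n. Lp_dist p (X n) (\<lambda>_. 0))" by (rule Cauchy_Bseq)
  then obtain K where "\<And>n. norm (Lp_dist p (X n) (\<lambda>_. 0)) \<le> K" unfolding Bseq_def by blast
  then have "nrm p (X n) \<le> K" for n
    using Lp_dist_eq[OF p CS_mem[OF X, of n], of "\<lambda>_. 0"]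
        by (simp add: Lip_intros) (metis abs_le_D1)
  then show thesis by (rule that)
qed

lemma lg_class_eq_iff:
  assumes p: "p = 1 \<or> p = 2" and "X \<in> CS p" "Y \<in> CS p"
  shows "lg_class p X = lg_class p Y \<longleftrightarrow> (\<lambda>n. nrm p (\<lambda>\<omega>. X n \<omega> - Y n \<omega>)) \<longlonglongrightarrow> 0"
  using pseudometric.cls_eq_iff[OF pseudometric_Lp[OF p], of X Y] assms CS_mem[OF assms(2)]
      CS_mem[OF assms(3)]
  unfolding lg_class_def CS_def by (simp add: Lp_dist_eq)

lemma mem_lg_class:
  assumes p: "p = 1 \<or> p = 2" and "X \<in> CS p"
  shows "Y \<in> lg_class p X \<longleftrightarrow> Y \<in> CS p \<and> (\<lambda>n. nrm p (\<lambda>\<omega>. X n \<omega> - Y n \<omega>)) \<longlonglongrightarrow> 0"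
proof -
  have "Y \<in> lg_class p X \<longleftrightarrow> Y \<in> CS p \<and> (\<lambda>n. Lp_dist p (X n) (Y n)) \<longlonglongrightarrow> 0"
    using assms(2) by (simp add: lg_class_def cauchy_rel_def CS_def)
  then show ?thesis using Lp_dist_eq[OF p CS_mem[OF assms(2)] CS_mem[of Y]] by auto
qed

lemma self_in_lg_class: "p = 1 \<or> p = 2 \<Longrightarrow> X \<in> CS p \<Longrightarrow> X \<in> lg_class p X"
  by (simp add: mem_lg_class nrm_const)

lemma LG_iff: "p = 1 \<or> p = 2 \<Longrightarrow> a \<in> LG p \<longleftrightarrow> (\<exists>X\<in>CS p. a = lg_class p X)"
  unfolding LG_def CS_def lg_class_def
  using pseudometric.completion_iff[OF pseudometric_Lp] by blast

lemma lg_class_LG: "p = 1 \<or> p = 2 \<Longrightarrow> X \<in> CS p \<Longrightarrow> lg_class p X \<in> LG p"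
  by (auto simp: LG_iff)

text \<open>The general well-definedness argument behind the lifted operations: the union over all
  representatives collapses to one class. The constant \<open>K\<close> may depend on
  \<open>Y\<close>, as it does for the square, where it involves the norms of both
  sequences.\<close>

lemma lg_lift:
  assumes p: "p = 1 \<or> p = 2" and q: "q = 1 \<or> q = 2" and X: "X \<in> CS p"
    and F: "\<And>Y. Y \<in> CS p \<Longrightarrow> F Y \<in> CS q"
    and le: "\<And>Y. Y \<in> CS p \<Longrightarrow> \<exists>K. \<forall>n. nrm q (\<lambda>\<omega>. F X n \<omega> - F Y n \<omega>) \<le> K * nrm p (\<lambda>\<omega>. X n \<omega> - Y n \<omega>)"
  shows "(\<Union>Y\<in>lg_class p X. lg_class q (F Y)) = lg_class q (F X)"
proof (rule UN_const[OF self_in_lg_class[OF p X]])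
  fix Y assume "Y \<in> lg_class p X"
  then have Y: "Y \<in> CS p" and lim: "(\<lambda>n. nrm p (\<lambda>\<omega>. X n \<omega> - Y n \<omega>)) \<longlonglongrightarrow> 0"
    by (simp_all add: mem_lg_class[OF p X])
  obtain K where K: "\<And>n. nrm q (\<lambda>\<omega>. F X n \<omega> - F Y n \<omega>) \<le> K * nrm p (\<lambda>\<omega>. X n \<omega> - Y n \<omega>)"
    using le[OF Y] by blast
  have "(\<lambda>n. nrm q (\<lambda>\<omega>. F X n \<omega> - F Y n \<omega>)) \<longlonglongrightarrow> 0"
    by (rule LIMSEQ_0_dominated[OF lim _ K])
       (intro nrm_nonneg Lip_intros CS_mem[OF F[OF X]] CS_mem[OF F[OF Y]])
  then show "lg_class q (F Y) = lg_class q (F X)"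
    using lg_class_eq_iff[OF q F[OF X] F[OF Y]] by simp
qed

lemma lg_add_class:
  assumes p: "p = 1 \<or> p = 2" and X: "X \<in> CS p" and Y: "Y \<in> CS p"
  shows "lg_add p (lg_class p X) (lg_class p Y) = lg_class p (\<lambda>n \<omega>. X n \<omega> + Y n \<omega>)"
proof -
  have 1: "(\<Union>Y'\<in>lg_class p Y. lg_class p (\<lambda>n \<omega>. X' n \<omega> + Y' n \<omega>))
      = lg_class p (\<lambda>n \<omega>. X' n \<omega> + Y n \<omega>)" if "X' \<in> CS p" for X'
    by (rule lg_lift[OF p p Y]) (auto intro: CS_add[OF p that] exI[of _ 1])
  have "(\<Union>X'\<in>lg_class p X. lg_class p (\<lambda>n \<omega>. X' n \<omega> + Y n \<omega>)) = lg_class p (\<lambda>n \<omega>. X n \<omega> + Y n \<omega>)"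
    by (rule lg_lift[OF p p X]) (auto intro: CS_add[OF p _ Y] exI[of _ 1])
  then show ?thesis
    unfolding lg_add_def using 1 mem_lg_class[OF p X] by simp
qed

lemma lg_diff_class:
  assumes p: "p = 1 \<or> p = 2" and X: "X \<in> CS p" and Y: "Y \<in> CS p"
  shows "lg_diff p (lg_class p X) (lg_class p Y) = lg_class p (\<lambda>n \<omega>. X n \<omega> - Y n \<omega>)"
proof -
  have 1: "(\<Union>Y'\<in>lg_class p Y. lg_class p (\<lambda>n \<omega>. X' n \<omega> - Y' n \<omega>))
      = lg_class p (\<lambda>n \<omega>. X' n \<omega> - Y n \<omega>)" if "X' \<in> CS p" for X'
  proof (rule lg_lift[OF p p Y])
    show "\<exists>K. \<forall>n. nrm p (\<lambda>\<omega>. X' n \<omega> - Y n \<omega> - (X' n \<omega> - Y' n \<omega>))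
        \<le> K * nrm p (\<lambda>\<omega>. Y n \<omega> - Y' n \<omega>)" for Y'
      by (intro exI[of _ 1]) (simp add: nrm_minus_commute[of p "Y' _" "Y _"])
  qed (rule CS_diff[OF p that])
  have "(\<Union>X'\<in>lg_class p X. lg_class p (\<lambda>n \<omega>. X' n \<omega> - Y n \<omega>)) = lg_class p (\<lambda>n \<omega>. X n \<omega> - Y n \<omega>)"
    by (rule lg_lift[OF p p X]) (auto intro: CS_diff[OF p _ Y] exI[of _ 1])
  then show ?thesis
    unfolding lg_diff_def using 1 mem_lg_class[OF p X] by simp
qed

lemma lg_scale_class:
  assumes p: "p = 1 \<or> p = 2" and X: "X \<in> CS p"
  shows "lg_scale p c (lg_class p X) = lg_class p (\<lambda>n \<omega>. c * X n \<omega>)"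
  unfolding lg_scale_def
proof (rule lg_lift[OF p p X])
  fix Y assume Y: "Y \<in> CS p"
  show "(\<lambda>n \<omega>. c * Y n \<omega>) \<in> CS p" by (rule CS_cmult[OF p Y])
  have "nrm p (\<lambda>\<omega>. c * X n \<omega> - c * Y n \<omega>) = \<bar>c\<bar> * nrm p (\<lambda>\<omega>. X n \<omega> - Y n \<omega>)" for n
    using nrm_cmult[of "\<lambda>\<omega>. X n \<omega> - Y n \<omega>" p c] CS_mem[OF X] CS_mem[OF Y]
        by (simp add: Lip_intros right_diff_distrib)
  then show "\<exists>K. \<forall>n. nrm p (\<lambda>\<omega>. c * X n \<omega> - c * Y n \<omega>) \<le> K * nrm p (\<lambda>\<omega>. X n \<omega> - Y n \<omega>)"
    by (intro exI[of _ "\<bar>c\<bar>"]) simp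
qed

lemma CS_2_1: "X \<in> CS 2 \<Longrightarrow> X \<in> CS 1"
  by (rule CS_dominated[of 2 1 X X 1]) (auto intro: CS_mem nrm_1_le_2 Lip_intros)

lemma lg_incl_class:
  assumes X: "X \<in> CS 2"
  shows "lg_incl (lg_class 2 X) = lg_class 1 X"
  unfolding lg_incl_def
proof (rule lg_lift[OF _ _ X])
  show "\<exists>K. \<forall>n. nrm 1 (\<lambda>\<omega>. X n \<omega> - Y n \<omega>) \<le> K * nrm 2 (\<lambda>\<omega>. X n \<omega> - Y n \<omega>)" if "Y \<in> CS 2" for Y
    using CS_mem[OF X] CS_mem[OF that] by (intro exI[of _ 1]) (auto intro: nrm_1_le_2 Lip_intros)
qed (auto intro: CS_2_1)

lemma nrm_square_diff:
  assumes XY: "X \<in> Lip" "Y \<in> Lip" and M: "nrm 2 X \<le> M" "nrm 2 Y \<le> M'"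
  shows "nrm 1 (\<lambda>\<omega>. (X \<omega>)\<^sup>2 - (Y \<omega>)\<^sup>2) \<le> (M + M') * nrm 2 (\<lambda>\<omega>. X \<omega> - Y \<omega>)"
proof -
  have "(X \<omega>)\<^sup>2 - (Y \<omega>)\<^sup>2 = (X \<omega> + Y \<omega>) * (X \<omega> - Y \<omega>)" for \<omega>
      by (simp add: power2_eq_square algebra_simps)
  then have "nrm 1 (\<lambda>\<omega>. (X \<omega>)\<^sup>2 - (Y \<omega>)\<^sup>2) \<le> nrm 2 (\<lambda>\<omega>. X \<omega> + Y \<omega>) * nrm 2 (\<lambda>\<omega>. X \<omega> - Y \<omega>)"
    using nrm_schwarz[of "\<lambda>\<omega>. X \<omega> + Y \<omega>" "\<lambda>\<omega>. X \<omega> - Y \<omega>"] XY by (simp add: Lip_intros)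
  also have "\<dots> \<le> (M + M') * nrm 2 (\<lambda>\<omega>. X \<omega> - Y \<omega>)"
    using nrm_triangle[OF XY, of 2] M by (intro mult_right_mono nrm_nonneg Lip_intros XY) linarith
  finally show ?thesis .
qed

lemma CS_square:
  assumes X: "X \<in> CS 2"
  shows "(\<lambda>n \<omega>. (X n \<omega>)\<^sup>2) \<in> CS 1"
proof -
  obtain M where M: "\<And>n. nrm 2 (X n) \<le> M" using CS_bounded[OF _ X] by auto
  show ?thesis
  proof (rule CS_dominated[OF _ _ X, of _ _ "M + M"])
    show "nrm 1 (\<lambda>\<omega>. (X m \<omega>)\<^sup>2 - (X n \<omega>)\<^sup>2) \<le> (M + M) * nrm 2 (\<lambda>\<omega>. X m \<omega> - X n \<omega>)" for m n
      by (intro nrm_square_diff CS_mem[OF X] M)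
  qed (auto intro: Lip_intros CS_mem[OF X])
qed

lemma lg_square_class:
  assumes X: "X \<in> CS 2"
  shows "lg_square (lg_class 2 X) = lg_class 1 (\<lambda>n \<omega>. (X n \<omega>)\<^sup>2)"
  unfolding lg_square_def
proof (rule lg_lift[OF _ _ X])
  fix Y assume Y: "Y \<in> CS 2"
  obtain M where M: "\<And>n. nrm 2 (X n) \<le> M" using CS_bounded[OF _ X] by auto
  obtain M' where M': "\<And>n. nrm 2 (Y n) \<le> M'" using CS_bounded[OF _ Y] by auto
  show "\<exists>K. \<forall>n. nrm 1 (\<lambda>\<omega>. (X n \<omega>)\<^sup>2 - (Y n \<omega>)\<^sup>2) \<le> K * nrm 2 (\<lambda>\<omega>. X n \<omega> - Y n \<omega>)"
    by (intro exI[of _ "M + M'"] allI nrm_square_diff CS_mem[OF X] CS_mem[OF Y] M M')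
qed (auto intro: CS_square)

lemma nrm_lipschitz:
  assumes L: "L-lipschitz_on UNIV \<phi>" and XY: "X \<in> Lip" "Y \<in> Lip"
  shows "nrm 1 (\<lambda>\<omega>. \<phi> (X \<omega>) - \<phi> (Y \<omega>)) \<le> L * nrm 1 (\<lambda>\<omega>. X \<omega> - Y \<omega>)"
proof -
  have L0: "0 \<le> L" using L by (rule lipschitz_on_nonneg)
  have le: "\<bar>\<phi> (X \<omega>) - \<phi> (Y \<omega>)\<bar> \<le> \<bar>L * (X \<omega> - Y \<omega>)\<bar>" for \<omega>
    using L L0 unfolding lipschitz_real_iff by (simp add: abs_mult)
  have "nrm 1 (\<lambda>\<omega>. \<phi> (X \<omega>) - \<phi> (Y \<omega>)) \<le> nrm 1 (\<lambda>\<omega>. L * (X \<omega> - Y \<omega>))"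
    using XY by (intro nrm_mono le Lip_intros) (auto simp: Lip_eq intro: Lip_on_lipschitz[OF L])
  also have "\<dots> = L * nrm 1 (\<lambda>\<omega>. X \<omega> - Y \<omega>)"
    using nrm_cmult[of "\<lambda>\<omega>. X \<omega> - Y \<omega>" 1 L] L0 XY by (simp add: Lip_intros)
  finally show ?thesis .
qed

lemma CS_lipschitz:
  assumes L: "L-lipschitz_on UNIV \<phi>" and X: "X \<in> CS 1"
  shows "(\<lambda>n \<omega>. \<phi> (X n \<omega>)) \<in> CS 1"
proof (rule CS_dominated[OF _ _ X])
  show "(\<lambda>\<omega>. \<phi> (X n \<omega>)) \<in> Lip" for n
    using CS_mem[OF X, of n] by (auto simp: Lip_eq intro: Lip_on_lipschitz[OF L])
qed (auto intro: nrm_lipschitz[OF L] CS_mem[OF X])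

lemma lg_comp_class:
  assumes L: "L-lipschitz_on UNIV \<phi>" and X: "X \<in> CS 1"
  shows "lg_comp \<phi> (lg_class 1 X) = lg_class 1 (\<lambda>n \<omega>. \<phi> (X n \<omega>))"
  unfolding lg_comp_def
  by (rule lg_lift[OF _ _ X])
     (auto intro: CS_lipschitz[OF L] exI[of _ L] nrm_lipschitz[OF L] CS_mem[OF X] CS_mem)

lemma lg_E_class:
  assumes X: "X \<in> CS 1"
  shows "(\<lambda>n. Ehat (X n)) \<longlonglongrightarrow> lg_E (lg_class 1 X)"
proof -
  have "Cauchy (\<lambda>n. Ehat (X n))"
  proof (rule metric_CauchyI)
    fix e :: real assume "0 < e"
    then obtain N where N: "\<forall>m\<ge>N. \<forall>n\<ge>N. nrm 1 (\<lambda>\<omega>. X m \<omega> - X n \<omega>) < e"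
      using X CS_iff[of 1 X] by auto
    then show "\<exists>M. \<forall>m\<ge>M. \<forall>n\<ge>M. dist (Ehat (X m)) (Ehat (X n)) < e"
      using Ehat_diff_le[OF CS_mem[OF X] CS_mem[OF X]] unfolding dist_real_def
          by (meson le_less_trans)
  qed
  then obtain l where l: "(\<lambda>n. Ehat (X n)) \<longlonglongrightarrow> l" using Cauchy_convergent convergent_def by blast
  have "lg_E (lg_class 1 X) = l"
    unfolding lg_E_def
  proof (rule the_equality)
    show "\<forall>Y\<in>lg_class 1 X. (\<lambda>n. Ehat (Y n)) \<longlonglongrightarrow> l"
    proof
      fix Y assume "Y \<in> lg_class 1 X"
      then have Y: "Y \<in> CS 1" and lim: "(\<lambda>n. nrm 1 (\<lambda>\<omega>. X n \<omega> - Y n \<omega>)) \<longlonglongrightarrow> 0"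
        using mem_lg_class[OF _ X] by auto
      have "\<bar>Ehat (X n) - Ehat (Y n)\<bar> \<le> 1 * nrm 1 (\<lambda>\<omega>. X n \<omega> - Y n \<omega>)" for n
        using Ehat_diff_le[OF CS_mem[OF X] CS_mem[OF Y]] by simp
      from LIMSEQ_0_dominated[OF lim _ this] have "(\<lambda>n. Ehat (X n) - Ehat (Y n)) \<longlonglongrightarrow> 0"
        by (simp add: tendsto_rabs_zero_iff)
      from tendsto_diff[OF l this] show "(\<lambda>n. Ehat (Y n)) \<longlonglongrightarrow> l" by simp
    qed
    fix r assume "\<forall>Y\<in>lg_class 1 X. (\<lambda>n. Ehat (Y n)) \<longlonglongrightarrow> r"
    then have "(\<lambda>n. Ehat (X n)) \<longlonglongrightarrow> r" using self_in_lg_class[OF _ X] by blast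
    then show "r = l" using l by (rule LIMSEQ_unique)
  qed
  with l show ?thesis by simp
qed

text \<open>Conditioning is a contraction: pointwise, the difference of the conditional expectations
  is at most the conditional expectation of \<open>\<bar>X \<omega> - Y \<omega>\<bar>\<close>,
  whose expectation is given by the tower property.\<close>

lemma nrm_Ehat_cond:
  assumes s: "0 \<le> s" and XY: "X \<in> Lip" "Y \<in> Lip"
  shows "nrm 1 (\<lambda>\<omega>. Ehat_cond s X \<omega> - Ehat_cond s Y \<omega>) \<le> nrm 1 (\<lambda>\<omega>. X \<omega> - Y \<omega>)"
proof -
  have Lip: "Ehat_cond s X \<in> Lip" if "X \<in> Lip" for X
    using Ehat_conc_Lip_upto[OF that s] by (simp add: Ehat_cond_eq[OF that s] Lip_upto_Lip)
  have D: "(\<lambda>\<omega>. \<bar>X \<omega> - Y \<omega>\<bar>) \<in> Lip" by (intro Lip_intros XY)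
  have "nrm 1 (\<lambda>\<omega>. Ehat_cond s X \<omega> - Ehat_cond s Y \<omega>) \<le> nrm 1 (\<lambda>\<omega>. Ehat_cond s (\<lambda>\<omega>. \<bar>X \<omega> - Y \<omega>\<bar>) \<omega>)"
  proof (rule nrm_mono)
    fix \<omega>
    have "\<bar>Ehat_cond s X \<omega> - Ehat_cond s Y \<omega>\<bar> \<le> Ehat_cond s (\<lambda>\<omega>. \<bar>X \<omega> - Y \<omega>\<bar>) \<omega>"
      using Ehat_diff_le[OF conc_Lip[OF XY(1) s] conc_Lip[OF XY(2) s]]
      by (simp add: Ehat_cond_eq[OF _ s] XY D nrm_1)
    then show "\<bar>Ehat_cond s X \<omega> - Ehat_cond s Y \<omega>\<bar> \<le> \<bar>Ehat_cond s (\<lambda>\<omega>. \<bar>X \<omega> - Y \<omega>\<bar>) \<omega>\<bar>" by linarith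
  qed (intro Lip_intros Lip XY)+
  also have "\<dots> = Ehat (Ehat_cond s (\<lambda>\<omega>. \<bar>X \<omega> - Y \<omega>\<bar>))"
  proof -
    have "0 \<le> Ehat_cond s (\<lambda>\<omega>. \<bar>X \<omega> - Y \<omega>\<bar>) \<omega>" for \<omega>
      unfolding Ehat_cond_eq[OF D s] by (intro Ehat_nonneg conc_Lip[OF D s]) simp
    then show ?thesis by (simp add: nrm_1)
  qed
  also have "\<dots> = nrm 1 (\<lambda>\<omega>. X \<omega> - Y \<omega>)"
    unfolding Ehat_cond_eq[OF D s] nrm_1 by (rule Ehat_tower[OF D s])
  finally show ?thesis .
qed

lemma lg_cond_class:
  assumes s: "0 \<le> s" and X: "X \<in> CS 1"
  shows "lg_cond s (lg_class 1 X) = lg_class 1 (\<lambda>n. Ehat_cond s (X n))"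
  unfolding lg_cond_def
proof (rule lg_lift[OF _ _ X])
  fix Y assume Y: "Y \<in> CS 1"
  show "\<exists>K. \<forall>n. nrm 1 (\<lambda>\<omega>. Ehat_cond s (X n) \<omega> - Ehat_cond s (Y n) \<omega>)
      \<le> K * nrm 1 (\<lambda>\<omega>. X n \<omega> - Y n \<omega>)"
    using nrm_Ehat_cond[OF s CS_mem[OF X] CS_mem[OF Y]] by (intro exI[of _ 1]) simp
  show "(\<lambda>n. Ehat_cond s (Y n)) \<in> CS 1"
  proof (rule CS_dominated[OF _ _ Y, of _ _ 1])
    show "Ehat_cond s (Y n) \<in> Lip" for n
      using Ehat_conc_Lip_upto[OF CS_mem[OF Y] s, THEN Lip_upto_Lip]
          by (simp add: Ehat_cond_eq[OF CS_mem[OF Y] s])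
    show "nrm 1 (\<lambda>\<omega>. Ehat_cond s (Y m) \<omega> - Ehat_cond s (Y n) \<omega>)
        \<le> 1 * nrm 1 (\<lambda>\<omega>. Y m \<omega> - Y n \<omega>)" for m n
      using nrm_Ehat_cond[OF s CS_mem[OF Y] CS_mem[OF Y]] by simp
  qed auto
qed auto

end

subsection \<open>Sums over the intervals of a grid\<close>

definition gsum :: "('b \<Rightarrow> 'b \<Rightarrow> real) \<Rightarrow> 'b list \<Rightarrow> real" where
  "gsum f ts = (\<Sum>(a, b)\<leftarrow>cpairs ts. f a b)"

lemma gsum_simps [simp]: "gsum f [] = 0" "gsum f [a] = 0"
    "gsum f (a # b # ts) = f a b + gsum f (b # ts)"
  by (simp_all add: gsum_def)

lemma gsum_append: "gsum f (as @ a # bs) = gsum f (as @ [a]) + gsum f (a # bs)"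
  unfolding gsum_def by (subst cpairs_append) simp

lemma gsum_cong: "(\<And>a b. (a, b) \<in> set (cpairs ts) \<Longrightarrow> f a b = g a b) \<Longrightarrow> gsum f ts = gsum g ts"
  unfolding gsum_def by (rule arg_cong[where f = sum_list], rule map_cong[OF refl]) auto

lemma gsum_mono: "(\<And>a b. (a, b) \<in> set (cpairs ts) \<Longrightarrow> f a b \<le> g a b) \<Longrightarrow> gsum f ts \<le> gsum g ts"
  unfolding gsum_def by (rule sum_list_mono) auto

lemma gsum_nonneg: "(\<And>a b. (a, b) \<in> set (cpairs ts) \<Longrightarrow> 0 \<le> f a b) \<Longrightarrow> 0 \<le> gsum f ts"
  unfolding gsum_def by (rule sum_list_nonneg) auto

lemma gsum_add: "gsum (\<lambda>a b. f a b + g a b) ts = gsum f ts + gsum g ts"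
  by (induction ts rule: induct_list012) (auto simp: algebra_simps)

lemma gsum_cmult: "gsum (\<lambda>a b. c * f a b) ts = c * gsum f ts"
  by (induction ts rule: induct_list012) (auto simp: algebra_simps)

lemma gsum_diff: "gsum (\<lambda>a b. f a b - g a b) ts = gsum f ts - gsum g ts"
  by (induction ts rule: induct_list012) (auto simp: algebra_simps)

lemma gsum_Lip_on:
  "(\<And>a b. (a, b) \<in> set (cpairs ts) \<Longrightarrow> f a b \<in> Lip_on I) \<Longrightarrow> (\<lambda>\<omega>. gsum (\<lambda>a b. f a b \<omega>) ts) \<in> Lip_on I"
  by (induction ts rule: induct_list012) (auto intro: Lip_on_const Lip_on_add)

lemmas gsum_Lip = gsum_Lip_on[where I = "{0..}", folded Lip_eq]

context G_setting
begin

lemma gsum_CS: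
  assumes p: "p = 1 \<or> p = 2"
  shows "(\<And>a b. (a, b) \<in> set (cpairs ts) \<Longrightarrow> Y a b \<in> CS p) \<Longrightarrow> (\<lambda>n \<omega>. gsum (\<lambda>a b. Y a b n \<omega>) ts) \<in> CS p"
  by (induction ts rule: induct_list012) (auto intro!: CS_const[OF p] Lip_intros CS_add[OF p])

text \<open>The summands are indexed by the ends of a cell instead of its number, so that sums in
  the quotient become \<open>gsum\<close> of representatives.\<close>

lemma lg_sum_gsum:
  assumes p: "p = 1 \<or> p = 2" and Y: "\<And>a b. (a, b) \<in> set (cpairs ts) \<Longrightarrow> Y a b \<in> CS p"
  shows "lg_sum p (length ts - 1) (\<lambda>k. lg_class p (Y (ts ! k) (ts ! Suc k))) =
    lg_class p (\<lambda>n \<omega>. gsum (\<lambda>a b. Y a b n \<omega>) ts)"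
proof -
  have "lg_sum p (length ts - 1) (\<lambda>k. lg_class p (Y (ts ! k) (ts ! Suc k))) =
    foldr (lg_add p) (map (\<lambda>(a, b). lg_class p (Y a b)) (cpairs ts)) (lg_embed p (\<lambda>_. 0))"
    unfolding lg_sum_def map_cpairs[of "\<lambda>a b. lg_class p (Y a b)"] ..
  also have "\<dots> = lg_class p (\<lambda>n \<omega>. gsum (\<lambda>a b. Y a b n \<omega>) ts)"
    using Y
  proof (induction ts rule: induct_list012)
    case (3 a b ts)
    have "lg_add p (lg_class p (Y a b)) (lg_class p (\<lambda>n \<omega>. gsum (\<lambda>a b. Y a b n \<omega>) (b # ts))) =
      lg_class p (\<lambda>n \<omega>. Y a b n \<omega> + gsum (\<lambda>a b. Y a b n \<omega>) (b # ts))"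
      by (rule lg_add_class[OF p]) (auto intro!: gsum_CS[OF p] "3.prems")
    then show ?case using "3.IH"(2) "3.prems" by simp
  qed (simp_all add: lg_embed_def)
  finally show ?thesis .
qed

lemma lg_sum_cong: "(\<And>k. k < N \<Longrightarrow> a k = b k) \<Longrightarrow> lg_sum p N a = lg_sum p N b"
  unfolding lg_sum_def by (rule arg_cong[where f = "\<lambda>xs. foldr _ xs _"]) simp

end

subsection \<open>More on grids\<close>

lemma cpairs_alt: "cpairs ts = map (\<lambda>k. (ts ! k, ts ! Suc k)) [0..<length ts - 1]"
  using map_cpairs[of Pair ts] by simp

lemma cpairs_iff: "(a, b) \<in> set (cpairs ts) \<longleftrightarrow> (\<exists>k<length ts - 1. a = ts ! k \<and> b = ts ! Suc k)"
  by (auto simp: cpairs_alt)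

lemma grid_sorted: "grid ts \<Longrightarrow> sorted_wrt (<) ts"
  by (simp add: grid_def)

lemma grid_cpairsD:
  assumes "grid ts" "(a, b) \<in> set (cpairs ts)"
  shows "0 \<le> a" "a < b" "a \<in> set ts" "b \<in> set ts"
  using set_cpairs_sorted[OF grid_sorted[OF assms(1)] assms(2)] grid_nonneg[OF assms(1)] by auto

lemma grid_le_last: "grid ts \<Longrightarrow> t \<in> set ts \<Longrightarrow> t \<le> last ts"
proof -
  assume g: "grid ts" and t: "t \<in> set ts"
  then obtain k where k: "k < length ts" "t = ts ! k" by (auto simp: in_set_conv_nth)
  have ne: "ts \<noteq> []" using g by (simp add: grid_def)
  have "ts ! k \<le> ts ! (length ts - 1)"
  proof (cases "k = length ts - 1")
    case False
    then have "k < length ts - 1" "length ts - 1 < length ts" using k(1) by linarith+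
    from grid_nth_mono[OF g this] show ?thesis by simp
  qed simp
  then show ?thesis using k(2) ne by (simp add: last_conv_nth)
qed

lemma grid_lastI: "grid ts \<Longrightarrow> T \<in> set ts \<Longrightarrow> (\<And>t. t \<in> set ts \<Longrightarrow> t \<le> T) \<Longrightarrow> last ts = T"
  using grid_le_last[of ts T] by (simp add: grid_def antisym)

lemma grid_last_nonneg: "grid ts \<Longrightarrow> 0 \<le> last ts"
  using grid_nonneg[of ts "last ts"] by (simp add: grid_def)

lemma grid_cell_unique:
  assumes g: "grid ts" and "i < length ts - 1" "ts ! i \<le> u" "u < ts ! Suc i"
    and "j < length ts - 1" "ts ! j \<le> u" "u < ts ! Suc j"
  shows "i = j"
proof (rule ccontr)
  have *: False if "i < j" "i < length ts - 1" "u < ts ! Suc i" "j < length ts - 1"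
      "ts ! j \<le> u" for i j
  proof -
    have j: "j < length ts" using that by linarith
    show False using grid_nth_mono[OF g _ j, of "Suc i"] that by (cases "Suc i = j") auto
  qed
  assume "i \<noteq> j"
  then show False using *[of i j] *[of j i] assms by (meson nat_neq_iff)
qed

lemma sorted_cell_exists:
  "sorted_wrt (<) ts \<Longrightarrow> ts \<noteq> [] \<Longrightarrow> hd ts \<le> u \<Longrightarrow> u < last ts \<Longrightarrow> \<exists>(a, b)\<in>set (cpairs ts). a \<le> u \<and> u < b"
  for ts :: "real list"
proof (induction ts rule: induct_list012)
  case (3 a b ts)
  show ?case
  proof (cases "u < b")
    case False
    then have "\<exists>(a, b)\<in>set (cpairs (b # ts)). a \<le> u \<and> u < b"
      by (intro "3.IH"(2)) (use "3.prems" in auto)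
    then show ?thesis by auto
  qed (use 3 in auto)
qed auto

lemma grid_cell_exists:
  "grid ts \<Longrightarrow> 0 \<le> u \<Longrightarrow> u < last ts \<Longrightarrow> \<exists>a b. (a, b) \<in> set (cpairs ts) \<and> a \<le> u \<and> u < b"
  using sorted_cell_exists[of ts u] unfolding grid_def by fastforce

lemma grid_union:
  assumes "grid ts" "grid us" "last ts = T" "last us = T"
  obtains vs where "grid vs" "set vs = set ts \<union> set us" "last vs = T"
proof -
  define vs where "vs = sorted_list_of_set (insert 0 (set ts \<union> set us))"
  have "grid vs" "set vs = insert 0 (set ts \<union> set us)"
    unfolding vs_def using grid_nonneg assms(1,2) by (intro grid_sorted_list; auto)+
  then have vs: "grid vs" "set vs = set ts \<union> set us" using grid_0_in[OF assms(1)] by auto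
  have "T \<in> set ts" using assms(1,3) by (auto simp: grid_def)
  then have "last vs = T"
    using vs grid_le_last[OF assms(1)] grid_le_last[OF assms(2)] assms(3,4)
        by (intro grid_lastI) auto
  with vs that show thesis by blast
qed

lemma gsum_indicator:
  "sorted_wrt (<) ts \<Longrightarrow> (\<And>a b. (a, b) \<in> set (cpairs ts) \<Longrightarrow> a \<le> u \<Longrightarrow> u < b \<Longrightarrow> f a = c) \<Longrightarrow> ts \<noteq> [] \<Longrightarrow>
   gsum (\<lambda>a b. indicator {a..<b} u * f a) ts = (if hd ts \<le> u \<and> u < last ts then c else 0)"
  for ts :: "real list"
proof (induction ts rule: induct_list012)
  case (3 a b ts)
  have IH: "gsum (\<lambda>a b. indicator {a..<b} u * f a) (b # ts) = (if hd (b # ts) \<le> u \<and> u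
      < last (b # ts) then c else 0)"
    by (rule "3.IH"(2)) (use "3.prems" in auto)
  have "b \<le> last (b # ts)" "a < b" using "3.prems"(1) by (auto simp: less_imp_le)
  then show ?case
    using IH "3.prems"(2)[of a b] by (auto simp: indicator_def)
qed auto

text \<open>The identity \<open>(y - x)^2 = y^2 - x^2 - 2 * x * (y - x)\<close>, summed over the
  cells: the discrete form of the definition of the quadratic variation.\<close>

lemma gsum_square:
  "ts \<noteq> [] \<Longrightarrow> gsum (\<lambda>a b. (h b - h a)\<^sup>2) ts = (h (last ts))\<^sup>2 - (h (hd ts))\<^sup>2
      - 2 * gsum (\<lambda>a b. h a * (h b - h a)) ts"
  for h :: "'b \<Rightarrow> real"
  by (induction ts rule: induct_list012) (auto simp: power2_eq_square algebra_simps)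

lemma gsum_zero: "gsum (\<lambda>a b. 0) ts = 0"
  by (induction ts rule: induct_list012) auto

lemma gsum_telescope: "ts \<noteq> [] \<Longrightarrow> gsum (\<lambda>a b. b - a) ts = last ts - hd ts"
  by (induction ts rule: induct_list012) auto

lemma gsum_map: "gsum f (map h ts) = gsum (\<lambda>a b. f (h a) (h b)) ts"
  by (induction ts rule: induct_list012) auto

section \<open>Distances between elements of the completion\<close>

lemma (in pseudometric) completion_dist_tri:
  assumes "X \<in> CS" "Y \<in> CS" "Z \<in> CS"
  shows "completion_dist d (cls X) (cls Z) \<le> completion_dist d (cls X) (cls Y)
      + completion_dist d (cls Y) (cls Z)"
proof (rule LIMSEQ_le[OF completion_dist_LIMSEQ])
  show "(\<lambda>n. d (X n) (Y n) + d (Y n) (Z n)) \<longlonglongrightarrow> completion_dist d (cls X) (cls Y)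
      + completion_dist d (cls Y) (cls Z)"
    by (intro tendsto_add completion_dist_LIMSEQ assms)
  show "\<exists>N. \<forall>n\<ge>N. d (X n) (Z n) \<le> d (X n) (Y n) + d (Y n) (Z n)"
    using d_tri CS_mem assms by blast
qed (rule assms)+

lemma (in pseudometric) completion_dist_nonneg:
  assumes "X \<in> CS" "Y \<in> CS"
  shows "0 \<le> completion_dist d (cls X) (cls Y)"
  by (rule LIMSEQ_le_const[OF completion_dist_LIMSEQ[OF assms]]) (use d_nonneg CS_mem assms in
      blast)

lemma (in pseudometric) completion_dist_commute:
  assumes "X \<in> CS" "Y \<in> CS"
  shows "completion_dist d (cls X) (cls Y) = completion_dist d (cls Y) (cls X)"
proof -
  have "(\<lambda>n. d (X n) (Y n)) = (\<lambda>n. d (Y n) (X n))" using d_sym CS_mem assms by blast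
  then show ?thesis
    using completion_dist_LIMSEQ[OF assms] completion_dist_LIMSEQ[OF assms(2,1)] LIMSEQ_unique
        by metis
qed

lemma (in pseudometric) completion_dist_eq_0D:
  assumes "X \<in> CS" "Y \<in> CS" "completion_dist d (cls X) (cls Y) = 0"
  shows "cls X = cls Y"
  using completion_dist_LIMSEQ[OF assms(1,2)] cls_eq_iff[OF assms(1,2)] assms(3) by simp

lemma (in pseudometric) completion_dist_const:
  assumes "x \<in> S" "y \<in> S"
  shows "completion_dist d (cls (\<lambda>_. x)) (cls (\<lambda>_. y)) = d x y"
  using LIMSEQ_unique[OF completion_dist_LIMSEQ[OF CS_const[OF assms(1)] CS_const[OF assms(2)]]
      tendsto_const] .

text \<open>Serves to recognise the class of a sequence of integral sums as the limit of these
  sums.\<close>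

lemma (in pseudometric) completion_dist_limit:
  assumes X: "X \<in> CS"
  shows "(\<lambda>n. completion_dist d (cls (\<lambda>_. X n)) (cls X)) \<longlonglongrightarrow> 0"
proof (rule LIMSEQ_I)
  fix e :: real assume e: "0 < e"
  obtain N where N: "\<forall>m\<ge>N. \<forall>n\<ge>N. d (X m) (X n) < e / 2" using CS_D[OF X, of "e / 2"] e by auto
  have "norm (completion_dist d (cls (\<lambda>_. X n)) (cls X) - 0) < e" if "N \<le> n" for n
  proof -
    note c = CS_const[OF CS_mem[OF X, of n]]
    have "completion_dist d (cls (\<lambda>_. X n)) (cls X) \<le> e / 2"
      by (rule LIMSEQ_le_const2[OF completion_dist_LIMSEQ[OF c X]]) (use N that in \<open>auto intro!:
          exI[of _ N] less_imp_le\<close>)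
    then show ?thesis using completion_dist_nonneg[OF c X] e by simp
  qed
  then show "\<exists>no. \<forall>n\<ge>no. norm (completion_dist d (cls (\<lambda>_. X n)) (cls X) - 0) < e" by blast
qed

context G_setting
begin

subsection \<open>Conditional estimates for increments\<close>

lemma Lip_B: "0 \<le> t \<Longrightarrow> B t \<in> Lip"
  by (simp add: Lip_eq Lip_on_B)

lemma Lip_upto_B: "0 \<le> t \<Longrightarrow> t \<le> T \<Longrightarrow> B t \<in> Lip_upto T"
  by (simp add: Lip_upto_eq Lip_on_B)

text \<open>Given the path up to \<open>a\<close>, the linear term has mean zero whatever the sign
  of \<open>V \<omega>\<close>, and the quadratic one has mean
  \<open>\<sigma>_hi\<^sup>2 * (b - a) * W \<omega>\<close> because \<open>W \<omega>\<close> is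
  nonnegative; the tower property does the rest. The moment estimates for increments and for
  integrals rest on this.\<close>

lemma Ehat_quadratic_incr:
  assumes ab: "0 \<le> a" "a \<le> b" and UVW: "U \<in> Lip_upto a" "V \<in> Lip_upto a" "W \<in> Lip_upto a"
    and W0: "\<And>\<omega>. 0 \<le> W \<omega>"
  shows "Ehat (\<lambda>\<omega>. U \<omega> + V \<omega> * (B b \<omega> - B a \<omega>) + W \<omega> * (B b \<omega> - B a \<omega>)\<^sup>2)
    \<le> Ehat (\<lambda>\<omega>. U \<omega> + \<sigma>_hi\<^sup>2 * (b - a) * W \<omega>)"
proof -
  define X where "X \<omega> = U \<omega> + V \<omega> * (B b \<omega> - B a \<omega>) + W \<omega> * (B b \<omega> - B a \<omega>)\<^sup>2" for \<omega>
  have L: "U \<in> Lip" "V \<in> Lip" "W \<in> Lip" "B a \<in> Lip" "B b \<in> Lip" "B (b - a) \<in> Lip"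
    using UVW ab by (auto intro: Lip_upto_Lip Lip_B)
  have X: "X \<in> Lip" unfolding X_def by (intro Lip_intros L)
  have le: "Ehat (\<lambda>\<omega>'. X (conc a \<omega> \<omega>')) \<le> U \<omega> + \<sigma>_hi\<^sup>2 * (b - a) * W \<omega>" for \<omega>
  proof -
    have "X (conc a \<omega> \<omega>') = U \<omega> + (V \<omega> * B (b - a) \<omega>' + W \<omega> * (B (b - a) \<omega>')\<^sup>2)" for \<omega>'
      unfolding X_def using ab UVW by (simp add: conc_Lip_upto B_conc)
    then have "Ehat (\<lambda>\<omega>'. X (conc a \<omega> \<omega>')) \<le> Ehat (\<lambda>_. U \<omega>) + Ehat (\<lambda>\<omega>'. V \<omega> * B (b - a) \<omega>'
        + W \<omega> * (B (b - a) \<omega>')\<^sup>2)"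
      by (simp only:) (intro Ehat_subadd Lip_intros L)
    also have "\<dots> \<le> Ehat (\<lambda>_. U \<omega>) + (Ehat (\<lambda>\<omega>'. V \<omega> * B (b - a) \<omega>') + Ehat (\<lambda>\<omega>'. W \<omega> * (B (b
        - a) \<omega>')\<^sup>2))"
      by (intro add_left_mono Ehat_subadd Lip_intros L)
    finally show ?thesis
      using ab W0[of \<omega>] by (simp add: Ehat_const Ehat_B_mean Ehat_B_square mult_ac)
  qed
  have "Ehat X = Ehat (\<lambda>\<omega>. Ehat (\<lambda>\<omega>'. X (conc a \<omega> \<omega>')))"
    using Ehat_tower[OF X ab(1)] by simp
  also have "\<dots> \<le> Ehat (\<lambda>\<omega>. U \<omega> + \<sigma>_hi\<^sup>2 * (b - a) * W \<omega>)"
    by (intro Ehat_mono le Lip_upto_Lip[OF Ehat_conc_Lip_upto[OF X ab(1)]] Lip_intros L)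
  finally show ?thesis by (simp add: X_def[abs_def])
qed

lemma Ehat_incr_square:
  assumes "0 \<le> a" "0 \<le> b"
  shows "Ehat (\<lambda>\<omega>. (B b \<omega> - B a \<omega>)\<^sup>2) \<le> \<sigma>_hi\<^sup>2 * \<bar>b - a\<bar>"
proof -
  have *: "Ehat (\<lambda>\<omega>. (B b \<omega> - B a \<omega>)\<^sup>2) \<le> \<sigma>_hi\<^sup>2 * (b - a)" if "0 \<le> a" "a \<le> b" for a b
    using Ehat_quadratic_incr[OF that, of "\<lambda>_. 0" "\<lambda>_. 0" "\<lambda>_. 1"]
    by (simp add: Lip_upto_intros Ehat_const)
  show ?thesis
  proof (cases "a \<le> b")
    case False
    then show ?thesis using *[of b a] assms by (simp add: power2_commute[of "B b _"])
  qed (use *[of a b] assms in simp)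
qed

lemma nrm_times_incr:
  assumes ab: "0 \<le> a" "a \<le> b" and Y: "Y \<in> Lip_upto a"
  shows "nrm 2 (\<lambda>\<omega>. Y \<omega> * (B b \<omega> - B a \<omega>)) \<le> sqrt (\<sigma>_hi\<^sup>2 * (b - a)) * nrm 2 Y"
proof -
  have "Ehat (\<lambda>\<omega>. (Y \<omega> * (B b \<omega> - B a \<omega>))\<^sup>2) \<le> Ehat (\<lambda>\<omega>. \<sigma>_hi\<^sup>2 * (b - a) * (Y \<omega>)\<^sup>2)"
    using Ehat_quadratic_incr[OF ab, of "\<lambda>_. 0" "\<lambda>_. 0" "\<lambda>\<omega>. (Y \<omega>)\<^sup>2"] Y
    by (simp add: Lip_upto_intros power_mult_distrib)
  also have "\<dots> = \<sigma>_hi\<^sup>2 * (b - a) * Ehat (\<lambda>\<omega>. (Y \<omega>)\<^sup>2)"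
    using ab Lip_upto_Lip[OF Y] by (intro Ehat_cmult Lip_intros) auto
  finally show ?thesis
    unfolding nrm_2 real_sqrt_mult[symmetric] by (rule real_sqrt_le_mono)
qed

text \<open>The squared integral and its bound are kept inside one expectation, and the expectation
  of their difference is shown to be at most 0. Estimating cell by cell and adding up afterwards
  would produce a sum of expectations, which may exceed the expectation of the sum.\<close>

lemma ito_inequality:
  assumes "grid ts" and Z: "\<And>a. Z a \<in> Lip_upto a"
  shows "Ehat (\<lambda>\<omega>. (gsum (\<lambda>a b. Z a \<omega> * (B b \<omega> - B a \<omega>)) ts)\<^sup>2)
    \<le> \<sigma>_hi\<^sup>2 * Ehat (\<lambda>\<omega>. gsum (\<lambda>a b. (b - a) * (Z a \<omega>)\<^sup>2) ts)"
proof -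
  let ?I = "\<lambda>ts \<omega>. gsum (\<lambda>a b. Z a \<omega> * (B b \<omega> - B a \<omega>)) ts"
  let ?A = "\<lambda>ts \<omega>. gsum (\<lambda>a b. (b - a) * (Z a \<omega>)\<^sup>2) ts"
  have I: "?I ts \<in> Lip_upto (last ts)" and A: "?A ts \<in> Lip_upto (last ts)" if g: "grid ts" for ts
  proof -
    have ab: "0 \<le> a" "a \<le> last ts" "0 \<le> b" "b \<le> last ts" if "(a, b) \<in> set (cpairs ts)" for a b
      using grid_cpairsD[OF g that] grid_le_last[OF g] grid_nonneg[OF g] by auto
    show "?I ts \<in> Lip_upto (last ts)"
      unfolding Lip_upto_eq
      by (rule gsum_Lip_on)
         (use ab in \<open>auto simp: Lip_upto_eq[symmetric] intro!: Lip_upto_intros Lip_upto_B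
             Lip_upto_mono[OF Z]\<close>)
    show "?A ts \<in> Lip_upto (last ts)"
      unfolding Lip_upto_eq
      by (rule gsum_Lip_on)
         (use ab in \<open>auto simp: Lip_upto_eq[symmetric] intro!: Lip_upto_intros Lip_upto_mono[OF Z]\<close>)
  qed
  have le: "Ehat (\<lambda>\<omega>. (?I ts \<omega>)\<^sup>2 - \<sigma>_hi\<^sup>2 * ?A ts \<omega>) \<le> 0" if "grid ts" for ts
    using that
  proof (induction ts rule: rev_induct)
    case (snoc b cs)
    show ?case
    proof (cases cs rule: rev_cases)
      case Nil
      then show ?thesis by (simp add: Ehat_const)
    next
      case (snoc as a)
      have g: "grid (as @ a # [b])" using snoc.prems snoc by simp
      have g': "grid (as @ [a])" by (rule grid_splitD(2)[OF g])
      have ab: "0 \<le> a" "a \<le> b" using grid_splitD[OF g] by auto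
      \<comment> \<open>All terms that depend only on the path up to \<open>a\<close>. The energy of
        the last cell is among them, already subtracted, so that it cancels against the bound for
        the quadratic term.\<close>
      let ?U = "\<lambda>\<omega>. (?I (as @ [a]) \<omega>)\<^sup>2 - \<sigma>_hi\<^sup>2 * ?A (as @ [a]) \<omega> - \<sigma>_hi\<^sup>2 * (b - a) * (Z a \<omega>)\<^sup>2"
      have I': "?I (as @ [a]) \<in> Lip_upto a" and A': "?A (as @ [a]) \<in> Lip_upto a"
        using I[OF g'] A[OF g'] by simp_all
      have "Ehat (\<lambda>\<omega>. ?U \<omega> + 2 * ?I (as @ [a]) \<omega> * Z a \<omega> * (B b \<omega> - B a \<omega>) + (Z a \<omega>)\<^sup>2 * (B b \<omega>
          - B a \<omega>)\<^sup>2)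
          \<le> Ehat (\<lambda>\<omega>. ?U \<omega> + \<sigma>_hi\<^sup>2 * (b - a) * (Z a \<omega>)\<^sup>2)"
        by (rule Ehat_quadratic_incr[OF ab, of ?U "\<lambda>\<omega>. 2 * ?I (as @ [a]) \<omega> * Z a \<omega>"
            "\<lambda>\<omega>. (Z a \<omega>)\<^sup>2"])
           (intro Lip_upto_intros I' A' Z | simp)+
      also have "(\<lambda>\<omega>. ?U \<omega> + \<sigma>_hi\<^sup>2 * (b - a) * (Z a \<omega>)\<^sup>2)
          = (\<lambda>\<omega>. (?I (as @ [a]) \<omega>)\<^sup>2 - \<sigma>_hi\<^sup>2 * ?A (as @ [a]) \<omega>)"
        by simp
      also have "Ehat \<dots> \<le> 0" using snoc.IH g' snoc by simp
      also have "(\<lambda>\<omega>. ?U \<omega> + 2 * ?I (as @ [a]) \<omega> * Z a \<omega> * (B b \<omega> - B a \<omega>) + (Z a \<omega>)\<^sup>2 * (B b \<omega>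
          - B a \<omega>)\<^sup>2)
          = (\<lambda>\<omega>. (?I (as @ a # [b]) \<omega>)\<^sup>2 - \<sigma>_hi\<^sup>2 * ?A (as @ a # [b]) \<omega>)"
        unfolding gsum_append[of _ as a "[b]"] by (simp add: power2_eq_square algebra_simps)
      finally show ?thesis using snoc by simp
    qed
  qed (simp add: grid_def)
  have L: "?I ts \<in> Lip" "?A ts \<in> Lip" using I[OF assms(1)] A[OF assms(1)]
      by (auto dest: Lip_upto_Lip)
  have "Ehat (\<lambda>\<omega>. (?I ts \<omega>)\<^sup>2) \<le> 1 * Ehat (\<lambda>\<omega>. (?I ts \<omega>)\<^sup>2 - \<sigma>_hi\<^sup>2 * ?A ts \<omega>)
      + \<sigma>_hi\<^sup>2 * Ehat (?A ts)"
    by (intro Ehat_le_combination Lip_intros L) auto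
  with le[OF assms(1)] show ?thesis by simp
qed

subsection \<open>Step processes\<close>

text \<open>A step process is represented by a family of Cauchy sequences of cylinder functions that is
  literally constant on the cells of the grid, so that passing to a finer grid does not change
  the family.\<close>

definition pw_const :: "real \<Rightarrow> real list \<Rightarrow> (real \<Rightarrow> nat \<Rightarrow> cpath \<Rightarrow> real) \<Rightarrow> bool" where
  "pw_const T ts X \<longleftrightarrow> grid ts \<and> last ts = T \<and> (\<forall>a. X a \<in> CS 2 \<and> (\<forall>n. X a n \<in> Lip_upto a)) \<and>
     (\<forall>a. \<not> (0 \<le> a \<and> a < T) \<longrightarrow> X a = (\<lambda>n \<omega>. 0)) \<and>
     (\<forall>a b u. (a, b) \<in> set (cpairs ts) \<longrightarrow> a \<le> u \<longrightarrow> u < b \<longrightarrow> X u = X a)"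

definition class_process :: "(real \<Rightarrow> nat \<Rightarrow> cpath \<Rightarrow> real) \<Rightarrow> real \<Rightarrow> LG_elem" where
  "class_process X u = lg_class 2 (X u)"

definition ito_sum :: "real list \<Rightarrow> (real \<Rightarrow> nat \<Rightarrow> cpath \<Rightarrow> real) \<Rightarrow> nat \<Rightarrow> cpath \<Rightarrow> real" where
  "ito_sum ts X n \<omega> = gsum (\<lambda>a b. X a n \<omega> * (B b \<omega> - B a \<omega>)) ts"

definition energy_sum :: "real list \<Rightarrow> (real \<Rightarrow> nat \<Rightarrow> cpath \<Rightarrow> real) \<Rightarrow> nat \<Rightarrow> cpath \<Rightarrow> real" where
  "energy_sum ts X n \<omega> = gsum (\<lambda>a b. (b - a) * (X a n \<omega>)\<^sup>2) ts"

lemma pw_constD: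
  assumes "pw_const T ts X"
  shows "grid ts" "last ts = T" "X a \<in> CS 2" "X a n \<in> Lip_upto a"
    "\<not> (0 \<le> a \<and> a < T) \<Longrightarrow> X a = (\<lambda>n \<omega>. 0)"
    "(a, b) \<in> set (cpairs ts) \<Longrightarrow> a \<le> u \<Longrightarrow> u < b \<Longrightarrow> X u = X a"
  using assms unfolding pw_const_def by blast+

lemma Lip_upto_0: "(\<lambda>_. 0) \<in> Lip_upto a"
  by (rule Lip_upto_intros)

lemma Lip_0: "(\<lambda>_. 0) \<in> Lip"
  by (rule Lip_intros)

lemma pw_const_exists:
  assumes g: "grid ts" "last ts = T"
    and Y: "\<And>k. k < length ts - 1 \<Longrightarrow> Y k \<in> CS 2"
        "\<And>k n. k < length ts - 1 \<Longrightarrow> Y k n \<in> Lip_upto (ts ! k)"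
  obtains X where "pw_const T ts X" "\<And>k. k < length ts - 1 \<Longrightarrow> X (ts ! k) = Y k"
proof -
  define cell where "cell u k \<longleftrightarrow> k < length ts - 1 \<and> ts ! k \<le> u \<and> u < ts ! Suc k" for u k
  define X where "X u = (if \<exists>k. cell u k then Y (THE k. cell u k) else (\<lambda>n \<omega>. 0))" for u
  have X: "X u = Y k" if "cell u k" for u k
  proof -
    have "(THE k. cell u k) = k"
    proof (rule the_equality)
      show "cell u k" by (rule that)
      show "k' = k" if "cell u k'" for k'
        using grid_cell_unique[OF g(1), of k' u k] that \<open>cell u k\<close> by (simp add: cell_def)
    qed
    with that show ?thesis unfolding X_def by auto
  qed
  have X0: "X u = (\<lambda>n \<omega>. 0)" if "\<nexists>k. cell u k" for u using that by (simp add: X_def)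
  have cellk: "cell (ts ! k) k" if "k < length ts - 1" for k
    using that grid_nth_mono[OF g(1), of k "Suc k"] by (simp add: cell_def)
  have "pw_const T ts X"
    unfolding pw_const_def
  proof (intro conjI allI impI g)
    fix a n
    show "X a \<in> CS 2"
      using X[of a] X0[of a] Y(1) CS_const[of 2 "\<lambda>_. 0"] Lip_0
          by (cases "\<exists>k. cell a k") (auto simp: cell_def)
    show "X a n \<in> Lip_upto a"
    proof (cases "\<exists>k. cell a k")
      case True
      then obtain k where k: "cell a k" by blast
      then show ?thesis using X[OF k] Lip_upto_mono[OF Y(2)[of k n], of a] by (simp add: cell_def)
    qed (simp add: X0 Lip_upto_0)
  next
    fix a assume a: "\<not> (0 \<le> a \<and> a < T)"
    have "\<not> cell a k" for k
    proof
      assume k: "cell a k"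
      then have "ts ! k \<in> set ts" "ts ! Suc k \<in> set ts" by (auto simp: cell_def)
      then show False
        using a k grid_nonneg[OF g(1), of "ts ! k"] grid_le_last[OF g(1), of "ts ! Suc k"] g(2)
        by (auto simp: cell_def)
    qed
    then show "X a = (\<lambda>n \<omega>. 0)" by (intro X0) blast
  next
    fix a b u assume ab: "(a, b) \<in> set (cpairs ts)" "a \<le> u" "u < b"
    then obtain k where k: "k < length ts - 1" "a = ts ! k" "b = ts ! Suc k"
        by (auto simp: cpairs_iff)
    then have "cell u k" using ab by (simp add: cell_def)
    then show "X u = X a" using X[of u k] X[OF cellk[OF k(1)]] k(2) by simp
  qed
  moreover have "X (ts ! k) = Y k" if "k < length ts - 1" for k by (rule X[OF cellk[OF that]])
  ultimately show thesis by (rule that)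
qed

text \<open>Since \<open>X\<close> takes the same value at both halves of a divided cell, its
  summand splits in two by additivity of increments and of lengths.\<close>

lemma pw_const_refine:
  assumes "pw_const T ts X" "grid us" "set ts \<subseteq> set us" "last us = T"
  shows "pw_const T us X \<and> ito_sum us X = ito_sum ts X \<and> energy_sum us X = energy_sum ts X"
  using pw_constD(1)[OF assms(1)] assms(2,3)
proof (induction rule: grid_refine_induct)
  case base
  then show ?case using assms(1) by simp
next
  \<comment> \<open>Both grids end at \<open>T\<close>, so no point lies beyond the last one and the
    case is contradictory.\<close>
  case (extend as a m)
  then have "a = T" "m \<le> T" using pw_constD(2)[of T "as @ [a]" X] grid_le_last[OF assms(2), of m]
      assms(4) by auto
  then show ?case using extend by simp
next
  case (insert as a b bs m)
  let ?o = "as @ a # b # bs" and ?n = "as @ a # m # b # bs"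
  note pco = conjunct1[OF insert.IH]
  have co: "cpairs ?o = cpairs (as @ [a]) @ (a, b) # cpairs (b # bs)"
    by (subst cpairs_append) simp
  have cn: "cpairs ?n = cpairs (as @ [a]) @ (a, m) # (m, b) # cpairs (b # bs)"
    by (subst cpairs_append) simp
  have c: "X u = X a" if "a \<le> u" "u < b" for u
    by (rule pw_constD(6)[OF pco _ that]) (simp add: co)
  have m: "X m = X a" using c[of m] insert by simp
  have "pw_const T ?n X"
    unfolding pw_const_def
  proof (intro conjI allI impI)
    show "last ?n = T" using pw_constD(2)[OF pco] by simp
    fix a' b' u assume "(a', b') \<in> set (cpairs ?n)" and u: "a' \<le> u" "u < b'"
    then consider "(a', b') \<in> set (cpairs ?o)" | "a' = a" "b' = m" | "a' = m" "b' = b"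
      unfolding cn co by auto
    then show "X u = X a'"
    proof cases
      case 1 then show ?thesis using pw_constD(6)[OF pco _ u] by simp
    next
      case 2 then show ?thesis using c[of u] u insert by simp
    next
      case 3 then show ?thesis using c[of u] m u insert by simp
    qed
  qed (use pw_constD[OF pco] insert in auto)
  moreover have "ito_sum ?n X = ito_sum ?o X"
    unfolding ito_sum_def gsum_def co cn using m by (simp add: fun_eq_iff algebra_simps)
  moreover have "energy_sum ?n X = energy_sum ?o X"
    unfolding energy_sum_def gsum_def co cn using m by (simp add: fun_eq_iff algebra_simps)
  ultimately show ?case using insert.IH by simp
qed

lemma pw_const_common:
  assumes "pw_const T ts X" "pw_const T us Y"
  obtains vs where "pw_const T vs X" "pw_const T vs Y" "ito_sum vs X = ito_sum ts X"
      "energy_sum vs X = energy_sum ts X"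
    "ito_sum vs Y = ito_sum us Y" "energy_sum vs Y = energy_sum us Y"
proof -
  obtain vs where vs: "grid vs" "set vs = set ts \<union> set us" "last vs = T"
    using grid_union pw_constD(1,2)[OF assms(1)] pw_constD(1,2)[OF assms(2)] by metis
  show thesis
    by (rule that[of vs])
       (use pw_const_refine[OF assms(1) vs(1) _ vs(3)] pw_const_refine[OF assms(2) vs(1) _ vs(3)]
           vs(2) in simp_all)
qed

definition proc_diff :: "(real \<Rightarrow> nat \<Rightarrow> cpath \<Rightarrow> real) \<Rightarrow> (real \<Rightarrow> nat \<Rightarrow> cpath \<Rightarrow> real) \<Rightarrow> real \<Rightarrow> nat \<Rightarrow>
    cpath \<Rightarrow> real" where
  "proc_diff X Y a n \<omega> = X a n \<omega> - Y a n \<omega>"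

lemma pw_const_proc_diff:
  assumes X: "pw_const T ts X" and Y: "pw_const T ts Y"
  shows "pw_const T ts (proc_diff X Y)"
  unfolding pw_const_def
proof (intro conjI allI impI pw_constD(1,2)[OF X])
  fix a n
  show "proc_diff X Y a \<in> CS 2"
    using CS_diff[OF _ pw_constD(3)[OF X] pw_constD(3)[OF Y], of a a]
        by (simp add: proc_diff_def[abs_def])
  show "proc_diff X Y a n \<in> Lip_upto a"
    unfolding proc_diff_def[abs_def] by (intro Lip_upto_intros pw_constD(4)[OF X] pw_constD(4)[OF
        Y])
next
  fix a assume "\<not> (0 \<le> a \<and> a < T)"
  from pw_constD(5)[OF X this] pw_constD(5)[OF Y this] show "proc_diff X Y a = (\<lambda>n \<omega>. 0)"
      by (simp add: proc_diff_def fun_eq_iff)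
next
  fix a b u assume "(a, b) \<in> set (cpairs ts)" "a \<le> u" "u < b"
  from pw_constD(6)[OF X this] pw_constD(6)[OF Y this] show "proc_diff X Y u = proc_diff X Y a"
      by (simp add: proc_diff_def fun_eq_iff)
qed

lemma class_process_proc_diff: "pw_const T ts X \<Longrightarrow> pw_const T ts Y
    \<Longrightarrow> lg_diff 2 (class_process X u) (class_process Y u) = class_process (proc_diff X Y) u"
  unfolding class_process_def proc_diff_def[abs_def] by (rule lg_diff_class) (auto intro: pw_constD)

text \<open>At a time in \<open>[0, T)\<close> exactly one indicator is 1, and its summand is the
  class of \<open>X u\<close> as \<open>X\<close> is constant on cells; at other times both sides
  are the class of 0.\<close>

lemma step_process_class_process:
  assumes X: "pw_const T ts X"
  shows "step_process ts (\<lambda>k. lg_class 2 (X (ts ! k))) = class_process X"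
proof
  fix u
  let ?Y = "\<lambda>a b n \<omega>. indicator {a..<b} u * X a n \<omega>"
  have "step_process ts (\<lambda>k. lg_class 2 (X (ts ! k))) u
      = lg_sum 2 (length ts - 1) (\<lambda>k. lg_class 2 (?Y (ts ! k) (ts ! Suc k)))"
    unfolding step_process_def by (rule lg_sum_cong) (simp add: lg_scale_class pw_constD(3)[OF X])
  also have "\<dots> = lg_class 2 (\<lambda>n \<omega>. gsum (\<lambda>a b. ?Y a b n \<omega>) ts)"
    by (rule lg_sum_gsum) (auto intro: CS_cmult pw_constD(3)[OF X])
  also have "(\<lambda>n \<omega>. gsum (\<lambda>a b. ?Y a b n \<omega>) ts) = X u"
  proof (intro ext)
    fix n \<omega>
    have g: "sorted_wrt (<) ts" "ts \<noteq> []" "hd ts = 0" "last ts = T" using pw_constD(1,2)[OF X]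
        by (auto simp: grid_def)
    have "gsum (\<lambda>a b. ?Y a b n \<omega>) ts = (if hd ts \<le> u \<and> u < last ts then X u n \<omega> else 0)"
    proof (rule gsum_indicator[where f = "\<lambda>a. X a n \<omega>", OF g(1) _ g(2)])
      show "X a n \<omega> = X u n \<omega>" if "(a, b) \<in> set (cpairs ts)" "a \<le> u" "u < b" for a b
        by (simp only: pw_constD(6)[OF X that])
    qed
    then show "gsum (\<lambda>a b. ?Y a b n \<omega>) ts = X u n \<omega>"
      using pw_constD(5)[OF X, of u] g by auto
  qed
  finally show "step_process ts (\<lambda>k. lg_class 2 (X (ts ! k))) u = class_process X u"
      by (simp add: class_process_def)
qed

lemma LG_uptoE:
  assumes "a \<in> LG_upto 2 u"
  obtains X where "X \<in> CS 2" "\<And>n. X n \<in> Lip_upto u" "a = lg_class 2 X"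
proof -
  obtain X where X: "a \<in> LG 2" "X \<in> a" "\<And>n. X n \<in> Lip_upto u" using assms unfolding LG_upto_def
      by blast
  then obtain Z where Z: "Z \<in> CS 2" "a = lg_class 2 Z" using LG_iff[of 2 a] by auto
  have X2: "X \<in> CS 2" "(\<lambda>n. nrm 2 (\<lambda>\<omega>. Z n \<omega> - X n \<omega>)) \<longlonglongrightarrow> 0" using X(2) Z mem_lg_class[of 2 Z X]
      by auto
  then have "a = lg_class 2 X" using Z lg_class_eq_iff[of 2 Z X] by simp
  with X2 X(3) that show thesis by blast
qed

lemma LG_uptoI: "X \<in> CS 2 \<Longrightarrow> (\<And>n. X n \<in> Lip_upto u) \<Longrightarrow> lg_class 2 X \<in> LG_upto 2 u"
  unfolding LG_upto_def using self_in_lg_class[of 2 X] lg_class_LG[of 2 X] by auto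

text \<open>Passes from a step process given by classes to adapted cylinder functions, one sequence
  per cell, so that sums over cells can be formed as sums of functions.\<close>

lemma step_rep_pw_const:
  assumes "step_rep T \<eta> ts x"
  obtains X where "pw_const T ts X" "\<And>k. k < length ts - 1 \<Longrightarrow> x k = lg_class 2 (X (ts ! k))"
      "\<eta> = class_process X"
proof -
  have g: "grid ts" "last ts = T" and x: "\<And>k. k < length ts - 1 \<Longrightarrow> x k \<in> LG_upto 2 (ts ! k)"
    and \<eta>: "\<eta> = step_process ts x"
    using assms unfolding step_rep_def by auto
  have "\<forall>k. \<exists>Y. k < length ts - 1 \<longrightarrow> Y \<in> CS 2 \<and> (\<forall>n. Y n \<in> Lip_upto (ts ! k)) \<and> x k = lg_class 2 Y"
    using x LG_uptoE by metis
  then obtain Y where Y: "\<And>k. k < length ts - 1 \<Longrightarrow> Y k \<in> CS 2"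
      "\<And>k n. k < length ts - 1 \<Longrightarrow> Y k n \<in> Lip_upto (ts ! k)"
    "\<And>k. k < length ts - 1 \<Longrightarrow> x k = lg_class 2 (Y k)" by metis
  obtain X where X: "pw_const T ts X" "\<And>k. k < length ts - 1 \<Longrightarrow> X (ts ! k) = Y k"
    using pw_const_exists[OF g, of Y] Y(1,2) by metis
  have xk: "x k = lg_class 2 (X (ts ! k))" if "k < length ts - 1" for k using X(2) Y(3) that by simp
  have "\<eta> = step_process ts (\<lambda>k. lg_class 2 (X (ts ! k)))"
    unfolding \<eta> step_process_def by (intro ext lg_sum_cong) (simp add: xk)
  then have "\<eta> = class_process X" using step_process_class_process[OF X(1)] by simp
  then show thesis using that[OF X(1) xk] by blast
qed

lemma pw_const_step_rep: "pw_const T ts X \<Longrightarrow> step_rep T (class_process X) ts (\<lambda>k. lg_class 2 (X (ts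
    ! k)))"
  unfolding step_rep_def using step_process_class_process[of T ts X] LG_uptoI pw_constD by metis

lemma MG20_iff: "\<eta> \<in> MG20 T \<longleftrightarrow> (\<exists>ts X. pw_const T ts X \<and> \<eta> = class_process X)"
  unfolding MG20_def using step_rep_pw_const pw_const_step_rep by blast

section \<open>Integrals of step processes\<close>

lemma CS_times_incr:
  assumes ab: "0 \<le> a" "a \<le> b" and X: "X \<in> CS 2" "\<And>n. X n \<in> Lip_upto a"
  shows "(\<lambda>n \<omega>. X n \<omega> * (B b \<omega> - B a \<omega>)) \<in> CS 2"
proof (rule CS_dominated[OF _ _ X(1), of _ _ "sqrt (\<sigma>_hi\<^sup>2 * (b - a))"])
  show "(\<lambda>\<omega>. X n \<omega> * (B b \<omega> - B a \<omega>)) \<in> Lip" for n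
    using ab by (intro Lip_intros CS_mem[OF X(1)] Lip_B) auto
  show "nrm 2 (\<lambda>\<omega>. X m \<omega> * (B b \<omega> - B a \<omega>) - X n \<omega> * (B b \<omega> - B a \<omega>))
      \<le> sqrt (\<sigma>_hi\<^sup>2 * (b - a)) * nrm 2 (\<lambda>\<omega>. X m \<omega> - X n \<omega>)" for m n
    using nrm_times_incr[OF ab, of "\<lambda>\<omega>. X m \<omega> - X n \<omega>"] X(2)
    by (simp add: Lip_upto_intros left_diff_distrib)
qed auto

text \<open>\<open>lg_lift\<close> does not apply, since the bound for multiplication by the
  increment, \<open>nrm_times_incr\<close>, requires representatives that are known at time
  \<open>a\<close>.\<close>

lemma lg_times_incr_class:
  assumes ab: "0 \<le> a" "a \<le> b" and X: "X \<in> CS 2" "\<And>n. X n \<in> Lip_upto a"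
  shows "lg_times_incr (lg_class 2 X) a b = lg_class 2 (\<lambda>n \<omega>. X n \<omega> * (B b \<omega> - B a \<omega>))"
  unfolding lg_times_incr_def
proof (rule UN_const[of X])
  show "X \<in> {Y \<in> lg_class 2 X. \<forall>n. Y n \<in> Lip_upto a}" using X self_in_lg_class[of 2 X] by simp
  fix Y assume "Y \<in> {Y \<in> lg_class 2 X. \<forall>n. Y n \<in> Lip_upto a}"
  then have Y: "Y \<in> CS 2" "\<And>n. Y n \<in> Lip_upto a" and lim: "(\<lambda>n. nrm 2 (\<lambda>\<omega>. X n \<omega> - Y n \<omega>)) \<longlonglongrightarrow> 0"
    using mem_lg_class[of 2 X Y] X(1) by auto
  have "nrm 2 (\<lambda>\<omega>. X n \<omega> * (B b \<omega> - B a \<omega>) - Y n \<omega> * (B b \<omega> - B a \<omega>))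
      \<le> sqrt (\<sigma>_hi\<^sup>2 * (b - a)) * nrm 2 (\<lambda>\<omega>. X n \<omega> - Y n \<omega>)" for n
    using nrm_times_incr[OF ab, of "\<lambda>\<omega>. X n \<omega> - Y n \<omega>"] X(2) Y(2)
    by (simp add: Lip_upto_intros left_diff_distrib)
  moreover have "0 \<le> nrm 2 (\<lambda>\<omega>. X n \<omega> * (B b \<omega> - B a \<omega>) - Y n \<omega> * (B b \<omega> - B a \<omega>))" for n
    using ab by (intro nrm_nonneg Lip_intros CS_mem[OF X(1)] CS_mem[OF Y(1)] Lip_B) auto
  ultimately have "(\<lambda>n. nrm 2 (\<lambda>\<omega>. X n \<omega> * (B b \<omega> - B a \<omega>) - Y n \<omega> * (B b \<omega> - B a \<omega>))) \<longlonglongrightarrow> 0"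
    by (intro LIMSEQ_0_dominated[OF lim])
  then show "lg_class 2 (\<lambda>n \<omega>. Y n \<omega> * (B b \<omega> - B a \<omega>))
      = lg_class 2 (\<lambda>n \<omega>. X n \<omega> * (B b \<omega> - B a \<omega>))"
    using lg_class_eq_iff[of 2 "\<lambda>n \<omega>. X n \<omega> * (B b \<omega> - B a \<omega>)" "\<lambda>n \<omega>. Y n \<omega> * (B b \<omega> - B a \<omega>)"]
      CS_times_incr[OF ab X] CS_times_incr[OF ab Y] by simp
qed

lemma ito_sum_terms:
  assumes X: "pw_const T ts X" and ab: "(a, b) \<in> set (cpairs ts)"
  shows "(\<lambda>n \<omega>. X a n \<omega> * (B b \<omega> - B a \<omega>)) \<in> CS 2" "(\<lambda>n \<omega>. (b - a) * (X a n \<omega>)\<^sup>2) \<in> CS 1"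
    "lg_times_incr (lg_class 2 (X a)) a b = lg_class 2 (\<lambda>n \<omega>. X a n \<omega> * (B b \<omega> - B a \<omega>))"
    "lg_scale 1 (b - a) (lg_square (lg_class 2 (X a))) = lg_class 1 (\<lambda>n \<omega>. (b - a) * (X a n \<omega>)\<^sup>2)"
proof -
  note ab' = grid_cpairsD(1,2)[OF pw_constD(1)[OF X] ab]
  note X' = pw_constD(3,4)[OF X]
  show "(\<lambda>n \<omega>. X a n \<omega> * (B b \<omega> - B a \<omega>)) \<in> CS 2"
    using ab' by (intro CS_times_incr X') auto
  show "(\<lambda>n \<omega>. (b - a) * (X a n \<omega>)\<^sup>2) \<in> CS 1"
    by (intro CS_cmult CS_square X') simp
  show "lg_times_incr (lg_class 2 (X a)) a b = lg_class 2 (\<lambda>n \<omega>. X a n \<omega> * (B b \<omega> - B a \<omega>))"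
    using ab' by (intro lg_times_incr_class X') auto
  show "lg_scale 1 (b - a) (lg_square (lg_class 2 (X a)))
      = lg_class 1 (\<lambda>n \<omega>. (b - a) * (X a n \<omega>)\<^sup>2)"
    by (simp add: lg_square_class lg_scale_class CS_square X')
qed

lemma ito_sum_CS: "pw_const T ts X \<Longrightarrow> ito_sum ts X \<in> CS 2" and energy_sum_CS: "pw_const T ts X
    \<Longrightarrow> energy_sum ts X \<in> CS 1"
  unfolding ito_sum_def[abs_def] energy_sum_def[abs_def]
  by (rule gsum_CS[OF disjI2[OF refl] ito_sum_terms(1)], assumption+)
     (rule gsum_CS[OF disjI1[OF refl] ito_sum_terms(2)], assumption+)

lemma lg_sum_ito_sum:
  assumes X: "pw_const T ts X"
  shows "lg_sum 2 (length ts - 1) (\<lambda>k. lg_times_incr (lg_class 2 (X (ts ! k))) (ts ! k) (ts ! Suc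
      k)) = lg_class 2 (ito_sum ts X)"
    and "lg_sum 1 (length ts - 1) (\<lambda>k. lg_scale 1 (ts ! Suc k
        - ts ! k) (lg_square (lg_class 2 (X (ts ! k))))) = lg_class 1 (energy_sum ts X)"
proof -
  have ab: "(ts ! k, ts ! Suc k) \<in> set (cpairs ts)" if "k < length ts - 1" for k
    using that by (auto simp: cpairs_iff)
  have "lg_sum 2 (length ts - 1) (\<lambda>k. lg_times_incr (lg_class 2 (X (ts ! k))) (ts ! k) (ts ! Suc k))
      = lg_sum 2 (length ts - 1) (\<lambda>k. lg_class 2 ((\<lambda>a b n \<omega>. X a n \<omega> * (B b \<omega>
          - B a \<omega>)) (ts ! k) (ts ! Suc k)))"
    by (rule lg_sum_cong) (rule ito_sum_terms(3)[OF X ab])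
  also have "\<dots> = lg_class 2 (ito_sum ts X)"
    unfolding ito_sum_def[abs_def] by (rule lg_sum_gsum) (auto intro: ito_sum_terms(1)[OF X])
  finally show "lg_sum 2 (length ts - 1) (\<lambda>k. lg_times_incr (lg_class 2 (X (ts ! k))) (ts ! k) (ts
      ! Suc k)) = lg_class 2 (ito_sum ts X)" .
  have "lg_sum 1 (length ts - 1) (\<lambda>k. lg_scale 1 (ts ! Suc k
      - ts ! k) (lg_square (lg_class 2 (X (ts ! k)))))
      = lg_sum 1 (length ts - 1) (\<lambda>k. lg_class 1 ((\<lambda>a b n \<omega>. (b
          - a) * (X a n \<omega>)\<^sup>2) (ts ! k) (ts ! Suc k)))"
    by (rule lg_sum_cong) (rule ito_sum_terms(4)[OF X ab])
  also have "\<dots> = lg_class 1 (energy_sum ts X)"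
    unfolding energy_sum_def[abs_def] by (rule lg_sum_gsum) (auto intro: ito_sum_terms(2)[OF X])
  finally show "lg_sum 1 (length ts - 1) (\<lambda>k. lg_scale 1 (ts ! Suc k
      - ts ! k) (lg_square (lg_class 2 (X (ts ! k))))) = lg_class 1 (energy_sum ts X)" .
qed

text \<open>Equal classes at every time allow the sums to be compared term by term on a common
  refinement. Together with \<open>step_integrals\<close> this disposes of the choice of a
  representation in both integrals.\<close>

lemma ito_sum_unique:
  assumes X: "pw_const T ts X" and Y: "pw_const T us Y" and eq: "class_process X = class_process Y"
  shows "lg_class 2 (ito_sum ts X) = lg_class 2 (ito_sum us Y)"
      "lg_class 1 (energy_sum ts X) = lg_class 1 (energy_sum us Y)"
proof -
  obtain vs where vs: "pw_const T vs X" "pw_const T vs Y" "ito_sum vs X = ito_sum ts X"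
      "energy_sum vs X = energy_sum ts X"
    "ito_sum vs Y = ito_sum us Y" "energy_sum vs Y = energy_sum us Y"
        using pw_const_common[OF X Y] .
  have "lg_class 2 (X a) = lg_class 2 (Y a)" for a using fun_cong[OF eq, of a]
      by (simp add: class_process_def)
  then show "lg_class 2 (ito_sum ts X) = lg_class 2 (ito_sum us Y)"
      "lg_class 1 (energy_sum ts X) = lg_class 1 (energy_sum us Y)"
    using lg_sum_ito_sum[OF vs(1)] lg_sum_ito_sum[OF vs(2)] vs(3-6) by simp_all
qed

lemma step_integrals:
  assumes X: "pw_const T ts X"
  shows "step_integral T (class_process X) = lg_class 2 (ito_sum ts X)"
      "step_sq_integral T (class_process X) = lg_class 1 (energy_sum ts X)"
proof -
  define p where "p = (SOME (us, x). step_rep T (class_process X) us x)"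
  have "case p of (us, x) \<Rightarrow> step_rep T (class_process X) us x"
    unfolding p_def by (rule someI[of _ "(ts, \<lambda>k. lg_class 2 (X (ts ! k)))"]) (simp add:
        pw_const_step_rep[OF X])
  then obtain us x where p: "p = (us, x)" "step_rep T (class_process X) us x" by (cases p) auto
  obtain Y where Y: "pw_const T us Y" "\<And>k. k < length us - 1 \<Longrightarrow> x k = lg_class 2 (Y (us ! k))"
      "class_process X = class_process Y"
    using step_rep_pw_const[OF p(2)] by metis
  have "step_integral T (class_process X) = lg_sum 2 (length us
      - 1) (\<lambda>k. lg_times_incr (lg_class 2 (Y (us ! k))) (us ! k) (us ! Suc k))"
    unfolding step_integral_def p_def[symmetric] p(1) by (simp cong: lg_sum_cong add: Y(2))
  then show "step_integral T (class_process X) = lg_class 2 (ito_sum ts X)"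
    using lg_sum_ito_sum(1)[OF Y(1)] ito_sum_unique(1)[OF X Y(1,3)] by simp
  have "step_sq_integral T (class_process X) = lg_sum 1 (length us
      - 1) (\<lambda>k. lg_scale 1 (us ! Suc k - us ! k) (lg_square (lg_class 2 (Y (us ! k)))))"
    unfolding step_sq_integral_def p_def[symmetric] p(1) by (simp cong: lg_sum_cong add: Y(2))
  then show "step_sq_integral T (class_process X) = lg_class 1 (energy_sum ts X)"
    using lg_sum_ito_sum(2)[OF Y(1)] ito_sum_unique(2)[OF X Y(1,3)] by simp
qed

text \<open>Expresses the distance as a limit over expectations of cylinder functions, so that
  inequalities between distances can be proved for each \<open>n\<close> and passed to the
  limit.\<close>

lemma MG2_dist_LIMSEQ:
  assumes X: "pw_const T ts X" and Y: "pw_const T ts Y"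
  shows "(\<lambda>n. sqrt (Ehat (energy_sum ts (proc_diff X Y) n))) \<longlonglongrightarrow> MG2_dist T (class_process X)
      (class_process Y)"
proof -
  have "(\<lambda>u. lg_diff 2 (class_process X u) (class_process Y u)) = class_process (proc_diff X Y)"
    by (intro ext class_process_proc_diff[OF X Y])
  then have "MG2_dist T (class_process X) (class_process Y)
      = sqrt (lg_E (lg_class 1 (energy_sum ts (proc_diff X Y))))"
    using step_integrals(2)[OF pw_const_proc_diff[OF X Y]] by (simp add: MG2_dist_def)
  then show ?thesis using lg_E_class[OF energy_sum_CS[OF pw_const_proc_diff[OF X Y]]]
      by (simp add: tendsto_real_sqrt)
qed

lemma energy_sum_Lip: "pw_const T ts X \<Longrightarrow> energy_sum ts X n \<in> Lip"
  using CS_mem[OF energy_sum_CS] .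

lemma energy_sum_nonneg: "pw_const T ts X \<Longrightarrow> 0 \<le> energy_sum ts X n \<omega>"
  unfolding energy_sum_def using grid_cpairsD(2)[OF pw_constD(1)]
      by (intro gsum_nonneg mult_nonneg_nonneg) force+

lemma energy_sum_triangle:
  assumes X: "pw_const T ts X" and Y: "pw_const T ts Y" and Z: "pw_const T ts Z"
  shows "sqrt (Ehat (energy_sum ts (proc_diff X Z) n))
      \<le> sqrt (Ehat (energy_sum ts (proc_diff X Y) n))
          + sqrt (Ehat (energy_sum ts (proc_diff Y Z) n))"
proof (rule Ehat_sqrt_triangle)
  fix r :: real and \<omega> assume r: "0 < r"
  have "energy_sum ts (proc_diff X Z) n \<omega> \<le> gsum (\<lambda>a b. (1 + r) * ((b
      - a) * (proc_diff X Y a n \<omega>)\<^sup>2) + (1 + 1 / r) * ((b - a) * (proc_diff Y Z a n \<omega>)\<^sup>2)) ts"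
    unfolding energy_sum_def
  proof (rule gsum_mono)
    fix a b assume ab: "(a, b) \<in> set (cpairs ts)"
    have "(proc_diff X Z a n \<omega>)\<^sup>2 \<le> (1 + r) * (proc_diff X Y a n \<omega>)\<^sup>2 + (1
        + 1 / r) * (proc_diff Y Z a n \<omega>)\<^sup>2"
      using young_square[OF r, of "proc_diff X Y a n \<omega>" "proc_diff Y Z a n \<omega>"]
          by (simp add: proc_diff_def)
    from mult_left_mono[OF this, of "b - a"] grid_cpairsD(2)[OF pw_constD(1)[OF X] ab]
    show "(b - a) * (proc_diff X Z a n \<omega>)\<^sup>2 \<le> (1 + r) * ((b - a) * (proc_diff X Y a n \<omega>)\<^sup>2) + (1
        + 1 / r) * ((b - a) * (proc_diff Y Z a n \<omega>)\<^sup>2)"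
      by (simp only: distrib_left mult.left_commute[of "b - a"])
  qed
  then show "energy_sum ts (proc_diff X Z) n \<omega>
      \<le> (1 + r) * energy_sum ts (proc_diff X Y) n \<omega> + (1
          + 1 / r) * energy_sum ts (proc_diff Y Z) n \<omega>"
    by (simp only: energy_sum_def gsum_add gsum_cmult)
qed (rule energy_sum_Lip[OF pw_const_proc_diff[OF X Y]] energy_sum_Lip[OF pw_const_proc_diff[OF Y
    Z]] energy_sum_Lip[OF pw_const_proc_diff[OF X Z]]
    energy_sum_nonneg[OF pw_const_proc_diff[OF X Y]] energy_sum_nonneg[OF pw_const_proc_diff[OF Y
        Z]])+

lemma pseudometric_MG2: "pseudometric (MG20 T) (MG2_dist T)"
proof
  fix \<eta> \<zeta> \<theta> assume "\<eta> \<in> MG20 T" "\<zeta> \<in> MG20 T" "\<theta> \<in> MG20 T"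
  then obtain ts1 X ts2 Y ts3 Z where
    XYZ: "pw_const T ts1 X" "pw_const T ts2 Y" "pw_const T ts3 Z" "\<eta> = class_process X"
        "\<zeta> = class_process Y" "\<theta> = class_process Z"
    unfolding MG20_iff by blast
  obtain us where us: "pw_const T us X" "pw_const T us Y" using pw_const_common[OF XYZ(1,2)]
      by metis
  obtain vs where vs: "pw_const T vs X" "pw_const T vs Z" using pw_const_common[OF us(1) XYZ(3)]
      by metis
  obtain ws where ws: "pw_const T ws Y" "pw_const T ws Z" "pw_const T ws X"
  proof -
    obtain ws where g: "grid ws" "set ws = set us \<union> set vs" "last ws = T"
      using grid_union pw_constD(1,2)[OF us(1)] pw_constD(1,2)[OF vs(1)] by metis
    show thesis
      by (rule that[of ws])
         (use pw_const_refine[OF us(2) g(1) _ g(3)] pw_const_refine[OF vs(2) g(1) _ g(3)]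
             pw_const_refine[OF vs(1) g(1) _ g(3)] g(2)
          in simp_all)
  qed
  have "energy_sum ws (proc_diff X X) n = (\<lambda>_. 0)" for n
      by (simp add: fun_eq_iff energy_sum_def proc_diff_def gsum_zero)
  then show "MG2_dist T \<eta> \<eta> = 0"
    using LIMSEQ_unique[OF MG2_dist_LIMSEQ[OF ws(3,3)], of 0] XYZ by (simp add: Ehat_const)
  have "energy_sum ws (proc_diff X Y) = energy_sum ws (proc_diff Y X)"
      by (simp add: energy_sum_def proc_diff_def fun_eq_iff power2_commute)
  then show "MG2_dist T \<eta> \<zeta> = MG2_dist T \<zeta> \<eta>"
    using LIMSEQ_unique[OF MG2_dist_LIMSEQ[OF ws(3,1)]] MG2_dist_LIMSEQ[OF ws(1,3)] XYZ by simp
  have "MG2_dist T (class_process X) (class_process Z)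
      \<le> MG2_dist T (class_process X) (class_process Y)
          + MG2_dist T (class_process Y) (class_process Z)"
    by (rule LIMSEQ_le[OF MG2_dist_LIMSEQ[OF ws(3,2)] tendsto_add[OF MG2_dist_LIMSEQ[OF ws(3,1)]
        MG2_dist_LIMSEQ[OF ws(1,2)]]])
       (use energy_sum_triangle[OF ws(3,1,2)] in blast)
  then show "MG2_dist T \<eta> \<theta> \<le> MG2_dist T \<eta> \<zeta> + MG2_dist T \<zeta> \<theta>" using XYZ by simp
qed

abbreviation cdist2 :: "LG_elem \<Rightarrow> LG_elem \<Rightarrow> real" where
  "cdist2 \<equiv> completion_dist (Lp_dist 2)"

sublocale L2: pseudometric Lip "Lp_dist 2"
  by (rule pseudometric_Lp) simp

lemma lg_class_cls: "lg_class 2 X = L2.cls X"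
  by (simp add: lg_class_def)

lemma L2_CS: "L2.CS = CS 2"
  by (simp add: CS_def)

lemma step_integral_LG: "\<eta> \<in> MG20 T \<Longrightarrow> \<exists>X\<in>CS 2. step_integral T \<eta> = lg_class 2 X"
  unfolding MG20_iff using step_integrals(1) ito_sum_CS by blast

text \<open>Ito's inequality for the difference of two processes on a common grid, passed to the
  limit. This Lipschitz bound is what extends the integral to the completion.\<close>

lemma step_integral_dist:
  assumes "\<eta> \<in> MG20 T" "\<zeta> \<in> MG20 T"
  shows "cdist2 (step_integral T \<eta>) (step_integral T \<zeta>) \<le> \<bar>\<sigma>_hi\<bar> * MG2_dist T \<eta> \<zeta>"
proof -
  obtain ts X us Y where XY: "pw_const T ts X" "pw_const T us Y" "\<eta> = class_process X"
      "\<zeta> = class_process Y"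
    using assms unfolding MG20_iff by blast
  obtain vs where vs: "pw_const T vs X" "pw_const T vs Y" using pw_const_common[OF XY(1,2)] by metis
  note CS2 = ito_sum_CS[OF vs(1)] ito_sum_CS[OF vs(2)]
  show ?thesis
    unfolding XY(3,4) step_integrals(1)[OF vs(1)] step_integrals(1)[OF vs(2)] lg_class_cls
  proof (rule LIMSEQ_le[OF L2.completion_dist_LIMSEQ tendsto_mult_left[OF MG2_dist_LIMSEQ[OF vs]]])
    have "Lp_dist 2 (ito_sum vs X n) (ito_sum vs Y n)
        \<le> \<bar>\<sigma>_hi\<bar> * sqrt (Ehat (energy_sum vs (proc_diff X Y) n))" for n
    proof -
      have "ito_sum vs X n \<omega> - ito_sum vs Y n \<omega> = ito_sum vs (proc_diff X Y) n \<omega>" for \<omega>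
        by (simp add: ito_sum_def proc_diff_def gsum_diff[symmetric] left_diff_distrib)
      then have "Lp_dist 2 (ito_sum vs X n) (ito_sum vs Y n)
          = sqrt (Ehat (\<lambda>\<omega>. (ito_sum vs (proc_diff X Y) n \<omega>)\<^sup>2))"
        using Lp_dist_eq[of 2] CS_mem[OF CS2(1)] CS_mem[OF CS2(2)] by (simp add: nrm_2)
      also have "\<dots> \<le> sqrt (\<sigma>_hi\<^sup>2 * Ehat (energy_sum vs (proc_diff X Y) n))"
        using ito_inequality[OF pw_constD(1)[OF vs(1)], of "\<lambda>a. proc_diff X Y a n"]
            pw_constD(4)[OF pw_const_proc_diff[OF vs]]
        by (simp add: ito_sum_def energy_sum_def[abs_def])
      finally show ?thesis by (simp add: real_sqrt_mult)
    qed
    then show "\<exists>N. \<forall>n\<ge>N. Lp_dist 2 (ito_sum vs X n) (ito_sum vs Y n)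
        \<le> \<bar>\<sigma>_hi\<bar> * sqrt (Ehat (energy_sum vs (proc_diff X Y) n))" by blast
  qed (use CS2 in \<open>simp_all add: L2_CS\<close>)
qed

end

context G_setting
begin

subsection \<open>The stochastic integral of the canonical process\<close>

definition B_step :: "real list \<Rightarrow> real \<Rightarrow> LG_elem" where
  "B_step ts = step_process ts (\<lambda>k. lg_embed 2 (B (ts ! k)))"

lemma B_step_pw_const:
  assumes g: "grid ts" "last ts = T"
  obtains X where "pw_const T ts X" "B_step ts = class_process X"
    "\<And>a b u. (a, b) \<in> set (cpairs ts) \<Longrightarrow> a \<le> u \<Longrightarrow> u < b \<Longrightarrow> X u = (\<lambda>_. B a)"
proof -
  have nn: "0 \<le> ts ! k" if "k < length ts - 1" for k using grid_nonneg[OF g(1), of "ts ! k"] that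
      by simp
  obtain X where X: "pw_const T ts X" "\<And>k. k < length ts - 1 \<Longrightarrow> X (ts ! k) = (\<lambda>_. B (ts ! k))"
    by (rule pw_const_exists[OF g, of "\<lambda>k _. B (ts ! k)"]) (auto intro!: CS_const Lip_B Lip_upto_B
        nn)
  have "B_step ts = step_process ts (\<lambda>k. lg_class 2 (X (ts ! k)))"
    unfolding B_step_def step_process_def lg_embed_def by (intro ext lg_sum_cong) (simp add: X(2))
  then have "B_step ts = class_process X" using step_process_class_process[OF X(1)] by simp
  moreover have "X u = (\<lambda>_. B a)" if ab: "(a, b) \<in> set (cpairs ts)" "a \<le> u" "u < b" for a b u
    using pw_constD(6)[OF X(1) ab] X(2) ab(1) by (auto simp: cpairs_iff)
  ultimately show thesis using that[OF X(1)] by blast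
qed

lemma B_step_MG20: "grid ts \<Longrightarrow> B_step ts \<in> MG20 (last ts)"
  using B_step_pw_const[of ts "last ts"] unfolding MG20_iff by metis

lemma Ehat_gsum_le:
  "(\<And>a b. (a, b) \<in> set (cpairs ts) \<Longrightarrow> f a b \<in> Lip) \<Longrightarrow>
   Ehat (\<lambda>\<omega>. gsum (\<lambda>a b. f a b \<omega>) ts) \<le> gsum (\<lambda>a b. Ehat (f a b)) ts"
proof (induction ts rule: induct_list012)
  case (3 a b ts)
  have "Ehat (\<lambda>\<omega>. f a b \<omega> + gsum (\<lambda>a b. f a b \<omega>) (b # ts))
      \<le> Ehat (f a b) + Ehat (\<lambda>\<omega>. gsum (\<lambda>a b. f a b \<omega>) (b # ts))"
    by (intro Ehat_subadd gsum_Lip) (use "3.prems" in auto)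
  also have "\<dots> \<le> Ehat (f a b) + gsum (\<lambda>a b. Ehat (f a b)) (b # ts)"
    by (intro add_left_mono "3.IH"(2)) (use "3.prems" in auto)
  finally show ?case by simp
qed (simp_all add: Ehat_const)

text \<open>On a cell of a common refinement starting at \<open>a\<close>, the discretizations have
  the values \<open>B p\<close> and \<open>B p'\<close>, where \<open>p\<close> and
  \<open>p'\<close> are the left ends of the two coarse cells that contain \<open>a\<close>. Neither
  lies more than \<open>e\<close> before \<open>a\<close>, so the mean square of the difference is
  at most \<open>\<sigma>_hi\<^sup>2 * e\<close>; the lengths of the cells sum to
  \<open>T\<close>.\<close>

lemma B_step_dist:
  assumes ts: "grid ts" "last ts = T" "\<And>a b. (a, b) \<in> set (cpairs ts) \<Longrightarrow> b - a < e"
    and us: "grid us" "last us = T" "\<And>a b. (a, b) \<in> set (cpairs us) \<Longrightarrow> b - a < e"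
  shows "MG2_dist T (B_step ts) (B_step us) \<le> sqrt (\<sigma>_hi\<^sup>2 * e * T)"
proof -
  obtain X where X: "pw_const T ts X" "B_step ts = class_process X"
    "\<And>a b u. (a, b) \<in> set (cpairs ts) \<Longrightarrow> a \<le> u \<Longrightarrow> u < b \<Longrightarrow> X u = (\<lambda>_. B a)"
        using B_step_pw_const[OF ts(1,2)] by metis
  obtain Y where Y: "pw_const T us Y" "B_step us = class_process Y"
    "\<And>a b u. (a, b) \<in> set (cpairs us) \<Longrightarrow> a \<le> u \<Longrightarrow> u < b \<Longrightarrow> Y u = (\<lambda>_. B a)"
        using B_step_pw_const[OF us(1,2)] by metis
  obtain vs where vs: "pw_const T vs X" "pw_const T vs Y" using pw_const_common[OF X(1) Y(1)]
      by metis
  note g = pw_constD(1,2)[OF vs(1)]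
  have le: "Ehat (energy_sum vs (proc_diff X Y) n) \<le> \<sigma>_hi\<^sup>2 * e * T" for n
  proof -
    have "Ehat (energy_sum vs (proc_diff X Y) n)
        \<le> gsum (\<lambda>a b. Ehat (\<lambda>\<omega>. (b - a) * (proc_diff X Y a n \<omega>)\<^sup>2)) vs"
      unfolding energy_sum_def by (intro Ehat_gsum_le Lip_intros CS_mem[OF pw_constD(3)[OF
          pw_const_proc_diff[OF vs]]])
    also have "\<dots> \<le> gsum (\<lambda>a b. \<sigma>_hi\<^sup>2 * e * (b - a)) vs"
    proof (rule gsum_mono)
      fix a b assume ab: "(a, b) \<in> set (cpairs vs)"
      note ab' = grid_cpairsD[OF g(1) ab]
      have aT: "a < T" using ab' grid_le_last[OF g(1), of b] g(2) by simp
      obtain p q where pq: "(p, q) \<in> set (cpairs ts)" "p \<le> a" "a < q"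
        using grid_cell_exists[OF ts(1), of a] ab'(1) aT ts(2) by auto
      obtain p' q' where pq': "(p', q') \<in> set (cpairs us)" "p' \<le> a" "a < q'"
        using grid_cell_exists[OF us(1), of a] ab'(1) aT us(2) by auto
      have p0: "0 \<le> p" "0 \<le> p'" using grid_cpairsD(1)[OF ts(1) pq(1)] grid_cpairsD(1)[OF us(1)
          pq'(1)] by auto
      have "\<bar>p - p'\<bar> \<le> e" using ts(3)[OF pq(1)] us(3)[OF pq'(1)] pq pq' by linarith
      then have "Ehat (\<lambda>\<omega>. (B p \<omega> - B p' \<omega>)\<^sup>2) \<le> \<sigma>_hi\<^sup>2 * e"
        using Ehat_incr_square[OF p0(2,1)] by (meson mult_left_mono order_trans zero_le_power2)
      moreover have "proc_diff X Y a n \<omega> = B p \<omega> - B p' \<omega>" for \<omega>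
        using X(3)[OF pq] Y(3)[OF pq'] by (simp add: proc_diff_def)
      moreover have "Ehat (\<lambda>\<omega>. (b - a) * (B p \<omega> - B p' \<omega>)\<^sup>2)
          = (b - a) * Ehat (\<lambda>\<omega>. (B p \<omega> - B p' \<omega>)\<^sup>2)"
        using ab'(2) by (intro Ehat_cmult Lip_intros Lip_B p0) simp
      ultimately show "Ehat (\<lambda>\<omega>. (b - a) * (proc_diff X Y a n \<omega>)\<^sup>2) \<le> \<sigma>_hi\<^sup>2 * e * (b - a)"
        using ab'(2) by (simp add: mult.commute[of _ "b - a"])
    qed
    also have "\<dots> = \<sigma>_hi\<^sup>2 * e * T"
      using g gsum_telescope[of vs] by (simp add: gsum_cmult grid_def)
    finally show ?thesis .
  qed
  show ?thesis
    unfolding X(2) Y(2)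
    by (rule LIMSEQ_le_const2[OF MG2_dist_LIMSEQ[OF vs]]) (use le in \<open>auto intro:
        real_sqrt_le_mono\<close>)
qed

lemma vanishing_meshD:
  assumes "vanishing_mesh T \<pi>"
  shows "grid (\<pi> N)" "last (\<pi> N) = T"
    "0 < e \<Longrightarrow> \<exists>N0. \<forall>N\<ge>N0. \<forall>a b. (a, b) \<in> set (cpairs (\<pi> N)) \<longrightarrow> b - a < e"
  using assms unfolding vanishing_mesh_def eventually_sequentially by (auto simp: cpairs_iff) metis

text \<open>Stated for two mesh sequences: with both equal it is the Cauchy property, otherwise the
  equivalence of the discretizations.\<close>

lemma B_step_dist_small:
  assumes \<pi>: "vanishing_mesh T \<pi>" and \<rho>: "vanishing_mesh T \<rho>" and d: "0 < d"
  shows "\<exists>N. \<forall>m\<ge>N. \<forall>n\<ge>N. MG2_dist T (B_step (\<pi> m)) (B_step (\<rho> n)) < d"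
proof -
  have T: "0 \<le> T" using grid_last_nonneg[OF vanishing_meshD(1)[OF \<pi>], of 0] vanishing_meshD(2)[OF
      \<pi>] by simp
  \<comment> \<open>The summand 1 makes \<open>c\<close> positive; then
    \<open>e = d\<^sup>2 / c\<close> gives
    \<open>\<sigma>_hi\<^sup>2 * e * T < d\<^sup>2\<close>.\<close>
  define c where "c = \<sigma>_hi\<^sup>2 * T + 1"
  have c: "0 < c" using T by (simp add: c_def add_nonneg_pos)
  define e where "e = d\<^sup>2 / c"
  have e: "0 < e" using d c by (simp add: e_def)
  obtain N1 where N1: "\<And>N a b. N \<ge> N1 \<Longrightarrow> (a, b) \<in> set (cpairs (\<pi> N)) \<Longrightarrow> b - a < e"
    using vanishing_meshD(3)[OF \<pi> e] by blast
  obtain N2 where N2: "\<And>N a b. N \<ge> N2 \<Longrightarrow> (a, b) \<in> set (cpairs (\<rho> N)) \<Longrightarrow> b - a < e"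
    using vanishing_meshD(3)[OF \<rho> e] by blast
  have "\<sigma>_hi\<^sup>2 * e * T < c * e" using e by (simp add: c_def algebra_simps)
  also have "\<dots> = d\<^sup>2" using c by (simp add: e_def)
  finally have s: "sqrt (\<sigma>_hi\<^sup>2 * e * T) < d" using d by (simp add: real_less_lsqrt)
  have "MG2_dist T (B_step (\<pi> m)) (B_step (\<rho> n)) < d" if "m \<ge> max N1 N2" "n \<ge> max N1 N2" for m n
  proof -
    have "MG2_dist T (B_step (\<pi> m)) (B_step (\<rho> n)) \<le> sqrt (\<sigma>_hi\<^sup>2 * e * T)"
      by (rule B_step_dist[OF vanishing_meshD(1,2)[OF \<pi>] _ vanishing_meshD(1,2)[OF \<rho>]])
         (use that in \<open>auto intro: N1 N2\<close>)
    with s show ?thesis by linarith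
  qed
  then show ?thesis by blast
qed

lemma B_step_vanishing_MG20: "vanishing_mesh T \<pi> \<Longrightarrow> B_step (\<pi> N) \<in> MG20 T"
  using B_step_MG20 vanishing_meshD(1,2) by metis

text \<open>All discretizations are equivalent, so one class contains them; \<pi> itself witnesses
  that no other class does. The definite description thus denotes the class of any single mesh
  sequence.\<close>

lemma B_process_eq:
  assumes \<pi>: "vanishing_mesh T \<pi>"
  shows "(\<lambda>N. B_step (\<pi> N)) \<in> cauchy_seqs (MG20 T) (MG2_dist T)"
    "B_process T = cauchy_rel (MG20 T) (MG2_dist T) `` {\<lambda>N. B_step (\<pi> N)}"
proof -
  interpret MG: pseudometric "MG20 T" "MG2_dist T" by (rule pseudometric_MG2)
  have CS: "(\<lambda>N. B_step (\<rho> N)) \<in> MG.CS" if "vanishing_mesh T \<rho>" for \<rho>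
    by (rule MG.CS_I[OF B_step_vanishing_MG20[OF that] B_step_dist_small[OF that that]])
  show "(\<lambda>N. B_step (\<pi> N)) \<in> MG.CS" by (rule CS[OF \<pi>])
  have rel: "(\<lambda>N. B_step (\<rho> N)) \<in> MG.cls (\<lambda>N. B_step (\<pi> N))" if \<rho>: "vanishing_mesh T \<rho>" for \<rho>
  proof -
    have "(\<lambda>n. MG2_dist T (B_step (\<pi> n)) (B_step (\<rho> n))) \<longlonglongrightarrow> 0"
    proof (rule LIMSEQ_I)
      fix d :: real assume "0 < d"
      then obtain N where N: "\<forall>m\<ge>N. \<forall>n\<ge>N. MG2_dist T (B_step (\<pi> m)) (B_step (\<rho> n)) < d"
        using B_step_dist_small[OF \<pi> \<rho>] by blast
      have "norm (MG2_dist T (B_step (\<pi> n)) (B_step (\<rho> n)) - 0) < d" if "N \<le> n" for n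
        using N that MG.d_nonneg[OF B_step_vanishing_MG20[OF \<pi>] B_step_vanishing_MG20[OF \<rho>], of n
            n] by simp
      then show "\<exists>N. \<forall>n\<ge>N. norm (MG2_dist T (B_step (\<pi> n)) (B_step (\<rho> n)) - 0) < d" by blast
    qed
    then show ?thesis using CS[OF \<pi>] CS[OF \<rho>] by (simp add: MG.rel_iff)
  qed
  show "B_process T = MG.cls (\<lambda>N. B_step (\<pi> N))"
    unfolding B_process_def B_step_def[symmetric]
  proof (rule the_equality)
    show "MG.cls (\<lambda>N. B_step (\<pi> N)) \<in> MG2 T \<and>
      (\<forall>\<rho>. vanishing_mesh T \<rho> \<longrightarrow> (\<lambda>N. B_step (\<rho> N)) \<in> MG.cls (\<lambda>N. B_step (\<pi> N)))"
      using rel CS[OF \<pi>] unfolding MG2_def MG.completion_iff by blast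
  next
    fix c assume c: "c \<in> MG2 T \<and> (\<forall>\<rho>. vanishing_mesh T \<rho> \<longrightarrow> (\<lambda>N. B_step (\<rho> N)) \<in> c)"
    then obtain X where "c = MG.cls X" "(\<lambda>N. B_step (\<pi> N)) \<in> MG.cls X"
      using \<pi> unfolding MG2_def MG.completion_iff by blast
    then show "c = MG.cls (\<lambda>N. B_step (\<pi> N))" using MG.cls_eqI by blast
  qed
qed

definition B_dB_sum :: "real list \<Rightarrow> cpath \<Rightarrow> real" where
  "B_dB_sum ts \<omega> = gsum (\<lambda>a b. B a \<omega> * (B b \<omega> - B a \<omega>)) ts"

lemma B_dB_sum_Lip_upto: "grid ts \<Longrightarrow> B_dB_sum ts \<in> Lip_upto (last ts)"
  unfolding B_dB_sum_def[abs_def] Lip_upto_eq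
  by (rule gsum_Lip_on, intro Lip_on_intros Lip_on_B)
     (auto dest: grid_cpairsD grid_nonneg grid_le_last)

lemma B_dB_sum_Lip: "grid ts \<Longrightarrow> B_dB_sum ts \<in> Lip"
  using B_dB_sum_Lip_upto Lip_upto_Lip by blast

lemma step_integral_B_step:
  assumes "grid ts" "last ts = T"
  shows "step_integral T (B_step ts) = lg_class 2 (\<lambda>_. B_dB_sum ts)"
proof -
  obtain X where X: "pw_const T ts X" "B_step ts = class_process X"
    "\<And>a b u. (a, b) \<in> set (cpairs ts) \<Longrightarrow> a \<le> u \<Longrightarrow> u < b \<Longrightarrow> X u = (\<lambda>_. B a)"
    using B_step_pw_const[OF assms] by metis
  have "ito_sum ts X n \<omega> = B_dB_sum ts \<omega>" for n \<omega>
    unfolding ito_sum_def B_dB_sum_def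
  proof (rule gsum_cong)
    fix a b assume ab: "(a, b) \<in> set (cpairs ts)"
    then show "X a n \<omega> * (B b \<omega> - B a \<omega>) = B a \<omega> * (B b \<omega> - B a \<omega>)"
      using X(3)[OF ab order_refl grid_cpairsD(2)[OF assms(1) ab]] by simp
  qed
  then have "ito_sum ts X = (\<lambda>_. B_dB_sum ts)" by (simp add: fun_eq_iff)
  then show ?thesis using step_integrals(1)[OF X(1)] X(2) by simp
qed

lemma B_dB_sum_CS:
  assumes \<pi>: "vanishing_mesh T \<pi>"
  shows "(\<lambda>N. B_dB_sum (\<pi> N)) \<in> CS 2"
  unfolding L2_CS[symmetric]
proof (rule L2.CS_I)
  note L = B_dB_sum_Lip[OF vanishing_meshD(1)[OF \<pi>]]
  show "B_dB_sum (\<pi> n) \<in> Lip" for n by (rule L)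
  fix e :: real assume e: "0 < e"
  have d: "0 < e / (\<bar>\<sigma>_hi\<bar> + 1)" using e by (simp add: add_nonneg_pos)
  obtain N where N: "\<forall>m\<ge>N. \<forall>n\<ge>N. MG2_dist T (B_step (\<pi> m)) (B_step (\<pi> n)) < e / (\<bar>\<sigma>_hi\<bar> + 1)"
    using B_step_dist_small[OF \<pi> \<pi> d] by blast
  have "Lp_dist 2 (B_dB_sum (\<pi> m)) (B_dB_sum (\<pi> n)) < e" if "m \<ge> N" "n \<ge> N" for m n
  proof -
    have "Lp_dist 2 (B_dB_sum (\<pi> m)) (B_dB_sum (\<pi> n))
        = cdist2 (step_integral T (B_step (\<pi> m))) (step_integral T (B_step (\<pi> n)))"
      unfolding step_integral_B_step[OF vanishing_meshD(1,2)[OF \<pi>]] lg_class_cls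
      by (rule L2.completion_dist_const[OF L L, symmetric])
    also have "\<dots> \<le> \<bar>\<sigma>_hi\<bar> * MG2_dist T (B_step (\<pi> m)) (B_step (\<pi> n))"
      by (intro step_integral_dist B_step_vanishing_MG20 \<pi>)
    also have "\<dots> \<le> \<bar>\<sigma>_hi\<bar> * (e / (\<bar>\<sigma>_hi\<bar> + 1))"
      using N that by (intro mult_left_mono) (auto intro: less_imp_le)
    also have "\<dots> < e" using e by (simp add: field_simps add_nonneg_pos)
    finally show ?thesis .
  qed
  then show "\<exists>N. \<forall>m\<ge>N. \<forall>n\<ge>N. Lp_dist 2 (B_dB_sum (\<pi> m)) (B_dB_sum (\<pi> n)) < e" by blast
qed

text \<open>The defining property of the integral speaks of all representatives of the integrand.
  The discretizations along \<pi> settle uniqueness, and the Lipschitz bound transfers the limit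
  from them to every other representative.\<close>

lemma ito_integral_B:
  assumes \<pi>: "vanishing_mesh T \<pi>"
  shows "ito_integral T (B_process T) = lg_class 2 (\<lambda>N. B_dB_sum (\<pi> N))"
proof -
  interpret MG: pseudometric "MG20 T" "MG2_dist T" by (rule pseudometric_MG2)
  note g = vanishing_meshD(1,2)[OF \<pi>]
  let ?Z = "lg_class 2 (\<lambda>N. B_dB_sum (\<pi> N))"
  note Z = B_dB_sum_CS[OF \<pi>]
  have lim0: "(\<lambda>N. cdist2 (step_integral T (B_step (\<pi> N))) ?Z) \<longlonglongrightarrow> 0"
    unfolding step_integral_B_step[OF g] lg_class_cls
    by (rule L2.completion_dist_limit) (use Z in \<open>simp add: L2_CS\<close>)
  have lim: "(\<lambda>N. cdist2 (step_integral T (\<eta> N)) ?Z) \<longlonglongrightarrow> 0" if \<eta>: "\<eta> \<in> B_process T" for \<eta>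
  proof -
    have \<eta>': "\<eta> \<in> MG.CS" "(\<lambda>n. MG2_dist T (B_step (\<pi> n)) (\<eta> n)) \<longlonglongrightarrow> 0"
      using \<eta> unfolding B_process_eq(2)[OF \<pi>] by (auto simp: MG.rel_iff)
    note M = MG.CS_mem[OF \<eta>'(1)] B_step_vanishing_MG20[OF \<pi>]
    have lim1: "(\<lambda>N. \<bar>\<sigma>_hi\<bar> * MG2_dist T (B_step (\<pi> N)) (\<eta> N)
        + cdist2 (step_integral T (B_step (\<pi> N))) ?Z) \<longlonglongrightarrow> 0"
      using tendsto_add[OF tendsto_mult_left[OF \<eta>'(2), of "\<bar>\<sigma>_hi\<bar>"] lim0] by simp
    have b: "0 \<le> cdist2 (step_integral T (\<eta> N)) ?Z \<and> cdist2 (step_integral T (\<eta> N)) ?Z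
        \<le> \<bar>\<sigma>_hi\<bar> * MG2_dist T (B_step (\<pi> N)) (\<eta> N)
            + cdist2 (step_integral T (B_step (\<pi> N))) ?Z" for N
    proof -
      obtain X where X: "X \<in> CS 2" "step_integral T (\<eta> N) = lg_class 2 X"
          using step_integral_LG[OF M(1)] by blast
      obtain Y where Y: "Y \<in> CS 2" "step_integral T (B_step (\<pi> N)) = lg_class 2 Y"
          using step_integral_LG[OF M(2)] by blast
      have "cdist2 (lg_class 2 X) ?Z \<le> cdist2 (lg_class 2 X) (lg_class 2 Y)
          + cdist2 (lg_class 2 Y) ?Z"
        "cdist2 (lg_class 2 X) (lg_class 2 Y) = cdist2 (lg_class 2 Y) (lg_class 2 X)"
            "0 \<le> cdist2 (lg_class 2 X) ?Z"
        unfolding lg_class_cls using X(1) Y(1) Z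
        by (auto intro!: L2.completion_dist_tri L2.completion_dist_commute
            L2.completion_dist_nonneg simp: L2_CS)
      moreover have "cdist2 (lg_class 2 Y) (lg_class 2 X)
          \<le> \<bar>\<sigma>_hi\<bar> * MG2_dist T (B_step (\<pi> N)) (\<eta> N)"
        using step_integral_dist[OF M(2) M(1), of N N] X(2) Y(2) by simp
      ultimately show ?thesis using X(2) Y(2) by simp
    qed
    show ?thesis by (rule LIMSEQ_0_dominated[OF lim1, of _ 1]) (use b in auto)
  qed
  show ?thesis
    unfolding ito_integral_def
  proof (rule the_equality)
    show "?Z \<in> LG_upto 2 T \<and> (\<forall>\<eta>\<in>B_process T. (\<lambda>N. cdist2 (step_integral T (\<eta> N)) ?Z) \<longlonglongrightarrow> 0)"
      using lim LG_uptoI[OF Z] B_dB_sum_Lip_upto[OF g(1)] g(2) by simp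
  next
    fix W assume W: "W \<in> LG_upto 2 T \<and> (\<forall>\<eta>\<in>B_process T. (\<lambda>N. cdist2 (step_integral T (\<eta> N)) W) \<longlonglongrightarrow> 0)"
    then obtain Y where Y: "Y \<in> CS 2" "W = lg_class 2 Y" using LG_uptoE by blast
    have "(\<lambda>N. B_step (\<pi> N)) \<in> B_process T"
      unfolding B_process_eq(2)[OF \<pi>] using MG.rel_refl[OF B_process_eq(1)[OF \<pi>]] by simp
    then have "(\<lambda>N. cdist2 (step_integral T (B_step (\<pi> N))) W) \<longlonglongrightarrow> 0"
      using bspec[OF conjunct2[OF W]] by simp
    from tendsto_add[OF this lim0]
    have l: "(\<lambda>N. cdist2 (step_integral T (B_step (\<pi> N))) W
        + cdist2 (step_integral T (B_step (\<pi> N))) ?Z) \<longlonglongrightarrow> 0" by simp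
    have "cdist2 W ?Z \<le> cdist2 (step_integral T (B_step (\<pi> N))) W
        + cdist2 (step_integral T (B_step (\<pi> N))) ?Z" for N
    proof -
      obtain X where X: "X \<in> CS 2" "step_integral T (B_step (\<pi> N)) = lg_class 2 X"
        using step_integral_LG[OF B_step_vanishing_MG20[OF \<pi>]] by blast
      have "cdist2 W ?Z \<le> cdist2 W (lg_class 2 X) + cdist2 (lg_class 2 X) ?Z"
          "cdist2 W (lg_class 2 X) = cdist2 (lg_class 2 X) W"
        unfolding Y(2) lg_class_cls using X(1) Y(1) Z
        by (auto intro!: L2.completion_dist_tri L2.completion_dist_commute simp: L2_CS)
      then show ?thesis using X(2) by simp
    qed
    then have "cdist2 W ?Z \<le> 0" by (intro LIMSEQ_le_const[OF l]) blast
    moreover have "0 \<le> cdist2 W ?Z"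
      unfolding Y(2) lg_class_cls using Y(1) Z
          by (intro L2.completion_dist_nonneg) (simp_all add: L2_CS)
    ultimately show "W = ?Z"
      unfolding Y(2) lg_class_cls using Y(1) Z
          by (intro L2.completion_dist_eq_0D) (simp_all add: L2_CS)
  qed
qed

subsection \<open>The quadratic variation\<close>

definition sq_var :: "real list \<Rightarrow> cpath \<Rightarrow> real" where
  "sq_var ts \<omega> = gsum (\<lambda>a b. (B b \<omega> - B a \<omega>)\<^sup>2) ts"

lemma sq_var_eq: "grid ts \<Longrightarrow> sq_var ts \<omega> = (B (last ts) \<omega>)\<^sup>2 - 2 * B_dB_sum ts \<omega>"
  using gsum_square[of ts "\<lambda>a. B a \<omega>"] by (simp add: sq_var_def B_dB_sum_def grid_def)

text \<open>For every \<open>N\<close> the sum of squared increments equals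
  \<open>(B T \<omega>)\<^sup>2\<close> minus twice the integral sum, exactly and not just in the
  limit, so the representatives on both sides coincide.\<close>

lemma QV_eq:
  assumes \<pi>: "vanishing_mesh T \<pi>"
  shows "(\<lambda>N. sq_var (\<pi> N)) \<in> CS 2" "QV T = lg_class 2 (\<lambda>N. sq_var (\<pi> N))"
proof -
  note g = vanishing_meshD(1,2)[OF \<pi>]
  have T: "0 \<le> T" using grid_last_nonneg[OF g(1), of 0] g(2) by simp
  have eq: "sq_var (\<pi> N) = (\<lambda>\<omega>. (B T \<omega>)\<^sup>2 - 2 * B_dB_sum (\<pi> N) \<omega>)" for N
    using sq_var_eq[OF g(1)] g(2) by (simp add: fun_eq_iff)
  have 1: "(\<lambda>N \<omega>. (B T \<omega>)\<^sup>2) \<in> CS 2" by (intro CS_const Lip_intros Lip_B T) simp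
  have 2: "(\<lambda>N \<omega>. 2 * B_dB_sum (\<pi> N) \<omega>) \<in> CS 2" by (intro CS_cmult B_dB_sum_CS[OF \<pi>]) simp
  show "(\<lambda>N. sq_var (\<pi> N)) \<in> CS 2" unfolding eq by (rule CS_diff[OF _ 1 2]) simp
  show "QV T = lg_class 2 (\<lambda>N. sq_var (\<pi> N))"
    unfolding QV_def ito_integral_B[OF \<pi>] lg_embed_def eq
    by (simp add: lg_scale_class B_dB_sum_CS[OF \<pi>] lg_diff_class 1 2)
qed

section \<open>Partitions with vanishing mesh and their concatenation\<close>

lemma vanishing_mesh_exists:
  assumes "0 \<le> T"
  obtains \<pi> where "vanishing_mesh T \<pi>"
proof (cases "T = 0")
  case True
  then have "vanishing_mesh T (\<lambda>_. [0])" by (simp add: vanishing_mesh_def grid_def)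
  then show thesis by (rule that)
next
  case False
  then have T: "0 < T" using assms by simp
  \<comment> \<open>The uniform partition into \<open>N + 1\<close> cells, so that
    \<open>N = 0\<close> causes no division by 0.\<close>
  define \<pi> where "\<pi> N = map (\<lambda>k. real k * (T / real (Suc N))) [0..<Suc (Suc N)]" for N
  have d: "0 < T / real (Suc N)" for N using T by simp
  have "grid (\<pi> N)" for N
    unfolding grid_def
  proof (intro conjI)
    show "\<pi> N \<noteq> []" by (simp add: \<pi>_def)
    show "hd (\<pi> N) = 0" by (simp add: \<pi>_def upt_rec)
    show "sorted_wrt (<) (\<pi> N)"
      unfolding sorted_wrt_iff_nth_less
    proof (intro allI impI)
      fix i j assume ij: "i < j" "j < length (\<pi> N)"
      then have "\<pi> N ! i = real i * (T / real (Suc N))" "\<pi> N ! j = real j * (T / real (Suc N))"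
        unfolding \<pi>_def by (simp_all del: upt_Suc of_nat_Suc)
      then show "\<pi> N ! i < \<pi> N ! j" using ij(1) d[of N]
          by (simp only: mult_less_cancel_right_pos of_nat_less_iff)
    qed
  qed
  moreover have "last (\<pi> N) = T" for N by (simp add: \<pi>_def)
  moreover have "\<forall>\<^sub>F N in sequentially. \<forall>k<length (\<pi> N) - 1. \<pi> N ! Suc k - \<pi> N ! k < e" if e: "0
      < e" for e
  proof -
    have "(\<lambda>N. T / real (Suc N)) \<longlonglongrightarrow> 0" using LIMSEQ_Suc[OF lim_const_over_n[of T]] by simp
    then have "\<forall>\<^sub>F N in sequentially. T / real (Suc N) < e" using e by (rule order_tendstoD(2))
    moreover have "\<pi> N ! Suc k - \<pi> N ! k = T / real (Suc N)" if "k < length (\<pi> N) - 1" for N k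
    proof -
      have k: "k < Suc N" using that by (simp add: \<pi>_def)
      have "\<pi> N ! Suc k = real (Suc k) * (T / real (Suc N))" "\<pi> N ! k = real k * (T / real (Suc N))"
        unfolding \<pi>_def using k by (simp_all del: upt_Suc of_nat_Suc)
      then show ?thesis by (simp add: algebra_simps add_divide_distrib)
    qed
    ultimately show ?thesis by (auto elim!: eventually_mono)
  qed
  ultimately have "vanishing_mesh T \<pi>" unfolding vanishing_mesh_def by blast
  then show thesis by (rule that)
qed

text \<open>\<open>tl us\<close> drops the initial 0 of \<open>us\<close>, whose shifted copy would
  repeat \<open>last ts\<close>.\<close>

definition grid_append :: "real list \<Rightarrow> real list \<Rightarrow> real list" where
  "grid_append ts us = ts @ map (\<lambda>t. t + last ts) (tl us)"

lemma cpairs_grid_append: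
  assumes "grid ts" "grid us"
  shows "cpairs (grid_append ts us) = cpairs ts @ cpairs (map (\<lambda>t. t + last ts) us)"
proof -
  obtain bs where us: "us = 0 # bs" using assms(2) unfolding grid_def by (cases us) auto
  obtain as a where ts: "ts = as @ [a]" using assms(1) unfolding grid_def by (metis rev_exhaust)
  show ?thesis using cpairs_append[of as a "map (\<lambda>t. t + a) bs"]
      by (simp add: grid_append_def us ts)
qed

lemma grid_grid_append:
  assumes "grid ts" "grid us"
  shows "grid (grid_append ts us)" "last (grid_append ts us) = last ts + last us"
proof -
  obtain bs where us: "us = 0 # bs" using assms(2) unfolding grid_def by (cases us) auto
  have bs: "0 < b" "sorted_wrt (<) bs" if "b \<in> set bs" for b using assms(2) that
      unfolding us grid_def by auto
  have "sorted_wrt (<) (grid_append ts us)"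
    unfolding grid_append_def sorted_wrt_append
  proof (intro conjI ballI)
    show "sorted_wrt (<) ts" using assms(1) by (rule grid_sorted)
    show "sorted_wrt (<) (map (\<lambda>t. t + last ts) (tl us))"
      using assms(2) unfolding us grid_def by (simp add: sorted_wrt_map)
    fix x y assume x: "x \<in> set ts" and y: "y \<in> set (map (\<lambda>t. t + last ts) (tl us))"
    then obtain b where "b \<in> set bs" "y = b + last ts" by (auto simp: us)
    then show "x < y" using grid_le_last[OF assms(1) x] bs(1) by fastforce
  qed
  then show "grid (grid_append ts us)" using assms(1) by (auto simp: grid_def grid_append_def)
  show "last (grid_append ts us) = last ts + last us"
      by (simp add: grid_append_def us last_map add.commute)
qed

lemma sq_var_grid_append:
  assumes "grid ts" "grid us"
  shows "sq_var (grid_append ts us) \<omega> = sq_var ts \<omega> + sq_var (map (\<lambda>t. t + last ts) us) \<omega>"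
  by (simp add: sq_var_def gsum_def cpairs_grid_append[OF assms])

lemma vanishing_mesh_grid_append:
  assumes \<pi>: "vanishing_mesh s \<pi>" and \<rho>: "vanishing_mesh t \<rho>"
  shows "vanishing_mesh (s + t) (\<lambda>N. grid_append (\<pi> N) (\<rho> N))"
  unfolding vanishing_mesh_def eventually_sequentially
proof (intro conjI allI impI)
  note g = vanishing_meshD(1,2)[OF \<pi>] vanishing_meshD(1,2)[OF \<rho>]
  show "grid (grid_append (\<pi> N) (\<rho> N))" "last (grid_append (\<pi> N) (\<rho> N)) = s + t" for N
    using grid_grid_append[OF g(1,3)] g(2,4) by simp_all
  fix e :: real assume e: "0 < e"
  obtain N1 where N1: "\<And>N a b. N \<ge> N1 \<Longrightarrow> (a, b) \<in> set (cpairs (\<pi> N)) \<Longrightarrow> b - a < e"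
    using vanishing_meshD(3)[OF \<pi> e] by blast
  obtain N2 where N2: "\<And>N a b. N \<ge> N2 \<Longrightarrow> (a, b) \<in> set (cpairs (\<rho> N)) \<Longrightarrow> b - a < e"
    using vanishing_meshD(3)[OF \<rho> e] by blast
  have "b - a < e" if "N \<ge> max N1 N2" "(a, b) \<in> set (cpairs (grid_append (\<pi> N) (\<rho> N)))" for N a b
    using that N1 N2 unfolding cpairs_grid_append[OF g(1,3)] by (auto simp: cpairs_map)
  then show "\<exists>N. \<forall>n\<ge>N. \<forall>k<length (grid_append (\<pi> n) (\<rho> n)) - 1. grid_append (\<pi> n) (\<rho> n) ! Suc k
      - grid_append (\<pi> n) (\<rho> n) ! k < e"
    by (intro exI[of _ "max N1 N2"]) (auto simp: cpairs_iff)
qed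

text \<open>After time \<open>s\<close> the increments of the concatenated path are those of
  \<omega>', whatever \<omega> is; both the law of the increment and its independence come down to
  this identity.\<close>

lemma sq_var_conc:
  assumes s: "0 \<le> s" and g: "grid us"
  shows "sq_var (map (\<lambda>t. t + s) us) (conc s \<omega> \<omega>') = sq_var us \<omega>'"
  unfolding sq_var_def gsum_map
proof (rule gsum_cong)
  fix a b assume "(a, b) \<in> set (cpairs us)"
  from grid_cpairsD(1,2)[OF g this] s
  show "(B (b + s) (conc s \<omega> \<omega>') - B (a + s) (conc s \<omega> \<omega>'))\<^sup>2 = (B b \<omega>' - B a \<omega>')\<^sup>2"
    by (simp add: B_conc_ge)
qed

section \<open>Law and conditional law of the increment of the quadratic variation\<close>

theorem QV_increment:
  assumes s: "0 \<le> s" and t: "0 \<le> t"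
  shows "identically_distributed (lg_incl (lg_diff 2 (QV (s + t)) (QV s))) (lg_incl (QV t))"
    and "independent_from_past s (lg_incl (lg_diff 2 (QV (s + t)) (QV s)))"
proof -
  obtain \<pi> where \<pi>: "vanishing_mesh s \<pi>" using vanishing_mesh_exists[OF s] .
  obtain \<rho> where \<rho>: "vanishing_mesh t \<rho>" using vanishing_mesh_exists[OF t] .
  note g = vanishing_meshD(1,2)[OF \<pi>] vanishing_meshD(1,2)[OF \<rho>]
  define S where "S N = sq_var (map (\<lambda>u. u + s) (\<rho> N))" for N
  define Q where "Q N = sq_var (\<rho> N)" for N
  note QVst = QV_eq[OF vanishing_mesh_grid_append[OF \<pi> \<rho>]]
  have diff: "(\<lambda>N \<omega>. sq_var (grid_append (\<pi> N) (\<rho> N)) \<omega> - sq_var (\<pi> N) \<omega>) = S"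
    using sq_var_grid_append[OF g(1,3)] g(2) by (simp add: S_def fun_eq_iff)
  have S2: "S \<in> CS 2" using CS_diff[OF _ QVst(1) QV_eq(1)[OF \<pi>]] diff by simp
  have Q2: "Q \<in> CS 2" using QV_eq(1)[OF \<rho>] by (simp add: Q_def[abs_def])
  have S1: "S \<in> CS 1" and Q1: "Q \<in> CS 1" using S2 Q2 by (auto intro: CS_2_1)
  have incr: "lg_incl (lg_diff 2 (QV (s + t)) (QV s)) = lg_class 1 S"
    using lg_diff_class[OF _ QVst(1) QV_eq(1)[OF \<pi>]] QVst(2) QV_eq(2)[OF \<pi>] diff lg_incl_class[OF
        S2] by simp
  have QVt: "lg_incl (QV t) = lg_class 1 Q"
    using QV_eq(2)[OF \<rho>] lg_incl_class[OF Q2] by (simp add: Q_def[abs_def])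
  have conc: "S N (conc s \<omega> \<omega>') = Q N \<omega>'" for N \<omega> \<omega>'
    unfolding S_def Q_def by (rule sq_var_conc[OF s g(3)])
  have \<phi>: "lg_E (lg_comp \<phi> (lg_class 1 S)) = lg_E (lg_comp \<phi> (lg_class 1 Q)) \<and>
      lg_cond s (lg_comp \<phi> (lg_class 1 S)) = lg_embed 1 (\<lambda>_. lg_E (lg_comp \<phi> (lg_class 1 S)))"
    if "\<phi> \<in> CbLip" for \<phi>
  proof -
    obtain L where L: "L-lipschitz_on UNIV \<phi>" using \<open>\<phi> \<in> CbLip\<close> unfolding CbLip_def by blast
    \<comment> \<open>One sequence of numbers plays three parts: the expectations for
      \<open>Q\<close>, the conditional expectations for \<open>S\<close>, which turn out to be
      constant, and by the tower property the expectations for \<open>S\<close>.\<close>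
    define c where "c N = Ehat (\<lambda>\<omega>. \<phi> (Q N \<omega>))" for N
    note S\<phi> = CS_lipschitz[OF L S1] and Q\<phi> = CS_lipschitz[OF L Q1]
    have cond: "Ehat_cond s (\<lambda>\<omega>. \<phi> (S N \<omega>)) = (\<lambda>_. c N)" for N
      unfolding Ehat_cond_eq[OF CS_mem[OF S\<phi>] s] conc c_def ..
    have "Ehat (\<lambda>\<omega>. \<phi> (S N \<omega>)) = c N" for N
      using Ehat_tower[OF CS_mem[OF S\<phi>] s, of N] cond[of N] Ehat_cond_eq[OF CS_mem[OF S\<phi>] s, of N]
      by (simp add: Ehat_const)
    then have limS: "c \<longlonglongrightarrow> lg_E (lg_comp \<phi> (lg_class 1 S))"
      using lg_E_class[OF S\<phi>] lg_comp_class[OF L S1] by simp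
    have limQ: "c \<longlonglongrightarrow> lg_E (lg_comp \<phi> (lg_class 1 Q))"
      using lg_E_class[OF Q\<phi>] lg_comp_class[OF L Q1] by (simp add: c_def[abs_def])
    let ?e = "lg_E (lg_comp \<phi> (lg_class 1 S))"
    \<comment> \<open>A convergent sequence of constants represents the same element as its limit,
      so the conditional expectation is the class of the constant \<open>?e\<close>.\<close>
    have "(\<lambda>N _. c N) \<in> CS 1"
    proof (rule CS_dominated[OF _ _ Q\<phi>, of _ _ 1])
      fix m n
      have "nrm 1 (\<lambda>_. c m - c n) = \<bar>c m - c n\<bar>" by (rule nrm_const)
      then show "nrm 1 (\<lambda>_. c m - c n) \<le> 1 * nrm 1 (\<lambda>\<omega>. \<phi> (Q m \<omega>) - \<phi> (Q n \<omega>))"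
        unfolding c_def using Ehat_diff_le[OF CS_mem[OF Q\<phi>] CS_mem[OF Q\<phi>]] by simp
    qed (auto intro: Lip_intros)
    moreover have "(\<lambda>_ _. ?e) \<in> CS 1" by (intro CS_const Lip_intros) simp
    moreover have "(\<lambda>N. nrm 1 (\<lambda>_. c N - ?e)) \<longlonglongrightarrow> 0"
      unfolding nrm_const using tendsto_rabs_zero[OF LIM_zero[OF limS]] .
    ultimately have "lg_class 1 (\<lambda>N _. c N) = lg_class 1 (\<lambda>_ _. ?e)"
      by (subst lg_class_eq_iff) simp_all
    moreover have "lg_cond s (lg_comp \<phi> (lg_class 1 S)) = lg_class 1 (\<lambda>N _. c N)"
      by (simp add: lg_comp_class[OF L S1] lg_cond_class[OF s S\<phi>] cond)
    ultimately show ?thesis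
      using LIMSEQ_unique[OF limS limQ] by (simp add: lg_embed_def)
  qed
  show "identically_distributed (lg_incl (lg_diff 2 (QV (s + t)) (QV s))) (lg_incl (QV t))"
    unfolding identically_distributed_def incr QVt using \<phi> lg_class_LG S1 Q1 by simp
  show "independent_from_past s (lg_incl (lg_diff 2 (QV (s + t)) (QV s)))"
    unfolding independent_from_past_def incr using \<phi> lg_class_LG S1 by simp
qed

end

theorem lemma4p2:
  fixes H :: "('a \<Rightarrow> real) set" and E :: "('a \<Rightarrow> real) \<Rightarrow> real" and \<xi> :: "nat \<Rightarrow> 'a \<Rightarrow> real"
    and \<sigma>_lo \<sigma>_hi s t :: real
  assumes "0 \<le> \<sigma>_lo" and "\<sigma>_lo \<le> \<sigma>_hi"
    and "sublinear_expectation_space H E"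
    and "\<And>i. G_normal H E (G_fun \<sigma>_lo \<sigma>_hi) (\<xi> i)"
    and "\<And>i. independent_from E (map \<xi> [0..<Suc i]) (\<xi> (Suc i))"
    and "0 \<le> s" and "0 \<le> t"
  shows "G_expectation.identically_distributed E \<xi>
           (G_expectation.lg_incl E \<xi>
              (G_expectation.lg_diff E \<xi> 2 (G_expectation.QV E \<xi> (s + t)) (G_expectation.QV E \<xi> s)))
           (G_expectation.lg_incl E \<xi> (G_expectation.QV E \<xi> t))
       \<and> G_expectation.independent_from_past E \<xi> s
           (G_expectation.lg_incl E \<xi>
              (G_expectation.lg_diff E \<xi> 2 (G_expectation.QV E \<xi> (s + t)) (G_expectation.QV E \<xi> s)))"
proof -
  interpret sublinear_expectation_space H E by (rule assms(3))
  interpret G_setting H E \<xi> \<sigma>_lo \<sigma>_hi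
    by unfold_locales (rule assms(4,5))+
  show ?thesis using QV_increment[OF assms(6,7)] by blast
qed

end
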